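(* Let $f:2^{\mathcal U}\to\mathbb{R}_{\ge0}$ be submodular on a ground set $\mathcal U$ with $|\mathcal U|=n$, given by a value oracle, let $0<\epsilon<1$, let $k$ be a positive integer and $O\in\arg\max_{S\subseteq\mathcal U,|S|\le k}f(S)$. Let $\ell$ be a positive integer with $\ell=O(\epsilon^{-1})$ and $\ell\ge\frac{4}{e\epsilon}$, and suppose $k\ge\frac{(2-\epsilon)^2\ell}{e\epsilon\ell-4}$. There is a randomized algorithm (the paper's ParallelInterpolatedGreedy) which, on input $(f,k,\epsilon)$ with parameter $\ell$, returns a set $G\subseteq\mathcal U$ with $|G|\le k$ and $\mathbb{E}[f(G)]\ge(1/e-\epsilon)f(O)$, and with probability $1-O(1/(\epsilon n))$ uses $O(\epsilon^{-5}\log(n)\log(k))$ adaptive rounds and $O(\epsilon^{-6}n\log(n)\log(k))$ oracle queries.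
   Context: A set function $f$ is submodular if $f(X)+f(Y)\ge f(X\cup Y)+f(X\cap Y)$ for all $X,Y$; $f$ is not assumed monotone. Query complexity is the total number of evaluations of $f$. Adaptive rounds: the oracle queries of the algorithm are partitioned into sequential rounds, such that the sets queried in a round may depend only on answers to queries from earlier rounds; adaptivity is the number of rounds. Expectation is over the algorithm's random choices. *)

theory Defs
  imports "HOL-Probability.Probability"
begin

definition submodular_on :: "'a set \<Rightarrow> ('a set \<Rightarrow> real) \<Rightarrow> bool" where
  "submodular_on U f \<longleftrightarrow>
     (\<forall>X Y. X \<subseteq> U \<longrightarrow> Y \<subseteq> U \<longrightarrow> f X + f Y \<ge> f (X \<union> Y) + f (X \<inter> Y))"

text \<open>
  Randomized parallel algorithms with access to a set-function oracle, as decision trees.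
  \<open>Query Qs c\<close> is one adaptive round: the whole batch \<open>Qs\<close> is fixed before any of its answers
  is known, and the algorithm continues as \<open>c ys\<close>, where \<open>ys\<close> lists the answers. The tree does not
  mention the oracle function, so the answers are the only information about it.
\<close>

datatype 'a oracle_alg =
    Return "'a set"
  | Flip "'a oracle_alg pmf"
  | Query "'a set list" "real list \<Rightarrow> 'a oracle_alg"

inductive queries_within :: "'a set \<Rightarrow> 'a oracle_alg \<Rightarrow> bool" for U where
  "queries_within U (Return G)"
| "(\<forall>A\<in>set_pmf p. queries_within U A) \<Longrightarrow> queries_within U (Flip p)"
| "(\<forall>Q\<in>set Qs. Q \<subseteq> U) \<Longrightarrow> (\<forall>ys. queries_within U (c ys)) \<Longrightarrow> queries_within U (Query Qs c)"

text \<open>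
  Joint distribution of (returned set, number of adaptive rounds, number of oracle queries);
  repeated evaluations of the same set are counted each time.
\<close>

primrec run :: "('a set \<Rightarrow> real) \<Rightarrow> 'a oracle_alg \<Rightarrow> ('a set \<times> nat \<times> nat) pmf" where
  "run f (Return G) = return_pmf (G, 0, 0)"
| "run f (Flip p) = join_pmf (map_pmf (run f) p)"
| "run f (Query Qs c) =
     map_pmf (\<lambda>(G, r, q). (G, r + 1, q + length Qs)) (run f (c (map f Qs)))"

end

theory Submission
  imports Defs
begin

text \<open>
  The solution is built in stages. A stage replaces \<open>G\<close> by a random \<open>G'\<close> such that, with
  \<open>t = 1 - 1 / l\<close>, every element joins with probability at most \<open>1 / l\<close>, hence
  \<open>E f(O \<union> G') \<ge> t f(O \<union> G)\<close>, and \<open>E f(G') \<ge> t f(G) + (\<beta> / l) t\<^sup>2 f(O \<union> G)\<close>. After \<open>l\<close> stages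
  this yields \<open>\<beta> t^(l+1) f(O)\<close>, which tends to \<open>f(O) / e\<close>.

  If \<open>k\<close> is at most of order \<open>ln k / \<epsilon>^3\<close>, a stage is one step of random greedy and \<open>l = k\<close>.
  Otherwise \<open>l\<close> is about \<open>2 / \<epsilon>\<close>, and a stage considers about \<open>k\<close> elements in blocks of size \<open>l\<close>, one
  random member of each block being accepted. The blocks are random subsets of the candidates whose
  marginal gain exceeds a threshold, and the threshold decreases geometrically. Many blocks are
  drawn at once; the longest useful prefix is found by testing prefixes of geometrically growing
  length, and a batch ends as soon as a \<open>\<delta>\<close>-fraction of the candidates has dropped below the
  threshold. Before that moment a random block is mostly good, so the expected gain of an accepted
  element is nearly the threshold; and each batch shrinks the candidates by a constant factor, so
  both costs are bounded in the worst case and not only with high probability.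
\<close>

section \<open>Algorithms in continuation-passing style\<close>

text \<open>Without monotonicity a stage may spoil f(O \<union> G). The cure is that no element
  joins with probability above 1 / l. The events for different elements may depend on each other
  arbitrarily, so a block may be picked from jointly, but an element must not be offered twice
  within a stage. Two quantities are followed through a stage: \<open>risk\<close> as a
  supermartingale, and \<open>surplus\<close>, the value of the output minus a fixed rate times the
  credit, as a submartingale. At the end of the stage the credit bounds, up to
  \<open>(1 - \<delta>)\<^sup>2\<close>, the gain of adding O to \<open>taken\<close>. This bound
  refers to the end of the stage, where the value of the output is itself unknown. That value
  therefore occurs on both sides of the inequality, and solving for it produces the second factor t
  in \<open>t\<^sup>2\<close>. A batch fits into one round because its randomness never depends on
  the answers.\<close>

abbreviation expect :: "'b pmf \<Rightarrow> ('b \<Rightarrow> real) \<Rightarrow> real" where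
  "expect p h \<equiv> measure_pmf.expectation p h"

text \<open>
  Intersecting with \<open>U\<close> keeps every query legal even along branches whose answers no set function
  produces.
\<close>

definition ask :: "'a set \<Rightarrow> 'a set list \<Rightarrow> (('a set \<Rightarrow> real) \<Rightarrow> 'b) \<Rightarrow> ('b \<Rightarrow> 'a oracle_alg) \<Rightarrow> 'a oracle_alg" where
  "ask U Qs h c = Query (map (\<lambda>S. S \<inter> U) Qs)
     (\<lambda>ys. c (h (\<lambda>S. case map_of (zip Qs ys) S of Some y \<Rightarrow> y | None \<Rightarrow> 0)))"

definition flip :: "'b pmf \<Rightarrow> ('b \<Rightarrow> 'a oracle_alg) \<Rightarrow> 'a oracle_alg" where
  "flip p c = Flip (map_pmf c p)"

text \<open>Kept apart from \<open>realizes\<close>: legality concerns every list of answers,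
  whereas \<open>realizes\<close> follows only the answers given by \<open>f\<close>.\<close>

definition safe :: "'a set \<Rightarrow> (('b \<Rightarrow> 'a oracle_alg) \<Rightarrow> 'a oracle_alg) \<Rightarrow> bool" where
  "safe U P \<longleftrightarrow> (\<forall>c. (\<forall>b. queries_within U (c b)) \<longrightarrow> queries_within U (P c))"

definition cost_le :: "('a set \<Rightarrow> real) \<Rightarrow> 'a oracle_alg \<Rightarrow> real \<Rightarrow> real \<Rightarrow> bool" where
  "cost_le f A R Q \<longleftrightarrow> (\<forall>(G, r, q) \<in> set_pmf (run f A). real r \<le> R \<and> real q \<le> Q)"

definition result :: "('a set \<Rightarrow> real) \<Rightarrow> 'a oracle_alg \<Rightarrow> 'a set pmf" where
  "result f A = map_pmf fst (run f A)"

text \<open>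
  \<open>D\<close> is the law of the value that \<open>P\<close> hands to its continuation; \<open>R\<close> and \<open>Q\<close> bound the rounds and
  the queries spent by \<open>P\<close> itself.
\<close>

definition realizes :: "('a set \<Rightarrow> real) \<Rightarrow> (('b \<Rightarrow> 'a oracle_alg) \<Rightarrow> 'a oracle_alg) \<Rightarrow> 'b pmf \<Rightarrow> real \<Rightarrow> real \<Rightarrow> bool" where
  "realizes f P D R Q \<longleftrightarrow>
     (\<forall>c. result f (P c) = bind_pmf D (\<lambda>b. result f (c b))) \<and>
     (\<forall>c r q. (\<forall>b\<in>set_pmf D. cost_le f (c b) r q) \<longrightarrow> cost_le f (P c) (R + r) (Q + q))"

section \<open>Composition rules for legality, output law and cost\<close>

lemma safe_ask: "safe U (ask U Qs h)"
  unfolding safe_def ask_def by (auto intro!: queries_within.intros)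

lemma safe_flip: "safe U (flip p)"
  unfolding safe_def flip_def by (auto intro!: queries_within.intros)

lemma safe_bind: "safe U P \<Longrightarrow> (\<And>b. safe U (P' b)) \<Longrightarrow> safe U (\<lambda>c. P (\<lambda>b. P' b c))"
  unfolding safe_def by simp

lemma safe_return: "safe U (\<lambda>c. c b)"
  unfolding safe_def by blast

lemma realizesI:
  assumes "\<And>c. result f (P c) = bind_pmf D (\<lambda>b. result f (c b))"
    and "\<And>c r q. (\<And>b. b \<in> set_pmf D \<Longrightarrow> cost_le f (c b) r q) \<Longrightarrow> cost_le f (P c) (R + r) (Q + q)"
  shows "realizes f P D R Q"
  unfolding realizes_def
proof (intro conjI allI impI)
  show "result f (P c) = bind_pmf D (\<lambda>b. result f (c b))" for c by (rule assms(1))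
  show "cost_le f (P c) (R + r) (Q + q)" if "\<forall>b\<in>set_pmf D. cost_le f (c b) r q" for c r q
    by (rule assms(2)) (rule bspec[OF that])
qed

lemma realizes_result:
  "realizes f P D R Q \<Longrightarrow> result f (P c) = bind_pmf D (\<lambda>b. result f (c b))"
  unfolding realizes_def by (elim conjE) (erule spec)

lemma realizes_cost:
  assumes "realizes f P D R Q" "\<And>b. b \<in> set_pmf D \<Longrightarrow> cost_le f (c b) r q"
  shows "cost_le f (P c) (R + r) (Q + q)"
proof -
  have "\<forall>c r q. (\<forall>b\<in>set_pmf D. cost_le f (c b) r q) \<longrightarrow> cost_le f (P c) (R + r) (Q + q)"
    using assms(1) unfolding realizes_def by (rule conjunct2)
  from this[rule_format, of c r q] assms(2) show ?thesis .
qed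

lemma realizes_return: "realizes f (\<lambda>c. c b) (return_pmf b) 0 0"
  by (rule realizesI) (simp_all add: bind_return_pmf)

text \<open>The function rebuilt from the answers is 0 off the queried sets. The second hypothesis
  says that \<open>h\<close> depends on the queried values alone, so \<open>h\<close> cannot tell it
  from \<open>f\<close>.\<close>

lemma realizes_ask:
  assumes "\<And>S. S \<in> set Qs \<Longrightarrow> S \<subseteq> U"
    and "\<And>g. (\<And>S. S \<in> set Qs \<Longrightarrow> g S = f S) \<Longrightarrow> h g = h f"
  shows "realizes f (ask U Qs h) (return_pmf (h f)) 1 (real (length Qs))"
proof -
  have "h (\<lambda>S. case map_of (zip Qs (map (f \<circ> (\<lambda>S. S \<inter> U)) Qs)) S of Some y \<Rightarrow> y | None \<Rightarrow> 0) = h f"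
    by (rule assms(2)) (simp add: map_of_zip_map assms(1) Int_absorb2)
  then have run: "run f (ask U Qs h c) = map_pmf (\<lambda>(G, r, q). (G, r + 1, q + length Qs)) (run f (c (h f)))" for c
    unfolding ask_def by simp
  show ?thesis
  proof (rule realizesI)
    fix c
    show "result f (ask U Qs h c) = bind_pmf (return_pmf (h f)) (\<lambda>b. result f (c b))"
      unfolding result_def run map_pmf_comp by (simp add: case_prod_beta bind_return_pmf)
  next
    fix c r q
    assume "\<And>b. b \<in> set_pmf (return_pmf (h f)) \<Longrightarrow> cost_le f (c b) r q"
    then have "cost_le f (c (h f)) r q" by simp
    then show "cost_le f (ask U Qs h c) (1 + r) (real (length Qs) + q)"
      unfolding cost_le_def run by auto
  qed
qed

lemma run_flip: "run f (flip p c) = bind_pmf p (\<lambda>b. run f (c b))"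
  by (simp add: flip_def join_pmf_def bind_map_pmf)

lemma realizes_flip: "realizes f (flip p) p 0 0"
proof (rule realizesI)
  show "result f (flip p c) = bind_pmf p (\<lambda>b. result f (c b))" for c
    by (simp add: result_def run_flip map_bind_pmf)
  show "cost_le f (flip p c) (0 + r) (0 + q)" if "\<And>b. b \<in> set_pmf p \<Longrightarrow> cost_le f (c b) r q" for c r q
    using that unfolding cost_le_def run_flip by fastforce
qed

lemma realizes_bind:
  assumes P: "realizes f P D R Q" and P': "\<And>b. b \<in> set_pmf D \<Longrightarrow> realizes f (P' b) (D' b) R' Q'"
  shows "realizes f (\<lambda>c. P (\<lambda>b. P' b c)) (bind_pmf D D') (R + R') (Q + Q')"
proof (rule realizesI)
  fix c
  have "result f (P (\<lambda>b. P' b c)) = bind_pmf D (\<lambda>b. result f (P' b c))"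
    by (rule realizes_result[OF P])
  also have "\<dots> = bind_pmf D (\<lambda>b. bind_pmf (D' b) (\<lambda>b. result f (c b)))"
    by (intro bind_pmf_cong refl realizes_result[OF P'])
  finally show "result f (P (\<lambda>b. P' b c)) = bind_pmf (bind_pmf D D') (\<lambda>b. result f (c b))"
    by (simp add: bind_assoc_pmf)
next
  fix c r q
  assume c: "\<And>b. b \<in> set_pmf (bind_pmf D D') \<Longrightarrow> cost_le f (c b) r q"
  have "cost_le f (P (\<lambda>b. P' b c)) (R + (R' + r)) (Q + (Q' + q))"
    by (rule realizes_cost[OF P], rule realizes_cost[OF P'], assumption, rule c) auto
  then show "cost_le f (P (\<lambda>b. P' b c)) (R + R' + r) (Q + Q' + q)"
    by (simp add: add.assoc)
qed

lemma cost_le_mono: "cost_le f A r q \<Longrightarrow> r \<le> r' \<Longrightarrow> q \<le> q' \<Longrightarrow> cost_le f A r' q'"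
  unfolding cost_le_def by fastforce

lemma realizes_mono:
  assumes "realizes f P D R Q" "R \<le> R'" "Q \<le> Q'"
  shows "realizes f P D R' Q'"
proof (rule realizesI)
  show "result f (P c) = bind_pmf D (\<lambda>b. result f (c b))" for c
    by (rule realizes_result[OF assms(1)])
  show "cost_le f (P c) (R' + r) (Q' + q)" if "\<And>b. b \<in> set_pmf D \<Longrightarrow> cost_le f (c b) r q" for c r q
    by (rule cost_le_mono[OF realizes_cost[OF assms(1)]]) (use that assms in auto)
qed

section \<open>Submodular functions and random subsets\<close>

text \<open>Finite support settles integrability, here and in the rules for monotonicity and
  linearity below.\<close>

lemma expect_bind:
  fixes h :: "'b \<Rightarrow> real"
  assumes "finite (set_pmf p)" "\<And>x. x \<in> set_pmf p \<Longrightarrow> finite (set_pmf (g x))"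
  shows "expect (bind_pmf p g) h = expect p (\<lambda>x. expect (g x) h)"
  using pmf_expectation_bind[of "set_pmf p" g p h] integral_measure_pmf[of "set_pmf p" p "\<lambda>x. expect (g x) h"] assms
  by simp

lemma expect_mono:
  assumes "finite (set_pmf p)" "\<And>x. x \<in> set_pmf p \<Longrightarrow> g x \<le> h x"
  shows "expect p g \<le> expect p h"
  using assms by (intro integral_mono_AE integrable_measure_pmf_finite) (auto simp: AE_measure_pmf_iff)

lemma expect_cong:
  "(\<And>x. x \<in> set_pmf p \<Longrightarrow> g x = h x) \<Longrightarrow> expect p g = expect p h"
  by (intro integral_cong_AE) (auto simp: AE_measure_pmf_iff)

lemma expect_affine:
  fixes g h :: "'b \<Rightarrow> real"
  assumes "finite (set_pmf p)"
  shows "expect p (\<lambda>x. g x + h x) = expect p g + expect p h"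
    and "expect p (\<lambda>x. g x - h x) = expect p g - expect p h"
  using assms by (auto intro!: Bochner_Integration.integral_add Bochner_Integration.integral_diff integrable_measure_pmf_finite)

lemma expect_sum:
  assumes "finite (set_pmf p)"
  shows "expect p (\<lambda>x. \<Sum>i\<in>I. g i x) = (\<Sum>i\<in>I. expect p (g i))"
  using assms by (intro Bochner_Integration.integral_sum integrable_measure_pmf_finite)

definition gain :: "('a set \<Rightarrow> real) \<Rightarrow> 'a set \<Rightarrow> 'a \<Rightarrow> real" where
  "gain f X v = f (insert v X) - f X"

abbreviation gain_pos :: "('a set \<Rightarrow> real) \<Rightarrow> 'a set \<Rightarrow> 'a \<Rightarrow> real" where
  "gain_pos f X v \<equiv> max 0 (gain f X v)"

lemma gain_mem: "v \<in> X \<Longrightarrow> gain f X v = 0"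
  by (simp add: gain_def insert_absorb)

locale submodular_fun =
  fixes U :: "'a set" and f :: "'a set \<Rightarrow> real"
  assumes finite_ground: "finite U"
    and nonneg: "\<And>S. S \<subseteq> U \<Longrightarrow> 0 \<le> f S"
    and submodular: "submodular_on U f"
begin

lemma gain_antimono:
  assumes "X \<subseteq> Y" "Y \<subseteq> U" "v \<in> U" "v \<notin> Y"
  shows "gain f Y v \<le> gain f X v"
proof -
  have "f (insert v X) + f Y \<ge> f (insert v X \<union> Y) + f (insert v X \<inter> Y)"
    by (rule submodular[unfolded submodular_on_def, rule_format]) (use assms in auto)
  moreover have "insert v X \<union> Y = insert v Y" "insert v X \<inter> Y = X"
    using assms by auto
  ultimately show ?thesis by (simp add: gain_def)
qed

text \<open>Joining a set lifts a negative gain to 0. Truncation at 0 absorbs this jump, so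
  antitonicity also holds for elements of \<open>Y\<close>.\<close>

lemma gain_pos_antimono:
  assumes "X \<subseteq> Y" "Y \<subseteq> U" "v \<in> U"
  shows "gain_pos f Y v \<le> gain_pos f X v"
  using gain_antimono[OF assms] gain_mem[of v Y f] by (cases "v \<in> Y") auto

lemma union_le_sum_gain_pos:
  assumes "Z \<subseteq> U" "X \<subseteq> U"
  shows "f (Z \<union> X) - f X \<le> (\<Sum>z\<in>Z. gain_pos f X z)"
proof -
  have "finite Z" using assms finite_ground finite_subset by blast
  then show ?thesis using assms
  proof (induction Z)
    case (insert z Z)
    have "f (insert z Z \<union> X) - f (Z \<union> X) = gain f (Z \<union> X) z" by (simp add: gain_def)
    also have "\<dots> \<le> gain_pos f (Z \<union> X) z" by simp
    also have "\<dots> \<le> gain_pos f X z" using insert by (intro gain_pos_antimono) auto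
    finally show ?case using insert by simp
  qed simp
qed

text \<open>Elements are added in order of decreasing inclusion probability, as in the convexity
  argument for the Lovasz extension. By submodularity an element contributes at least its
  probability times its gain at the full union so far. Abel summation leaves nonnegative multiples
  of values of \<open>f\<close>, of which only \<open>(1 - \<rho>) * f S\<close> is kept. The joint
  law of the inclusions does not enter.\<close>

lemma random_union_ge:
  assumes fin: "finite (set_pmf p)" and sub: "\<And>x. x \<in> set_pmf p \<Longrightarrow> A x \<subseteq> U" and S: "S \<subseteq> U"
    and prob: "\<And>v. v \<in> U \<Longrightarrow> expect p (\<lambda>x. of_bool (v \<in> A x)) \<le> \<rho>"
    and rho: "0 \<le> \<rho>" "\<rho> \<le> 1"
  shows "(1 - \<rho>) * f S \<le> expect p (\<lambda>x. f (S \<union> A x))"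
proof -
  let ?P = "\<lambda>v. expect p (\<lambda>x. of_bool (v \<in> A x)) :: real"
  have P01: "0 \<le> ?P v" for v by simp
  \<comment> \<open>The first four conjuncts say that \<open>q\<close> is the least of \<rho> and
    the listed probabilities, in a form that covers the empty list. Probabilities increase along the
    list, and the induction adds the head last.\<close>
  have main: "\<exists>q. 0 \<le> q \<and> q \<le> \<rho> \<and> (\<forall>v\<in>set vs. q \<le> ?P v) \<and> (\<forall>r. (\<forall>v\<in>set vs. r \<le> ?P v) \<longrightarrow> r \<le> \<rho> \<longrightarrow> r \<le> q) \<and>
     (1 - \<rho>) * f S + q * f (S \<union> set vs) \<le> expect p (\<lambda>x. f (S \<union> (A x \<inter> set vs)))"
    if "set vs \<subseteq> U" "sorted_wrt (\<lambda>u v. ?P u \<le> ?P v) vs" for vs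
    using that
  proof (induction vs)
    case Nil
    show ?case by (rule exI[of _ \<rho>]) (use rho in \<open>simp add: algebra_simps\<close>)
  next
    case (Cons v vs)
    then obtain q where q: "0 \<le> q" "q \<le> \<rho>" "\<forall>v\<in>set vs. q \<le> ?P v"
      "\<forall>r. (\<forall>v\<in>set vs. r \<le> ?P v) \<longrightarrow> r \<le> \<rho> \<longrightarrow> r \<le> q"
      "(1 - \<rho>) * f S + q * f (S \<union> set vs) \<le> expect p (\<lambda>x. f (S \<union> (A x \<inter> set vs)))"
      by auto
    have v: "v \<in> U" "set vs \<subseteq> U" using Cons.prems by auto
    have vq: "?P v \<le> q" using q(4) Cons.prems prob[OF v(1)] by auto
    have "f (S \<union> (A x \<inter> set vs)) + of_bool (v \<in> A x) * gain f (S \<union> set vs) v \<le> f (S \<union> (A x \<inter> set (v # vs)))"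
      if x: "x \<in> set_pmf p" for x
    proof (cases "v \<in> A x")
      case True
      have "gain f (S \<union> set vs) v \<le> gain f (S \<union> (A x \<inter> set vs)) v"
      \<comment> \<open>\<open>vs\<close> may repeat \<open>v\<close>, and \<open>v\<close> may lie
        in \<open>S\<close>; both gains are then 0.\<close>
      proof (cases "v \<in> S \<union> set vs")
        case True
        then have "v \<in> S \<union> (A x \<inter> set vs)" using \<open>v \<in> A x\<close> by auto
        then show ?thesis using True by (simp add: gain_mem)
      next
        case False
        then show ?thesis using v S by (intro gain_antimono) auto
      qed
      moreover have "S \<union> (A x \<inter> set (v # vs)) = insert v (S \<union> (A x \<inter> set vs))"
        using True by auto
      ultimately show ?thesis using True by (simp add: gain_def)
    qed simp
    then have "expect p (\<lambda>x. f (S \<union> (A x \<inter> set vs)) + of_bool (v \<in> A x) * gain f (S \<union> set vs) v)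
        \<le> expect p (\<lambda>x. f (S \<union> (A x \<inter> set (v # vs))))"
      by (rule expect_mono[OF fin])
    then have step: "expect p (\<lambda>x. f (S \<union> (A x \<inter> set vs))) + ?P v * gain f (S \<union> set vs) v
        \<le> expect p (\<lambda>x. f (S \<union> (A x \<inter> set (v # vs))))"
      by (simp add: expect_affine[OF fin])
    \<comment> \<open>Lowering the coefficient from \<open>q\<close> to the probability of
      \<open>v\<close> frees this term; nonnegativity of \<open>f\<close> allows it to be
      dropped.\<close>
    have "0 \<le> (q - ?P v) * f (S \<union> set vs)"
      using vq nonneg[of "S \<union> set vs"] S v by simp
    then have "(1 - \<rho>) * f S + ?P v * f (S \<union> set (v # vs)) \<le> expect p (\<lambda>x. f (S \<union> (A x \<inter> set (v # vs))))"
      using q(5) step by (simp add: gain_def algebra_simps)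
    then show ?case using Cons.prems vq q P01[of v] by (intro exI[of _ "?P v"]) auto
  qed
  obtain us where us: "set us = U" "sorted_wrt (\<lambda>u v. ?P u \<le> ?P v) us"
  proof -
    obtain vs where "set vs = U" using finite_ground finite_list by blast
    then have "set (sort_key ?P vs) = U" "sorted_wrt (\<lambda>u v. ?P u \<le> ?P v) (sort_key ?P vs)"
      using sorted_sort_key[of ?P vs] by (auto simp: sorted_map)
    then show ?thesis by (rule that)
  qed
  then obtain q where q: "0 \<le> q" "(1 - \<rho>) * f S + q * f (S \<union> U) \<le> expect p (\<lambda>x. f (S \<union> (A x \<inter> U)))"
    using main[of us] by auto
  have "expect p (\<lambda>x. f (S \<union> (A x \<inter> U))) \<le> expect p (\<lambda>x. f (S \<union> A x))"
    using sub by (intro expect_mono[OF fin]) (simp add: Int_absorb2)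
  moreover have "0 \<le> q * f (S \<union> U)" using q(1) nonneg[of "S \<union> U"] S by simp
  ultimately show ?thesis using q(2) by linarith
qed

end

text \<open>Each member of a block of at most \<open>l\<close> elements has probability exactly 1 /
  l, also when the block is short; the missing mass goes to \<open>None\<close>.\<close>

definition pick :: "nat \<Rightarrow> 'a set \<Rightarrow> 'a option pmf" where
  "pick l B = bind_pmf (bernoulli_pmf (real (card B) / real l))
     (\<lambda>b. if b then map_pmf Some (pmf_of_set B) else return_pmf None)"

lemma pick_props:
  assumes "finite B" "card B \<le> l" "0 < l"
  shows finite_pick: "finite (set_pmf (pick l B))"
    and set_option_pick: "\<And>x. x \<in> set_pmf (pick l B) \<Longrightarrow> set_option x \<subseteq> B"
    and expect_pick: "\<And>h. expect (pick l B) h = (\<Sum>b\<in>B. h (Some b)) / l + (1 - card B / l) * h None"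
proof -
  have "finite (set_pmf (pick l B)) \<and> (\<forall>x\<in>set_pmf (pick l B). set_option x \<subseteq> B) \<and>
    (\<forall>h. expect (pick l B) h = (\<Sum>b\<in>B. h (Some b)) / l + (1 - card B / l) * h None)"
  proof (cases "B = {}")
    case True
    \<comment> \<open>For empty \<open>B\<close> the law \<open>pmf_of_set B\<close> is unspecified.
      Its branch has weight 0 and is removed first.\<close>
    have "bernoulli_pmf 0 = return_pmf False"
      by (rule pmf_eqI) (metis (full_types) indicator_simps(1) indicator_simps(2) pmf_bernoulli_False pmf_bernoulli_True pmf_return diff_zero order_refl singletonD singletonI zero_le_one)
    then have "pick l B = return_pmf None"
      using True by (simp add: pick_def bind_return_pmf)
    then show ?thesis using True by simp
  next
    case False
    have cl: "real (card B) / real l \<le> 1" using assms by simp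
    have fin: "finite (set_pmf (pick l B))"
      using assms False by (auto simp: pick_def)
    have "expect (pick l B) h = (\<Sum>b\<in>B. h (Some b)) / l + (1 - card B / l) * h None" for h
    proof -
      have "expect (pick l B) h = expect (bernoulli_pmf (real (card B) / real l))
          (\<lambda>b. expect (if b then map_pmf Some (pmf_of_set B) else return_pmf None) h)"
        unfolding pick_def using assms False by (intro expect_bind) auto
      also have "\<dots> = (\<Sum>b\<in>B. h (Some b)) / card B * (card B / l) + (1 - card B / l) * h None"
        using cl assms False by (simp add: integral_pmf_of_set mult.commute)
      finally show ?thesis using assms False by simp
    qed
    then show ?thesis using fin assms False by (auto simp: pick_def split: if_splits)
  qed
  then show "finite (set_pmf (pick l B))" "\<And>x. x \<in> set_pmf (pick l B) \<Longrightarrow> set_option x \<subseteq> B"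
    "\<And>h. expect (pick l B) h = (\<Sum>b\<in>B. h (Some b)) / l + (1 - card B / l) * h None" by blast+
qed

definition block :: "nat \<Rightarrow> 'a set \<Rightarrow> 'a set pmf" where
  "block l V = pmf_of_set {B. B \<subseteq> V \<and> card B = min l (card V)}"

lemma blocks_finite: "finite V \<Longrightarrow> finite {B. B \<subseteq> V \<and> card B = b}"
  by (rule finite_subset[of _ "Pow V"]) auto

lemma blocks_nonempty: "{B. B \<subseteq> V \<and> card B = min l (card V)} \<noteq> {}"
  using obtain_subset_with_card_n[of "min l (card V)" V] by fastforce

lemma set_block: "finite V \<Longrightarrow> set_pmf (block l V) = {B. B \<subseteq> V \<and> card B = min l (card V)}"
  unfolding block_def by (intro set_pmf_of_set blocks_nonempty blocks_finite)

text \<open>Removing \<open>v\<close> matches the blocks of size b through \<open>v\<close> with the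
  blocks of size b - 1 in the other m - 1 candidates. The identity b C(m, b) = m C(m - 1, b - 1)
  turns the quotient of the counts into b / m.\<close>

lemma expect_block_mem:
  assumes V: "finite V" "v \<in> V"
  shows "expect (block l V) (\<lambda>B. of_bool (v \<in> B)) = min l (card V) / card V"
proof -
  define b where "b = min l (card V)"
  define m where "m = card V"
  have m: "0 < m" using V by (auto simp: m_def card_gt_0_iff)
  have "b \<le> m" by (simp add: b_def m_def)
  let ?F = "{B. B \<subseteq> V \<and> card B = b}"
  have fin: "finite ?F" using V by (intro blocks_finite)
  have cardF: "card ?F = m choose b" unfolding m_def using V by (intro n_subsets)
  have "expect (block l V) (\<lambda>B. of_bool (v \<in> B)) = (\<Sum>B\<in>?F. of_bool (v \<in> B)) / card ?F"
    unfolding block_def b_def using V by (intro integral_pmf_of_set blocks_nonempty blocks_finite)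
  also have "(\<Sum>B\<in>?F. of_bool (v \<in> B)) = real (card {B\<in>?F. v \<in> B})"
    using fin by (simp add: of_bool_def sum.If_cases Int_def)
  finally have E: "expect (block l V) (\<lambda>B. of_bool (v \<in> B)) = real (card {B\<in>?F. v \<in> B}) / card ?F" .
  have "m * card {B\<in>?F. v \<in> B} = b * card ?F"
  proof (cases b)
    case 0
    then have "{B\<in>?F. v \<in> B} = {}" using V finite_subset by fastforce
    then show ?thesis using 0 by (metis card.empty mult_0 mult_0_right)
  next
    case (Suc b')
    have "bij_betw (insert v) {B. B \<subseteq> V - {v} \<and> card B = b'} {B\<in>?F. v \<in> B}"
    proof (rule bij_betwI[where g = "\<lambda>B. B - {v}"])
      show "insert v \<in> {B. B \<subseteq> V - {v} \<and> card B = b'} \<rightarrow> {B\<in>?F. v \<in> B}"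
      proof
        fix B assume B: "B \<in> {B. B \<subseteq> V - {v} \<and> card B = b'}"
        then have "finite B" "v \<notin> B" using V finite_subset[of B "V - {v}"] by auto
        then show "insert v B \<in> {B\<in>?F. v \<in> B}" using B Suc V by auto
      qed
    next
      show "(\<lambda>B. B - {v}) \<in> {B\<in>?F. v \<in> B} \<rightarrow> {B. B \<subseteq> V - {v} \<and> card B = b'}"
        using Suc by auto
    qed auto
    then have "card {B\<in>?F. v \<in> B} = card {B. B \<subseteq> V - {v} \<and> card B = b'}"
      by (rule bij_betw_same_card[symmetric])
    also have "\<dots> = (m - 1) choose b'"
      using V by (subst n_subsets) (auto simp: m_def)
    finally show ?thesis
      using Suc_times_binomial_eq[of "m - 1" b'] m Suc cardF by (simp add: mult.commute)
  qed
  from arg_cong[OF this, of real] have "real m * real (card {B\<in>?F. v \<in> B}) = real b * real (card ?F)"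
    by (simp only: of_nat_mult)
  moreover have "card ?F > 0" using cardF \<open>b \<le> m\<close> by simp
  ultimately show ?thesis using m b_def[folded m_def] unfolding E m_def[symmetric]
    by (simp add: field_simps)
qed

lemma expect_block_sum:
  fixes h :: "'a \<Rightarrow> real"
  assumes "finite V"
  shows "expect (block l V) (\<lambda>B. \<Sum>v\<in>B. h v) = min l (card V) / card V * (\<Sum>v\<in>V. h v)"
proof -
  have fin: "finite (set_pmf (block l V))" using assms by (simp add: set_block blocks_finite)
  have "expect (block l V) (\<lambda>B. \<Sum>v\<in>B. h v) = expect (block l V) (\<lambda>B. \<Sum>v\<in>V. of_bool (v \<in> B) * h v)"
  proof (rule expect_cong)
    fix B assume "B \<in> set_pmf (block l V)"
    then have "B \<subseteq> V" using assms by (simp add: set_block)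
    then show "(\<Sum>v\<in>B. h v) = (\<Sum>v\<in>V. of_bool (v \<in> B) * h v)"
      using assms by (intro sum.mono_neutral_cong_left) auto
  qed
  also have "\<dots> = (\<Sum>v\<in>V. expect (block l V) (\<lambda>B. of_bool (v \<in> B)) * h v)"
    using fin by (subst expect_sum) auto
  also have "\<dots> = (\<Sum>v\<in>V. min l (card V) / card V * h v)"
    using assms by (intro sum.cong refl) (simp add: expect_block_mem)
  finally show ?thesis by (simp add: sum_distrib_left)
qed

section \<open>Sampling blocks of candidates\<close>

text \<open>Sampling without replacement that never looks at \<open>f\<close>; one round can
  therefore evaluate all prefixes of a sample at once.\<close>

fun draws :: "nat \<Rightarrow> nat \<Rightarrow> 'a set \<Rightarrow> ('a set \<times> 'a option) list pmf" where
  "draws l 0 V = return_pmf []"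
| "draws l (Suc n) V = (if V = {} then return_pmf [] else
     bind_pmf (block l V) (\<lambda>B. bind_pmf (pick l B) (\<lambda>x. map_pmf (Cons (B, x)) (draws l n (V - B)))))"

fun valid_draws :: "nat \<Rightarrow> nat \<Rightarrow> 'a set \<Rightarrow> ('a set \<times> 'a option) list \<Rightarrow> bool" where
  "valid_draws l n V [] \<longleftrightarrow> n = 0 \<or> V = {}"
| "valid_draws l n V ((B, x) # bs) \<longleftrightarrow> 0 < n \<and> V \<noteq> {} \<and> B \<subseteq> V \<and> card B = min l (card V) \<and>
     set_option x \<subseteq> B \<and> valid_draws l (n - 1) (V - B) bs"

lemma set_draws:
  assumes "0 < l" "finite V"
  shows "finite (set_pmf (draws l n V)) \<and> (\<forall>bs\<in>set_pmf (draws l n V). valid_draws l n V bs)"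
  using assms(2)
proof (induction n arbitrary: V)
  case (Suc n)
  show ?case
  proof (cases "V = {}")
    case False
    have B: "finite B" "card B \<le> l" if "B \<in> set_pmf (block l V)" for B
      using that Suc.prems by (auto simp: set_block intro: finite_subset)
    have "finite (set_pmf (block l V))" using Suc.prems by (simp add: set_block blocks_finite)
    moreover have "finite (set_pmf (pick l B))" if "B \<in> set_pmf (block l V)" for B
      using B[OF that] assms(1) by (rule finite_pick)
    moreover have "finite (set_pmf (draws l n (V - B)))" for B using Suc by simp
    moreover have "valid_draws l n (V - B) bs" if "bs \<in> set_pmf (draws l n (V - B))" for B bs
      using Suc that by simp
    moreover have "set_option x \<subseteq> B" if "B \<in> set_pmf (block l V)" "x \<in> set_pmf (pick l B)" for x B
      using set_option_pick[OF B[OF that(1)] assms(1) that(2)] .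
    ultimately show ?thesis using False Suc.prems by (auto simp: set_block)
  qed simp
qed simp

lemma finite_draws: "0 < l \<Longrightarrow> finite V \<Longrightarrow> finite (set_pmf (draws l n V))"
  using set_draws by blast

lemma expect_draws_Suc:
  fixes h :: "('a set \<times> 'a option) list \<Rightarrow> real"
  assumes "0 < l" "finite V" "V \<noteq> {}"
  shows "expect (draws l (Suc n) V) h =
    expect (block l V) (\<lambda>B. expect (pick l B) (\<lambda>x. expect (draws l n (V - B)) (\<lambda>bs. h ((B, x) # bs))))"
proof -
  have fb: "finite (set_pmf (block l V))" using assms by (simp add: set_block blocks_finite)
  have fp: "finite (set_pmf (pick l B))" if "B \<in> set_pmf (block l V)" for B
    using that assms by (intro finite_pick) (auto simp: set_block intro: finite_subset)
  have fd: "finite (set_pmf (draws l n (V - B)))" for B using assms by (intro finite_draws) auto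
  have "expect (draws l (Suc n) V) h = expect (block l V) (\<lambda>B. expect (bind_pmf (pick l B) (\<lambda>x. map_pmf (Cons (B, x)) (draws l n (V - B)))) h)"
    using assms fb fp fd by (simp add: expect_bind)
  also have "\<dots> = expect (block l V) (\<lambda>B. expect (pick l B) (\<lambda>x. expect (map_pmf (Cons (B, x)) (draws l n (V - B))) h))"
    using fp fd by (intro expect_cong expect_bind) auto
  finally show ?thesis by simp
qed

text \<open>
  An accepted element may have a very negative gain. All accepted elements enter \<open>taken\<close>, relative
  to which gains are measured, but only those with nonnegative gain enter \<open>kept\<close>, the output.
  \<open>credit\<close> sums, over the elements of \<open>seen\<close>, the threshold at which they were considered.
\<close>

record 'a gstate =
  taken :: "'a set"
  kept :: "'a set"
  seen :: "'a set"
  cand :: "'a set"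
  budget :: nat
  credit :: real

definition absorb :: "('a set \<Rightarrow> real) \<Rightarrow> real \<Rightarrow> 'a set \<Rightarrow> 'a option \<Rightarrow> 'a gstate \<Rightarrow> 'a gstate" where
  "absorb f w B x st = \<lparr>taken = taken st \<union> set_option x,
     kept = kept st \<union> {a \<in> set_option x. 0 \<le> gain f (taken st) a},
     seen = seen st \<union> B, cand = cand st - B, budget = budget st - 1, credit = credit st + w * card B\<rparr>"

lemma absorb_simps [simp]:
  "taken (absorb f w B x st) = taken st \<union> set_option x"
  "kept (absorb f w B x st) = kept st \<union> {a \<in> set_option x. 0 \<le> gain f (taken st) a}"
  "seen (absorb f w B x st) = seen st \<union> B"
  "cand (absorb f w B x st) = cand st - B"
  "budget (absorb f w B x st) = budget st - 1"
  "credit (absorb f w B x st) = credit st + w * card B"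
  by (simp_all add: absorb_def)

definition alive :: "('a set \<Rightarrow> real) \<Rightarrow> real \<Rightarrow> 'a gstate \<Rightarrow> 'a set" where
  "alive f w st = {v \<in> cand st. w \<le> gain f (taken st) v}"

text \<open>Checkpoints: there are only logarithmically many, yet a stretch without one grows the
  position by at most a factor 1 + \<delta> (\<open>grid_gap\<close>).\<close>

definition grid :: "real \<Rightarrow> nat \<Rightarrow> bool" where
  "grid \<delta> i \<longleftrightarrow> (\<exists>j::nat. i = nat \<lfloor>(1 + \<delta>) ^ j\<rfloor>)"

definition plenty :: "('a set \<Rightarrow> real) \<Rightarrow> real \<Rightarrow> real \<Rightarrow> nat \<Rightarrow> 'a gstate \<Rightarrow> bool" where
  "plenty f w \<delta> N st \<longleftrightarrow> (1 - \<delta>) * real N < real (card (alive f w st))"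

text \<open>\<open>N\<close> stays the number of candidates at the start of the batch. Filtering on
  every exit makes all remaining candidates alive, which is where the next batch starts. The first
  block is absorbed without a test, so a walk from position 0 along a nonempty sample makes
  progress.\<close>

fun walk :: "('a set \<Rightarrow> real) \<Rightarrow> real \<Rightarrow> real \<Rightarrow> nat \<Rightarrow> nat \<Rightarrow> 'a gstate \<Rightarrow> ('a set \<times> 'a option) list \<Rightarrow> 'a gstate" where
  "walk f w \<delta> N i st [] = st\<lparr>cand := alive f w st\<rparr>"
| "walk f w \<delta> N i st ((B, x) # bs) =
     (if 0 < i \<and> grid \<delta> i \<and> \<not> plenty f w \<delta> N st then st\<lparr>cand := alive f w st\<rparr>
      else walk f w \<delta> N (Suc i) (absorb f w B x st) bs)"

text \<open>
  Only the steps counted here have a controlled expected gain; the grid is fine enough that the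
  remaining steps of a walk add at most a \<open>\<delta>\<close>-fraction to the credit (\<open>credit_walk_le\<close>).
\<close>

fun plenty_credit :: "('a set \<Rightarrow> real) \<Rightarrow> real \<Rightarrow> real \<Rightarrow> nat \<Rightarrow> nat \<Rightarrow> 'a gstate \<Rightarrow> ('a set \<times> 'a option) list \<Rightarrow> real" where
  "plenty_credit f w \<delta> N i st [] = 0"
| "plenty_credit f w \<delta> N i st ((B, x) # bs) =
     (if 0 < i \<and> grid \<delta> i \<and> \<not> plenty f w \<delta> N st then 0
      else (if plenty f w \<delta> N st then w * card B else 0) + plenty_credit f w \<delta> N (Suc i) (absorb f w B x st) bs)"

lemma walk_continue:
  assumes "\<not> (0 < i \<and> grid \<delta> i \<and> \<not> plenty f w \<delta> N st)"
  shows "walk f w \<delta> N i st ((B, x) # bs) = walk f w \<delta> N (Suc i) (absorb f w B x st) bs"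
    and "plenty_credit f w \<delta> N i st ((B, x) # bs) =
      (if plenty f w \<delta> N st then w * card B else 0) + plenty_credit f w \<delta> N (Suc i) (absorb f w B x st) bs"
  unfolding walk.simps plenty_credit.simps if_not_P[OF assms] by (rule refl)+

text \<open>The invariant is obtained for the state before the last filtering; the disjunction lists
  the reasons for stopping.\<close>

lemma walk_induct:
  assumes "valid_draws l (budget st) (cand st) bs" "I i st"
    and "\<And>i st B x. I i st \<Longrightarrow> 0 < budget st \<Longrightarrow> cand st \<noteq> {} \<Longrightarrow> B \<subseteq> cand st \<Longrightarrow> card B = min l (card (cand st)) \<Longrightarrow>
      set_option x \<subseteq> B \<Longrightarrow> I (Suc i) (absorb f w B x st)"
  shows "\<exists>j st'. I j st' \<and> walk f w \<delta> N i st bs = st'\<lparr>cand := alive f w st'\<rparr> \<and>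
    (budget st' = 0 \<or> cand st' = {} \<or> 0 < j \<and> \<not> plenty f w \<delta> N st')"
  using assms(1,2)
proof (induction bs arbitrary: i st)
  case Nil
  then show ?case by auto
next
  case (Cons b bs)
  obtain B x where b: "b = (B, x)" by (cases b)
  show ?case
  proof (cases "0 < i \<and> grid \<delta> i \<and> \<not> plenty f w \<delta> N st")
    case True
    then show ?thesis using Cons.prems b by auto
  next
    case False
    have "I (Suc i) (absorb f w B x st)" using Cons.prems b by (intro assms(3)) auto
    then show ?thesis using False b Cons.prems Cons.IH[of "absorb f w B x st" "Suc i"] by auto
  qed
qed

text \<open>The least power of 1 + \<delta> that reaches \<open>c\<close> is at most (1 + \<delta>)
  c, and its floor is still at least \<open>c\<close> because \<open>c\<close> is an integer. A
  larger \<open>i\<close> would have this floor as a checkpoint before it.\<close>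

lemma grid_gap:
  assumes d: "0 < \<delta>" and c: "1 \<le> c" "c \<le> i" and gap: "\<And>j. c \<le> j \<Longrightarrow> j < i \<Longrightarrow> \<not> grid \<delta> j"
  shows "real i \<le> (1 + \<delta>) * real c"
proof (rule ccontr)
  assume less: "\<not> real i \<le> (1 + \<delta>) * real c"
  define P where "P = (\<lambda>j::nat. real c \<le> (1 + \<delta>) ^ j)"
  have "\<exists>j. P j" unfolding P_def using real_arch_pow[of "1 + \<delta>" "real c"] d by (auto intro: less_imp_le)
  define j where "j = (LEAST j. P j)"
  have Pj: "P j" unfolding j_def using \<open>\<exists>j. P j\<close> by (rule LeastI_ex)
  have up: "(1 + \<delta>) ^ j \<le> (1 + \<delta>) * real c"
  proof (cases j)
    case 0
    have "1 * 1 \<le> (1 + \<delta>) * real c" using d c by (intro mult_mono) auto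
    then show ?thesis using 0 by simp
  next
    case (Suc j')
    then have "\<not> P j'" unfolding j_def using not_less_Least[of j' P] by (simp add: j_def)
    then show ?thesis using Suc d unfolding P_def by simp
  qed
  let ?g = "nat \<lfloor>(1 + \<delta>) ^ j\<rfloor>"
  have nn: "0 \<le> \<lfloor>(1 + \<delta>) ^ j\<rfloor>" using d by simp
  have "int c \<le> \<lfloor>(1 + \<delta>) ^ j\<rfloor>" using Pj unfolding P_def by (simp add: le_floor_iff)
  then have "c \<le> ?g" by simp
  moreover have "real ?g \<le> (1 + \<delta>) ^ j" using nn by simp
  then have "?g < i" using up less by linarith
  ultimately show False using gap[of ?g] by (auto simp: grid_def)
qed

text \<open>A power whose floor is at most \<open>n\<close> is below n + 1, and ln (1 + \<delta>)
  \<ge> \<delta> / 2 bounds its exponent; the final 1 counts the exponent 0.\<close>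

lemma card_grid_le:
  assumes d: "0 < \<delta>" "\<delta> \<le> 1" and n: "1 \<le> n"
  shows "real (card {i. i \<le> n \<and> 0 < i \<and> grid \<delta> i}) \<le> 2 * ln (real n + 1) / \<delta> + 1"
proof -
  let ?J = "nat \<lfloor>2 * ln (real n + 1) / \<delta>\<rfloor>"
  have "{i. i \<le> n \<and> 0 < i \<and> grid \<delta> i} \<subseteq> (\<lambda>j. nat \<lfloor>(1 + \<delta>) ^ j\<rfloor>) ` {..?J}"
  proof
    fix i assume "i \<in> {i. i \<le> n \<and> 0 < i \<and> grid \<delta> i}"
    then obtain j where j: "i = nat \<lfloor>(1 + \<delta>) ^ j\<rfloor>" "i \<le> n" by (auto simp: grid_def)
    have "(1 + \<delta>) ^ j < real n + 1"
    proof -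
      have "\<lfloor>(1 + \<delta>) ^ j\<rfloor> \<le> int n" using j by linarith
      then show ?thesis by (simp add: floor_le_iff)
    qed
    then have "ln ((1 + \<delta>) ^ j) < ln (real n + 1)" using d by (subst ln_less_cancel_iff) auto
    then have "real j * ln (1 + \<delta>) < ln (real n + 1)" using d by (simp add: ln_realpow)
    moreover have "\<delta> / 2 \<le> ln (1 + \<delta>)"
    proof -
      have "\<delta> / (1 + \<delta>) \<le> ln (1 + \<delta>)"
        using ln_le_minus_one[of "1 / (1 + \<delta>)"] d by (simp add: ln_div field_simps)
      moreover have "\<delta> / 2 \<le> \<delta> / (1 + \<delta>)" using d by (intro divide_left_mono) auto
      ultimately show ?thesis by linarith
    qed
    then have "real j * (\<delta> / 2) \<le> real j * ln (1 + \<delta>)" by (intro mult_left_mono) auto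
    ultimately have "real j \<le> 2 * ln (real n + 1) / \<delta>" using d by (simp add: field_simps)
    then have "j \<le> ?J" by (simp add: le_nat_floor)
    then show "i \<in> (\<lambda>j. nat \<lfloor>(1 + \<delta>) ^ j\<rfloor>) ` {..?J}" using j by auto
  qed
  then have "card {i. i \<le> n \<and> 0 < i \<and> grid \<delta> i} \<le> card {..?J}"
    by (meson card_image_le card_mono finite_atMost finite_imageI le_trans)
  then have "real (card {i. i \<le> n \<and> 0 < i \<and> grid \<delta> i}) \<le> real ?J + 1" by simp
  moreover have "real ?J \<le> 2 * ln (real n + 1) / \<delta>" using d by (intro of_nat_floor) auto
  ultimately show ?thesis by linarith
qed

section \<open>Analysis of one walk along the sampled blocks\<close>

locale threshold_sampling = submodular_fun U f for U :: "'a set" and f +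
  fixes \<delta> :: real and l :: nat
  assumes delta: "0 < \<delta>" "\<delta> < 1" and l_pos: "0 < l"
begin

definition wf :: "'a gstate \<Rightarrow> bool" where
  "wf st \<longleftrightarrow> taken st \<subseteq> U \<and> kept st \<subseteq> taken st \<and> seen st \<subseteq> U \<and> cand st \<subseteq> U - seen st \<and> cand st \<inter> taken st = {}"

text \<open>
  Charging scheme: at the end \<open>Z\<close> is the part of the optimum inside \<open>seen\<close>, and the elements of
  \<open>seen - Z\<close> pay for the rest of the optimum.
\<close>

definition covered :: "real \<Rightarrow> 'a gstate \<Rightarrow> bool" where
  "covered w st \<longleftrightarrow> (\<forall>v\<in>U - seen st. (1 - \<delta>) * gain_pos f (taken st) v \<le> w) \<and>
     (\<forall>Z\<subseteq>seen st. (1 - \<delta>) * (\<Sum>z\<in>Z. gain_pos f (taken st) z) + w * card (seen st - Z) \<le> credit st)"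

text \<open>\<open>M\<close> caps the size of the output. \<open>H\<close> bounds from below the
  number of elements seen once the budget is spent: every block has \<open>l\<close> members unless
  it exhausts the candidates, and the last summand allows for that loss.\<close>

definition run_inv :: "real \<Rightarrow> nat \<Rightarrow> nat \<Rightarrow> 'a gstate \<Rightarrow> bool" where
  "run_inv w M H st \<longleftrightarrow> wf st \<and> f (taken st) \<le> f (kept st) \<and> card (kept st) + budget st \<le> M \<and>
     H \<le> card (seen st) + l * budget st + (if cand st = {} then l else 0) \<and> covered w st \<and>
     (\<forall>v\<in>U - seen st. v \<in> cand st \<or> gain f (taken st) v < w)"

lemma finite_sub: "X \<subseteq> U \<Longrightarrow> finite X"
  using finite_ground finite_subset by blast

lemma wf_absorb:
  assumes "wf st" "B \<subseteq> cand st" "set_option x \<subseteq> B"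
  shows "wf (absorb f w B x st)"
  using assms unfolding wf_def by auto

text \<open>Since \<open>kept\<close> is contained in \<open>taken\<close>, the gain relative to
  \<open>kept\<close> is the larger one. Keeping an element of nonnegative measured gain thus earns
  at least that gain, and dropping the others keeps \<open>kept\<close> ahead of
  \<open>taken\<close> in value.\<close>

lemma kept_absorb:
  assumes "wf st" "B \<subseteq> cand st" "x = Some a" "a \<in> B"
  shows "f (kept st) + gain_pos f (taken st) a \<le> f (kept (absorb f w B x st))"
    and "f (taken (absorb f w B x st)) - f (taken st) \<le> f (kept (absorb f w B x st)) - f (kept st)"
proof -
  have a: "gain f (taken st) a \<le> gain f (kept st) a"
    using assms unfolding wf_def by (intro gain_antimono) auto
  have k: "kept (absorb f w B x st) = (if 0 \<le> gain f (taken st) a then insert a (kept st) else kept st)"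
    using assms by auto
  show "f (kept st) + gain_pos f (taken st) a \<le> f (kept (absorb f w B x st))"
    using a unfolding k by (auto simp: gain_def)
  then show "f (taken (absorb f w B x st)) - f (taken st) \<le> f (kept (absorb f w B x st)) - f (kept st)"
    using assms by (simp add: gain_def)
qed

text \<open>Every new element brings credit \<open>w\<close>. Outside \<open>Z\<close> this pays its
  summand \<open>w\<close> in the charging inequality; inside \<open>Z\<close> it pays for the
  element's own gain, which is at most w / (1 - \<delta>) because the element was unseen until
  now.\<close>

lemma covered_absorb:
  assumes wf: "wf st" and cov: "covered w st" and w: "0 < w" and B: "B \<subseteq> cand st" "set_option x \<subseteq> B"
  shows "covered w (absorb f w B x st)"
proof -
  let ?st = "absorb f w B x st"
  have wf': "wf ?st" using wf B by (rule wf_absorb)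
  have anti: "gain_pos f (taken ?st) v \<le> gain_pos f (taken st) v" if "v \<in> U" for v
    using wf' that by (intro gain_pos_antimono) (auto simp: wf_def)
  have bound: "(1 - \<delta>) * gain_pos f (taken ?st) v \<le> w" if "v \<in> U - seen st" for v
  proof -
    have "(1 - \<delta>) * gain_pos f (taken ?st) v \<le> (1 - \<delta>) * gain_pos f (taken st) v"
      using delta anti that by (intro mult_left_mono) auto
    also have "\<dots> \<le> w" using cov that unfolding covered_def by (elim conjE) (rule bspec)
    finally show ?thesis .
  qed
  have disj: "seen st \<inter> B = {}" and BU: "B \<subseteq> U" and SU: "seen st \<subseteq> U" using wf B by (auto simp: wf_def)
  have fin: "finite B" "finite (seen st)" using BU SU by (auto intro: finite_sub)
  have "(1 - \<delta>) * (\<Sum>z\<in>Z. gain_pos f (taken ?st) z) + w * card (seen ?st - Z) \<le> credit ?st" if Z: "Z \<subseteq> seen ?st" for Z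
  proof -
    let ?Z1 = "Z \<inter> seen st" and ?Z2 = "Z \<inter> B"
    have Z12: "Z = ?Z1 \<union> ?Z2" "?Z1 \<inter> ?Z2 = {}" "finite ?Z1" "finite ?Z2" using Z disj fin by auto
    have "(1 - \<delta>) * (\<Sum>z\<in>Z. gain_pos f (taken ?st) z)
        = (1 - \<delta>) * (\<Sum>z\<in>?Z1. gain_pos f (taken ?st) z) + (\<Sum>z\<in>?Z2. (1 - \<delta>) * gain_pos f (taken ?st) z)"
      using sum.union_disjoint[OF Z12(3,4,2), of "gain_pos f (taken ?st)"] Z12(1)
      by (simp add: distrib_left sum_distrib_left)
    moreover have "(1 - \<delta>) * (\<Sum>z\<in>?Z1. gain_pos f (taken ?st) z) \<le> (1 - \<delta>) * (\<Sum>z\<in>?Z1. gain_pos f (taken st) z)"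
      using delta SU by (intro mult_left_mono sum_mono anti) auto
    moreover have "(\<Sum>z\<in>?Z2. (1 - \<delta>) * gain_pos f (taken ?st) z) \<le> (\<Sum>z\<in>?Z2. w)"
      using disj BU by (intro sum_mono bound) auto
    moreover have "(1 - \<delta>) * (\<Sum>z\<in>?Z1. gain_pos f (taken st) z) + w * card (seen st - ?Z1) \<le> credit st"
      using cov unfolding covered_def by blast
    moreover have "card (seen ?st - Z) = card (seen st - ?Z1) + card (B - ?Z2)"
    proof -
      have "seen ?st - Z = (seen st - ?Z1) \<union> (B - ?Z2)" by auto
      then show ?thesis using disj fin by (simp add: card_Un_disjoint Int_Diff Diff_Int_distrib2)
          (subst card_Un_disjoint, auto)
    qed
    moreover have "card B = card ?Z2 + card (B - ?Z2)"
      using fin card_Diff_subset[of ?Z2 B] card_mono[of B ?Z2] by auto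
    ultimately show ?thesis by (simp add: algebra_simps)
  qed
  then show ?thesis using bound unfolding covered_def by auto
qed

lemma run_inv_absorb:
  assumes inv: "run_inv w M H st" and w: "0 < w" and st: "0 < budget st" "cand st \<noteq> {}"
    and B: "B \<subseteq> cand st" "card B = min l (card (cand st))" "set_option x \<subseteq> B"
  shows "run_inv w M H (absorb f w B x st)"
proof -
  let ?st = "absorb f w B x st"
  have wf: "wf st" using inv by (simp add: run_inv_def)
  then have wf': "wf ?st" using B by (intro wf_absorb)
  have fin: "finite B" "finite (seen st)" "finite (cand st)" "finite (kept st)" and disj: "seen st \<inter> B = {}"
    using wf B by (auto simp: wf_def intro!: finite_sub)
  have "f (taken ?st) \<le> f (kept ?st)"
  proof (cases x)
    case None
    then show ?thesis using inv by (simp add: run_inv_def)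
  next
    case (Some a)
    then show ?thesis using kept_absorb(2)[OF wf B(1) Some, of w] B inv by (simp add: run_inv_def)
  qed
  moreover have "card (kept ?st) + budget ?st \<le> M"
  proof -
    have "card {a \<in> set_option x. 0 \<le> gain f (taken st) a} \<le> 1"
      by (cases x) (auto intro: le_trans[OF card_mono[of "{_}"]])
    then have "card (kept ?st) \<le> card (kept st) + 1"
      using card_Un_le[of "kept st" "{a \<in> set_option x. 0 \<le> gain f (taken st) a}"] by simp
    moreover have "Suc (budget ?st) = budget st" using st by simp
    moreover have "card (kept st) + budget st \<le> M" using inv by (simp add: run_inv_def)
    ultimately show ?thesis by linarith
  qed
  moreover have "H \<le> card (seen ?st) + l * budget ?st + (if cand ?st = {} then l else 0)"
  proof -
    have c: "card (seen ?st) = card (seen st) + card B" using fin disj by (simp add: card_Un_disjoint)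
    have H: "H \<le> card (seen st) + l * budget st" using inv st by (simp add: run_inv_def)
    obtain b where b: "budget st = Suc b" using st by (cases "budget st") auto
    show ?thesis
    proof (cases "card B = l")
      case True
      then show ?thesis using c H b by auto
    next
      case False
      then have "card B = card (cand st)" using B by linarith
      then have "B = cand st" using B fin by (intro card_subset_eq) auto
      then show ?thesis using c H b by auto
    qed
  qed
  moreover have "covered w ?st" using inv B w by (intro covered_absorb) (auto simp: run_inv_def)
  moreover have "v \<in> cand ?st \<or> gain f (taken ?st) v < w" if v: "v \<in> U - seen ?st" for v
  proof (cases "v \<in> cand st")
    case True
    then show ?thesis using v by auto
  next
    case False
    then have "gain f (taken st) v < w" using inv v by (auto simp: run_inv_def)
    moreover have "gain_pos f (taken ?st) v \<le> gain_pos f (taken st) v"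
      using wf' v by (intro gain_pos_antimono) (auto simp: wf_def)
    ultimately show ?thesis using w by auto
  qed
  ultimately show ?thesis using wf' unfolding run_inv_def by blast
qed

lemma covered_cand [simp]: "covered w (st\<lparr>cand := V\<rparr>) = covered w st"
  by (simp add: covered_def)

lemma run_inv_alive:
  assumes "run_inv w M H st"
  shows "run_inv w M H (st\<lparr>cand := alive f w st\<rparr>)"
proof -
  have sub: "alive f w st \<subseteq> cand st" by (auto simp: alive_def)
  have "H \<le> card (seen st) + l * budget st + (if alive f w st = {} then l else 0)"
    using assms sub by (cases "cand st = {}") (auto simp: run_inv_def)
  moreover have "v \<in> alive f w st \<or> gain f (taken st) v < w" if "v \<in> U - seen st" for v
    using assms that unfolding run_inv_def alive_def by auto
  moreover have "wf (st\<lparr>cand := alive f w st\<rparr>)" using assms sub by (auto simp: run_inv_def wf_def)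
  ultimately show ?thesis using assms unfolding run_inv_def by simp
qed

lemma walk_props:
  assumes inv: "run_inv w M H st" and w: "0 < w" and st: "0 < budget st" "cand st \<noteq> {}"
    and bs: "valid_draws l (budget st) (cand st) bs"
  defines "st' \<equiv> walk f w \<delta> (card (cand st)) 0 st bs"
  shows "run_inv w M H st'" "alive f w st' = cand st'" "credit st + w \<le> credit st'"
    "budget st' = 0 \<or> real (card (cand st')) \<le> (1 - \<delta>) * card (cand st)"
proof -
  \<comment> \<open>The credit may be unchanged only before the first block, and there
    \<open>st\<close> has both budget and candidates, so the walk does not end.\<close>
  define I where "I = (\<lambda>(i::nat) s. run_inv w M H s \<and> (i = 0 \<and> s = st \<or> credit st + w \<le> credit s))"
  have "\<exists>j s. I j s \<and> st' = s\<lparr>cand := alive f w s\<rparr> \<and>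
      (budget s = 0 \<or> cand s = {} \<or> 0 < j \<and> \<not> plenty f w \<delta> (card (cand st)) s)"
    unfolding st'_def
  proof (rule walk_induct[OF bs])
    show "I 0 st" using inv by (simp add: I_def)
    fix i s B x
    assume a: "I i s" "0 < budget s" "cand s \<noteq> {}" "B \<subseteq> cand s" "card B = min l (card (cand s))" "set_option x \<subseteq> B"
    have "finite (cand s)" using a(1) by (auto simp: I_def run_inv_def wf_def intro: finite_sub)
    then have "1 \<le> card B" using a l_pos by (simp add: Suc_le_eq card_gt_0_iff)
    then have "w \<le> w * card B" using w by simp
    then have "credit s + w \<le> credit (absorb f w B x s)" by simp
    then show "I (Suc i) (absorb f w B x s)"
      using a(1) run_inv_absorb[OF _ w a(2-6)] w unfolding I_def by (auto simp del: absorb_simps)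
  qed
  then obtain j s where s: "I j s" "st' = s\<lparr>cand := alive f w s\<rparr>"
    "budget s = 0 \<or> cand s = {} \<or> 0 < j \<and> \<not> plenty f w \<delta> (card (cand st)) s" by blast
  show "run_inv w M H st'" using s run_inv_alive by (auto simp: I_def)
  show "alive f w st' = cand st'" unfolding s(2) by (auto simp: alive_def)
  show "credit st + w \<le> credit st'" using s st unfolding I_def by auto
  show "budget st' = 0 \<or> real (card (cand st')) \<le> (1 - \<delta>) * card (cand st)"
    using s(3) delta unfolding s(2) by (auto simp: plenty_def alive_def)
qed

section \<open>Credit collected after too many candidates have died\<close>

lemma not_plenty_absorb:
  assumes "wf st" "B \<subseteq> cand st" "set_option x \<subseteq> B" "\<not> plenty f w \<delta> N st"
  shows "\<not> plenty f w \<delta> N (absorb f w B x st)"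
proof -
  have wf': "wf (absorb f w B x st)" using assms by (intro wf_absorb)
  have "gain f (taken (absorb f w B x st)) v \<le> gain f (taken st) v" if "v \<in> cand (absorb f w B x st)" for v
    using that wf' by (intro gain_antimono) (auto simp: wf_def)
  then have "alive f w (absorb f w B x st) \<subseteq> alive f w st" by (force simp: alive_def)
  moreover have "finite (alive f w st)" using assms(1) by (auto simp: alive_def wf_def intro!: finite_sub)
  ultimately have "card (alive f w (absorb f w B x st)) \<le> card (alive f w st)" by (rule card_mono[rotated])
  then show ?thesis using assms(4) unfolding plenty_def by linarith
qed

text \<open>Shortage of candidates persists, so the walk ends at the next checkpoint. With
  \<open>c\<close> the position where it sets in and \<open>i\<close> the current one,
  \<open>grid_gap\<close> leaves room for at most (1 + \<delta>) c - i more blocks, each worth at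
  most w l.\<close>

lemma credit_walk_not_plenty:
  assumes "wf st" "0 < w" "valid_draws l (budget st) (cand st) bs" "\<not> plenty f w \<delta> N st"
    and "1 \<le> c" "c \<le> i" "\<And>j. c \<le> j \<Longrightarrow> j < i \<Longrightarrow> \<not> grid \<delta> j"
  shows "credit (walk f w \<delta> N i st bs) \<le> credit st + w * l * ((1 + \<delta>) * c - i)
    \<and> plenty_credit f w \<delta> N i st bs = 0"
  using assms
proof (induction bs arbitrary: i st)
  case Nil
  then have "0 \<le> w * l * ((1 + \<delta>) * c - i)"
    using grid_gap[OF delta(1), of c i] by (intro mult_nonneg_nonneg) auto
  then show ?case by simp
next
  case (Cons b bs)
  obtain B x where b: "b = (B, x)" by (cases b)
  show ?case
  proof (cases "0 < i \<and> grid \<delta> i \<and> \<not> plenty f w \<delta> N st")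
    case True
    have "0 \<le> w * l * ((1 + \<delta>) * c - i)"
      using grid_gap[OF delta(1), of c i] Cons.prems by (intro mult_nonneg_nonneg) auto
    then show ?thesis using True b by simp
  next
    case False
    have "\<not> grid \<delta> j" if "c \<le> j" "j < Suc i" for j
      using that False Cons.prems by (cases "j = i") auto
    then have IH: "credit (walk f w \<delta> N (Suc i) (absorb f w B x st) bs) \<le> credit (absorb f w B x st) + w * l * ((1 + \<delta>) * c - Suc i)
      \<and> plenty_credit f w \<delta> N (Suc i) (absorb f w B x st) bs = 0"
      using Cons.prems b by (intro Cons.IH wf_absorb not_plenty_absorb) auto
    have "w * card B \<le> w * l" using Cons.prems b by (intro mult_left_mono) auto
    moreover have "w * l * ((1 + \<delta>) * c - Suc i) = w * l * ((1 + \<delta>) * c - i) - w * l" by (simp add: algebra_simps)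
    moreover have "credit (absorb f w B x st) = credit st + w * card B" by simp
    ultimately show ?thesis using IH Cons.prems(4) unfolding b walk_continue[OF False] by auto
  qed
qed

text \<open>Each full block at a position with plenty of candidates saves \<delta> w l. After
  \<open>i\<close> of them the saving \<delta> w l i pays for the at most \<delta> i blocks absorbed
  once the shortage has set in. At \<open>i = 0\<close> this term vanishes.\<close>

lemma credit_walk_le:
  assumes "wf st" "0 < w" "valid_draws l (budget st) (cand st) bs" "i = 0 \<Longrightarrow> plenty f w \<delta> N st"
  shows "credit (walk f w \<delta> N i st bs) - credit st \<le> (1 + \<delta>) * plenty_credit f w \<delta> N i st bs + \<delta> * (w * l * i)
    \<and> 0 \<le> plenty_credit f w \<delta> N i st bs"
  using assms
proof (induction bs arbitrary: i st)
  case Nil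
  then show ?case using delta by simp
next
  case (Cons b bs)
  obtain B x where b: "b = (B, x)" by (cases b)
  let ?st = "absorb f w B x st"
  show ?case
  proof (cases "plenty f w \<delta> N st")
    case True
    have IH: "credit (walk f w \<delta> N (Suc i) ?st bs) - credit ?st \<le> (1 + \<delta>) * plenty_credit f w \<delta> N (Suc i) ?st bs + \<delta> * (w * l * (Suc i))
      \<and> 0 \<le> plenty_credit f w \<delta> N (Suc i) ?st bs"
      using Cons.prems b by (intro Cons.IH wf_absorb) auto
    show ?thesis
    proof (cases "card B = l")
      case True
      then show ?thesis using IH \<open>plenty f w \<delta> N st\<close> b Cons.prems(2) by (simp add: algebra_simps)
    next
      case False
      \<comment> \<open>A short block exhausts the candidates, so no block follows and no saving has
        to be made.\<close>
      have "card B = card (cand st)" using Cons.prems b False by auto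
      moreover have "finite (cand st)" using Cons.prems(1) by (auto simp: wf_def intro: finite_sub)
      ultimately have "B = cand st" using Cons.prems b by (intro card_subset_eq) auto
      then have "bs = []" using Cons.prems b by (cases bs) auto
      then show ?thesis using \<open>plenty f w \<delta> N st\<close> b Cons.prems(2) delta by (simp add: algebra_simps)
    qed
  next
    case False
    then have "1 \<le> i" using Cons.prems(4) by (cases i) auto
    then have "credit (walk f w \<delta> N i st (b # bs)) \<le> credit st + w * l * ((1 + \<delta>) * i - i)
      \<and> plenty_credit f w \<delta> N i st (b # bs) = 0"
      using Cons.prems False by (intro credit_walk_not_plenty) auto
    then show ?thesis by (simp add: algebra_simps)
  qed
qed

section \<open>Martingale estimates for one walk\<close>

lemma finite_block: "V \<subseteq> U \<Longrightarrow> finite (set_pmf (block l V))"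
  by (simp add: set_block blocks_finite finite_sub)

lemma block_props:
  assumes "V \<subseteq> U" "B \<in> set_pmf (block l V)"
  shows "finite B" "B \<subseteq> V" "card B = min l (card V)" "finite (set_pmf (pick l B))"
    "\<And>x. x \<in> set_pmf (pick l B) \<Longrightarrow> set_option x \<subseteq> B"
    "\<And>h. expect (pick l B) h = (\<Sum>b\<in>B. h (Some b)) / l + (1 - card B / l) * h None"
proof -
  have V: "finite V" using assms by (intro finite_sub)
  show 1: "B \<subseteq> V" "card B = min l (card V)" using assms V by (auto simp: set_block)
  show 2: "finite B" using 1 V finite_subset by blast
  have 3: "card B \<le> l" using 1 by simp
  show "finite (set_pmf (pick l B))" "\<And>x. x \<in> set_pmf (pick l B) \<Longrightarrow> set_option x \<subseteq> B"
    "\<And>h. expect (pick l B) h = (\<Sum>b\<in>B. h (Some b)) / l + (1 - card B / l) * h None"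
    using pick_props[OF 2 3 l_pos] by blast+
qed

text \<open>A submartingale argument. At a step with plenty of candidates a uniform candidate has
  expected truncated gain at least (1 - \<delta>) w, and a block of b members yields b / l times as
  much, which is the amount subtracted. At other steps nothing is subtracted and \<open>kept\<close>
  cannot lose value.\<close>

lemma expect_walk_kept:
  assumes "wf st" "0 < w" "card (cand st) \<le> N"
  shows "f (kept st) \<le> expect (draws l (budget st) (cand st))
    (\<lambda>bs. f (kept (walk f w \<delta> N i st bs)) - (1 - \<delta>) / l * plenty_credit f w \<delta> N i st bs)"
  using assms
proof (induction "budget st" arbitrary: st i)
  case 0
  then show ?case by (simp flip: 0(1))
next
  case (Suc n)
  note n = Suc.hyps(2)[symmetric]
  have V: "finite (cand st)" "cand st \<subseteq> U" using Suc.prems by (auto simp: wf_def intro!: finite_sub)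
  show ?case
  proof (cases "cand st = {} \<or> 0 < i \<and> grid \<delta> i \<and> \<not> plenty f w \<delta> N st")
    case True
    have const: "f (kept (walk f w \<delta> N i st bs)) - (1 - \<delta>) / l * plenty_credit f w \<delta> N i st bs = f (kept st)"
      if "bs \<in> set_pmf (draws l (budget st) (cand st))" for bs
    proof -
      have "valid_draws l (budget st) (cand st) bs" using set_draws[OF l_pos V(1)] that by blast
      then show ?thesis using True by (cases bs) auto
    qed
    show ?thesis by (subst expect_cong[OF const]) auto
  next
    case False
    then have go: "\<not> (0 < i \<and> grid \<delta> i \<and> \<not> plenty f w \<delta> N st)" by simp
    let ?r = "if plenty f w \<delta> N st then (1 - \<delta>) / l * w else 0"
    let ?g = "gain_pos f (taken st)"
    let ?F = "\<lambda>B x. expect (draws l n (cand st - B)) (\<lambda>bs. f (kept (walk f w \<delta> N i st ((B, x) # bs))) - (1 - \<delta>) / l * plenty_credit f w \<delta> N i st ((B, x) # bs))"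
    have inner: "f (kept (absorb f w B x st)) - ?r * card B \<le> ?F B x"
      if B: "B \<subseteq> cand st" "set_option x \<subseteq> B" for B x
    proof -
      let ?st = "absorb f w B x st"
      have "card (cand ?st) \<le> N" using Suc.prems(3) V card_mono[of "cand st" "cand st - B"] by simp
      then have "f (kept ?st) \<le> expect (draws l n (cand st - B))
        (\<lambda>bs. f (kept (walk f w \<delta> N (Suc i) ?st bs)) - (1 - \<delta>) / l * plenty_credit f w \<delta> N (Suc i) ?st bs)"
        using Suc.hyps(1)[of ?st "Suc i"] Suc.prems B n wf_absorb[of st B x w] by simp
      moreover have "?F B x = expect (draws l n (cand st - B))
        (\<lambda>bs. f (kept (walk f w \<delta> N (Suc i) ?st bs)) - (1 - \<delta>) / l * plenty_credit f w \<delta> N (Suc i) ?st bs - ?r * card B)"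
        unfolding walk_continue[OF go] by (intro expect_cong) (simp add: distrib_left)
      moreover have "\<dots> = expect (draws l n (cand st - B))
        (\<lambda>bs. f (kept (walk f w \<delta> N (Suc i) ?st bs)) - (1 - \<delta>) / l * plenty_credit f w \<delta> N (Suc i) ?st bs) - ?r * card B"
        using V by (subst expect_affine(2)) (auto intro!: finite_draws l_pos)
      ultimately show ?thesis by linarith
    qed
    have outer: "f (kept st) + (\<Sum>v\<in>B. ?g v) / l - ?r * min l (card (cand st)) \<le> expect (pick l B) (?F B)"
      if B: "B \<in> set_pmf (block l (cand st))" for B
    proof -
      note bp = block_props[OF V(2) B]
      let ?h = "\<lambda>x. f (kept st) + (case x of None \<Rightarrow> 0 | Some a \<Rightarrow> ?g a) - ?r * min l (card (cand st))"
      have "?h x \<le> ?F B x" if x: "x \<in> set_pmf (pick l B)" for x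
      proof -
        have "f (kept st) + (case x of None \<Rightarrow> 0 | Some a \<Rightarrow> ?g a) \<le> f (kept (absorb f w B x st))"
          using kept_absorb(1)[OF Suc.prems(1) bp(2), of x _ w] bp(5)[OF x] by (cases x) auto
        then show ?thesis using inner[OF bp(2) bp(5)[OF x]] unfolding bp(3)[symmetric] by linarith
      qed
      then have "expect (pick l B) ?h \<le> expect (pick l B) (?F B)" using bp(4) by (intro expect_mono)
      moreover have "expect (pick l B) ?h = f (kept st) + (\<Sum>v\<in>B. ?g v) / l - ?r * min l (card (cand st))"
        unfolding bp(6) using l_pos bp(1) by (simp add: sum.distrib sum_subtractf field_simps)
      ultimately show ?thesis by simp
    qed
    have "expect (block l (cand st)) (\<lambda>B. f (kept st) + (\<Sum>v\<in>B. ?g v) / l - ?r * min l (card (cand st)))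
        \<le> expect (block l (cand st)) (\<lambda>B. expect (pick l B) (?F B))"
      using V outer by (intro expect_mono finite_block)
    also have "\<dots> = expect (draws l (budget st) (cand st))
      (\<lambda>bs. f (kept (walk f w \<delta> N i st bs)) - (1 - \<delta>) / l * plenty_credit f w \<delta> N i st bs)"
      unfolding n using False V l_pos by (subst expect_draws_Suc) auto
    finally have main: "f (kept st) + min l (card (cand st)) / card (cand st) * (\<Sum>v\<in>cand st. ?g v) / l - ?r * min l (card (cand st))
       \<le> expect (draws l (budget st) (cand st))
      (\<lambda>bs. f (kept (walk f w \<delta> N i st bs)) - (1 - \<delta>) / l * plenty_credit f w \<delta> N i st bs)"
      using V by (simp add: expect_affine finite_block expect_block_sum)
    have c: "0 < card (cand st)" using False V by (auto simp: card_gt_0_iff)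
    have "?r * l * card (cand st) \<le> (\<Sum>v\<in>cand st. ?g v)"
    proof (cases "plenty f w \<delta> N st")
      case True
      \<comment> \<open>\<open>plenty\<close> refers to \<open>N\<close>, which the current number
        of candidates does not exceed, so the alive share is at least 1 - \<delta>.\<close>
      have "(1 - \<delta>) * card (cand st) \<le> (1 - \<delta>) * N" using Suc.prems delta by (intro mult_left_mono) auto
      then have "(1 - \<delta>) * card (cand st) \<le> card (alive f w st)" using True unfolding plenty_def by linarith
      then have "w * ((1 - \<delta>) * card (cand st)) \<le> w * card (alive f w st)" using Suc.prems by (intro mult_left_mono) auto
      also have "\<dots> = (\<Sum>v\<in>alive f w st. w)" by simp
      also have "\<dots> \<le> (\<Sum>v\<in>alive f w st. ?g v)" by (intro sum_mono) (auto simp: alive_def)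
      also have "\<dots> \<le> (\<Sum>v\<in>cand st. ?g v)" using V by (intro sum_mono2) (auto simp: alive_def)
      finally have "w * ((1 - \<delta>) * card (cand st)) \<le> (\<Sum>v\<in>cand st. ?g v)" .
      moreover have "?r * l * card (cand st) = w * ((1 - \<delta>) * card (cand st))" using True l_pos by simp
      ultimately show ?thesis by (simp only:)
    qed (auto intro: sum_nonneg)
    then have "min l (card (cand st)) / card (cand st) / l * (?r * l * card (cand st)) \<le> min l (card (cand st)) / card (cand st) / l * (\<Sum>v\<in>cand st. ?g v)"
      by (intro mult_left_mono) auto
    moreover have "min l (card (cand st)) / card (cand st) / l * (?r * l * card (cand st)) = ?r * min l (card (cand st))"
      using l_pos c by simp
    ultimately show ?thesis using main by simp
  qed
qed

text \<open>An upper bound for the probability that \<open>v\<close> is eventually taken.\<close>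

definition risk :: "'a \<Rightarrow> 'a gstate \<Rightarrow> real" where
  "risk v st = (if v \<in> taken st then 1 else if v \<in> seen st then 0 else 1 / l)"

lemma risk_cand [simp]: "risk v (st\<lparr>cand := V\<rparr>) = risk v st"
  by (simp add: risk_def)

text \<open>A supermartingale argument: when its block is drawn, an undecided element moves from
  risk 1 / l to 1 or 0 with mean 1 / l. From then on it is seen, is no candidate any more, and its
  risk is fixed.\<close>

lemma expect_walk_risk:
  assumes "wf st"
  shows "expect (draws l (budget st) (cand st)) (\<lambda>bs. risk v (walk f w \<delta> N i st bs)) \<le> risk v st"
  using assms
proof (induction "budget st" arbitrary: st i)
  case 0
  then show ?case by (simp flip: 0(1))
next
  case (Suc n)
  note n = Suc.hyps(2)[symmetric]
  have V: "finite (cand st)" "cand st \<subseteq> U" using Suc.prems by (auto simp: wf_def intro!: finite_sub)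
  show ?case
  proof (cases "cand st = {} \<or> 0 < i \<and> grid \<delta> i \<and> \<not> plenty f w \<delta> N st")
    case True
    have const: "risk v (walk f w \<delta> N i st bs) = risk v st"
      if "bs \<in> set_pmf (draws l (budget st) (cand st))" for bs
    proof -
      have "valid_draws l (budget st) (cand st) bs" using set_draws[OF l_pos V(1)] that by blast
      then show ?thesis using True by (cases bs) auto
    qed
    show ?thesis by (subst expect_cong[OF const]) auto
  next
    case False
    then have go: "\<not> (0 < i \<and> grid \<delta> i \<and> \<not> plenty f w \<delta> N st)" by simp
    let ?F = "\<lambda>B x. expect (draws l n (cand st - B)) (\<lambda>bs. risk v (walk f w \<delta> N i st ((B, x) # bs)))"
    have "expect (pick l B) (?F B) \<le> risk v st" if B: "B \<in> set_pmf (block l (cand st))" for B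
    proof -
      note bp = block_props[OF V(2) B]
      have "?F B x \<le> risk v (absorb f w B x st)" if x: "x \<in> set_pmf (pick l B)" for x
        using Suc.hyps(1)[of "absorb f w B x st" "Suc i"] n wf_absorb[OF Suc.prems bp(2) bp(5)[OF x], of w]
        unfolding walk_continue(1)[OF go] by simp
      then have "expect (pick l B) (?F B) \<le> expect (pick l B) (\<lambda>x. risk v (absorb f w B x st))"
        using bp(4) by (intro expect_mono)
      also have "\<dots> \<le> risk v st"
      proof (cases "v \<in> B")
        case True
        then have "v \<notin> taken st" "v \<notin> seen st" using bp(2) Suc.prems by (auto simp: wf_def)
        then have "(\<lambda>x. risk v (absorb f w B x st)) = (\<lambda>x. of_bool (x = Some v))"
          using True by (intro ext) (auto simp: risk_def)
        then have "expect (pick l B) (\<lambda>x. risk v (absorb f w B x st)) = (\<Sum>b\<in>B. of_bool (b = v)) / l"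
          using bp(6)[of "\<lambda>x. of_bool (x = Some v)"] by simp
        also have "(\<Sum>b\<in>B. of_bool (b = v)) = (1 :: real)"
          using True bp(1) by (simp add: of_bool_def)
        finally show ?thesis using \<open>v \<notin> taken st\<close> \<open>v \<notin> seen st\<close> by (simp add: risk_def)
      next
        case False
        have "risk v (absorb f w B x st) = risk v st" if "x \<in> set_pmf (pick l B)" for x
          using False bp(5)[OF that] by (auto simp: risk_def)
        then show ?thesis by (subst expect_cong[of _ _ "\<lambda>_. risk v st"]) auto
      qed
      finally show ?thesis .
    qed
    then have "expect (block l (cand st)) (\<lambda>B. expect (pick l B) (?F B)) \<le> expect (block l (cand st)) (\<lambda>_. risk v st)"
      using V by (intro expect_mono finite_block)
    then show ?thesis unfolding n using False V l_pos by (subst expect_draws_Suc) auto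
  qed
qed

end

section \<open>Stages\<close>

definition batch_pmf :: "('a set \<Rightarrow> real) \<Rightarrow> real \<Rightarrow> real \<Rightarrow> nat \<Rightarrow> 'a gstate \<Rightarrow> 'a gstate pmf" where
  "batch_pmf f w \<delta> l st = (if cand st = {} \<or> budget st = 0 then return_pmf st
     else map_pmf (walk f w \<delta> (card (cand st)) 0 st) (draws l (budget st) (cand st)))"

fun batches_pmf :: "('a set \<Rightarrow> real) \<Rightarrow> real \<Rightarrow> real \<Rightarrow> nat \<Rightarrow> nat \<Rightarrow> 'a gstate \<Rightarrow> 'a gstate pmf" where
  "batches_pmf f w \<delta> l 0 st = return_pmf st"
| "batches_pmf f w \<delta> l (Suc T) st = bind_pmf (batch_pmf f w \<delta> l st) (batches_pmf f w \<delta> l T)"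

text \<open>Elements already seen stay excluded when the threshold drops; a second chance could push
  their probability of joining above 1 / l.\<close>

definition refill :: "'a set \<Rightarrow> ('a set \<Rightarrow> real) \<Rightarrow> real \<Rightarrow> 'a gstate \<Rightarrow> 'a gstate" where
  "refill U f w st = st\<lparr>cand := {v \<in> U - seen st. w \<le> gain f (taken st) v}\<rparr>"

fun levels_pmf :: "'a set \<Rightarrow> ('a set \<Rightarrow> real) \<Rightarrow> real \<Rightarrow> nat \<Rightarrow> nat \<Rightarrow> nat \<Rightarrow> real \<Rightarrow> 'a gstate \<Rightarrow> 'a gstate pmf" where
  "levels_pmf U f \<delta> l T 0 w st = return_pmf st"
| "levels_pmf U f \<delta> l T (Suc L) w st =
     bind_pmf (batches_pmf f w \<delta> l T (refill U f w st)) (levels_pmf U f \<delta> l T L ((1 - \<delta>) * w))"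

definition top_gain :: "'a set \<Rightarrow> ('a set \<Rightarrow> real) \<Rightarrow> 'a set \<Rightarrow> real" where
  "top_gain U f G = Max (gain f G ` U)"

definition init_state :: "nat \<Rightarrow> 'a set \<Rightarrow> 'a gstate" where
  "init_state m G = \<lparr>taken = G, kept = G, seen = {}, cand = {}, budget = m, credit = 0\<rparr>"

definition stage_pmf :: "'a set \<Rightarrow> ('a set \<Rightarrow> real) \<Rightarrow> real \<Rightarrow> nat \<Rightarrow> nat \<Rightarrow> nat \<Rightarrow> nat \<Rightarrow> 'a set \<Rightarrow> 'a set pmf" where
  "stage_pmf U f \<delta> l T L m G = (if top_gain U f G \<le> 0 then return_pmf G
     else map_pmf kept (levels_pmf U f \<delta> l T L (top_gain U f G) (init_state m G)))"

text \<open>The gain of a stage is bounded below in terms of the value \<open>y\<close> of its own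
  output, so \<open>y\<close> occurs twice. Instead of a division by 1 + \<beta> / l, the inequality
  is multiplied by t = 1 - 1 / l, because t (1 + \<beta> / l) \<le> t (1 + 1 / l) \<le> 1.\<close>

lemma stage_recurrence:
  fixes l :: nat and \<beta> g a y :: real
  assumes "0 < l" "0 \<le> \<beta>" "\<beta> \<le> 1" "0 \<le> y" "g + \<beta> / l * ((1 - 1 / l) * a - y) \<le> y"
  shows "(1 - 1 / l) * g + \<beta> / l * (1 - 1 / l)\<^sup>2 * a \<le> y"
proof -
  define t where "t = 1 - 1 / real l"
  have t: "0 \<le> t" "t \<le> 1" using assms(1) by (auto simp: t_def field_simps)
  have "t * (g + \<beta> / l * t * a) \<le> t * ((1 + \<beta> / l) * y)"
    using assms(5) t by (intro mult_left_mono) (auto simp: t_def algebra_simps)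
  also have "\<dots> \<le> y"
  proof -
    have "t * (1 + \<beta> / l) \<le> t * (1 + 1 / l)"
      using assms t by (intro mult_left_mono add_left_mono divide_right_mono) auto
    also have "\<dots> \<le> 1" by (simp add: t_def algebra_simps)
    finally have "t * (1 + \<beta> / l) * y \<le> 1 * y" using assms by (intro mult_right_mono)
    then show ?thesis by (simp add: mult.assoc)
  qed
  finally show ?thesis unfolding t_def[symmetric] by (simp add: algebra_simps power2_eq_square)
qed

lemma kept_walk_mono: "kept st \<subseteq> kept (walk f w \<delta> N i st bs)"
proof (induction bs arbitrary: i st)
  case (Cons b bs)
  obtain B x where b: "b = (B, x)" by (cases b)
  show ?case using Cons[of "absorb f w B x st" "Suc i"] b by auto
qed simp

lemma kept_batches_mono: "st' \<in> set_pmf (batches_pmf f w \<delta> l T st) \<Longrightarrow> kept st \<subseteq> kept st'"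
proof (induction T arbitrary: st)
  case (Suc T)
  then obtain s where s: "s \<in> set_pmf (batch_pmf f w \<delta> l st)" "st' \<in> set_pmf (batches_pmf f w \<delta> l T s)" by auto
  have "kept st \<subseteq> kept s"
    using s(1) by (auto simp: batch_pmf_def split: if_splits intro: kept_walk_mono[THEN subsetD])
  then show ?case using Suc.IH[OF s(2)] by blast
qed simp

lemma kept_levels_mono: "st' \<in> set_pmf (levels_pmf U f \<delta> l T L w st) \<Longrightarrow> kept st \<subseteq> kept st'"
proof (induction L arbitrary: st w)
  case (Suc L)
  then obtain s where s: "s \<in> set_pmf (batches_pmf f w \<delta> l T (refill U f w st))"
    "st' \<in> set_pmf (levels_pmf U f \<delta> l T L ((1 - \<delta>) * w) s)" by auto
  have "kept st \<subseteq> kept s" using kept_batches_mono[OF s(1)] by (simp add: refill_def)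
  then show ?case using Suc.IH[OF s(2)] by blast
qed simp

context threshold_sampling
begin

text \<open>The rate (1 - \<delta>) / l applies to credit earned with plenty of candidates; the
  divisor 1 + \<delta> accounts for the total credit being larger by up to that factor.\<close>

definition yield_rate :: real where
  "yield_rate = (1 - \<delta>) / (l * (1 + \<delta>))"

definition surplus :: "'a gstate \<Rightarrow> real" where
  "surplus st = f (kept st) - yield_rate * credit st"

text \<open>Both martingale properties, in a form closed under \<open>bind_pmf\<close>.\<close>

definition tame :: "'a gstate \<Rightarrow> 'a gstate pmf \<Rightarrow> bool" where
  "tame st D \<longleftrightarrow> finite (set_pmf D) \<and> surplus st \<le> expect D surplus \<and> (\<forall>v. expect D (risk v) \<le> risk v st)"

lemma tame_return: "surplus st \<le> surplus st' \<Longrightarrow> (\<And>v. risk v st' = risk v st) \<Longrightarrow> tame st (return_pmf st')"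
  by (simp add: tame_def)

lemma tame_bind:
  assumes "tame st D" "\<And>s. s \<in> set_pmf D \<Longrightarrow> tame s (K s)"
  shows "tame st (bind_pmf D K)"
proof -
  have fin: "finite (set_pmf D)" "\<And>s. s \<in> set_pmf D \<Longrightarrow> finite (set_pmf (K s))"
    using assms by (auto simp: tame_def)
  have "surplus st \<le> expect D surplus" using assms(1) by (simp add: tame_def)
  also have "\<dots> \<le> expect D (\<lambda>s. expect (K s) surplus)"
    using fin assms(2) by (intro expect_mono) (auto simp: tame_def)
  finally have 1: "surplus st \<le> expect (bind_pmf D K) surplus" using fin by (simp add: expect_bind)
  have 2: "expect (bind_pmf D K) (risk v) \<le> risk v st" for v
  proof -
    have "expect D (\<lambda>s. expect (K s) (risk v)) \<le> expect D (risk v)"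
      using fin assms(2) by (intro expect_mono) (auto simp: tame_def)
    also have "\<dots> \<le> risk v st" using assms(1) by (simp add: tame_def)
    finally show ?thesis using fin by (simp add: expect_bind)
  qed
  show ?thesis using 1 2 fin unfolding tame_def by simp
qed

lemma batch_tame:
  assumes inv: "run_inv w M H st" and al: "alive f w st = cand st" and w: "0 < w"
  shows "tame st (batch_pmf f w \<delta> l st)"
proof (cases "cand st = {} \<or> budget st = 0")
  case True
  then show ?thesis by (simp add: batch_pmf_def tame_def)
next
  case False
  let ?N = "card (cand st)"
  let ?D = "draws l (budget st) (cand st)"
  let ?wk = "walk f w \<delta> ?N 0 st"
  let ?pc = "plenty_credit f w \<delta> ?N 0 st"
  have wf: "wf st" using inv by (simp add: run_inv_def)
  have V: "finite (cand st)" using wf by (auto simp: wf_def intro: finite_sub)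
  have D: "batch_pmf f w \<delta> l st = map_pmf ?wk ?D" using False by (simp add: batch_pmf_def)
  have fin: "finite (set_pmf ?D)" using V l_pos by (intro finite_draws)
  have plenty: "plenty f w \<delta> ?N st" using al False V delta by (simp add: plenty_def card_gt_0_iff)
  have "f (kept (?wk bs)) - (1 - \<delta>) / l * ?pc bs - yield_rate * credit st \<le> surplus (?wk bs)"
    if bs: "bs \<in> set_pmf ?D" for bs
  proof -
    have "credit (?wk bs) - credit st \<le> (1 + \<delta>) * ?pc bs"
      using credit_walk_le[OF wf w, of bs 0 ?N] set_draws[OF l_pos V] bs plenty by auto
    then have "yield_rate * (credit (?wk bs) - credit st) \<le> yield_rate * ((1 + \<delta>) * ?pc bs)"
      using delta by (intro mult_left_mono) (auto simp: yield_rate_def)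
    also have "\<dots> = (1 - \<delta>) / l * ?pc bs" using delta by (simp add: yield_rate_def)
    finally show ?thesis by (simp add: surplus_def algebra_simps)
  qed
  then have "expect ?D (\<lambda>bs. f (kept (?wk bs)) - (1 - \<delta>) / l * ?pc bs - yield_rate * credit st) \<le> expect ?D (\<lambda>bs. surplus (?wk bs))"
    using fin by (intro expect_mono)
  moreover have "expect ?D (\<lambda>bs. f (kept (?wk bs)) - (1 - \<delta>) / l * ?pc bs - yield_rate * credit st)
      = expect ?D (\<lambda>bs. f (kept (?wk bs)) - (1 - \<delta>) / l * ?pc bs) - yield_rate * credit st"
    using fin by (subst expect_affine(2)) auto
  moreover have "f (kept st) \<le> expect ?D (\<lambda>bs. f (kept (?wk bs)) - (1 - \<delta>) / l * ?pc bs)"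
    using wf w by (intro expect_walk_kept) auto
  ultimately have "surplus st \<le> expect ?D (\<lambda>bs. surplus (?wk bs))" by (simp add: surplus_def)
  then show ?thesis
    using fin expect_walk_risk[OF wf, of _ w ?N 0] unfolding D tame_def by simp
qed

lemma batch_props:
  assumes inv: "run_inv w M H st" and al: "alive f w st = cand st" and w: "0 < w"
    and st': "st' \<in> set_pmf (batch_pmf f w \<delta> l st)"
  shows "run_inv w M H st'" "alive f w st' = cand st'" "credit st \<le> credit st'"
    "0 < budget st \<Longrightarrow> cand st \<noteq> {} \<Longrightarrow> credit st + w \<le> credit st'"
    "budget st' = 0 \<or> real (card (cand st')) \<le> (1 - \<delta>) * card (cand st)"
proof -
  have "run_inv w M H st' \<and> alive f w st' = cand st' \<and> credit st \<le> credit st' \<and>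
    (0 < budget st \<longrightarrow> cand st \<noteq> {} \<longrightarrow> credit st + w \<le> credit st') \<and>
    (budget st' = 0 \<or> real (card (cand st')) \<le> (1 - \<delta>) * card (cand st))"
  proof (cases "cand st = {} \<or> budget st = 0")
    case True
    then show ?thesis using assms by (auto simp: batch_pmf_def)
  next
    case False
    have V: "finite (cand st)" using inv by (auto simp: run_inv_def wf_def intro: finite_sub)
    obtain bs where bs: "bs \<in> set_pmf (draws l (budget st) (cand st))" "st' = walk f w \<delta> (card (cand st)) 0 st bs"
      using st' False by (auto simp: batch_pmf_def)
    have "valid_draws l (budget st) (cand st) bs" using set_draws[OF l_pos V] bs by blast
    then show ?thesis using walk_props[OF inv w _ _, of bs] False bs(2) w by auto
  qed
  then show "run_inv w M H st'" "alive f w st' = cand st'" "credit st \<le> credit st'"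
    "0 < budget st \<Longrightarrow> cand st \<noteq> {} \<Longrightarrow> credit st + w \<le> credit st'"
    "budget st' = 0 \<or> real (card (cand st')) \<le> (1 - \<delta>) * card (cand st)" by auto
qed

lemma batches_no_budget: "budget st = 0 \<Longrightarrow> batches_pmf f w \<delta> l T st = return_pmf st"
  by (induction T) (auto simp: batch_pmf_def bind_return_pmf)

lemma batches_props:
  assumes "run_inv w M H st" "alive f w st = cand st" "0 < w"
  shows "tame st (batches_pmf f w \<delta> l T st) \<and> (\<forall>st'\<in>set_pmf (batches_pmf f w \<delta> l T st).
    run_inv w M H st' \<and> credit st \<le> credit st' \<and>
    (0 < T \<longrightarrow> 0 < budget st \<longrightarrow> cand st \<noteq> {} \<longrightarrow> credit st + w \<le> credit st') \<and>
    (budget st' = 0 \<or> real (card (cand st')) \<le> (1 - \<delta>) ^ T * card (cand st)))"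
  using assms
proof (induction T arbitrary: st)
  case 0
  then show ?case by (auto simp: tame_def)
next
  case (Suc T)
  note bp = batch_props[OF Suc.prems]
  have "tame st (batches_pmf f w \<delta> l (Suc T) st)"
    using batch_tame[OF Suc.prems] Suc.IH[OF bp(1,2) Suc.prems(3)] by (auto intro!: tame_bind)
  moreover have "run_inv w M H st' \<and> credit st \<le> credit st' \<and>
    (0 < budget st \<longrightarrow> cand st \<noteq> {} \<longrightarrow> credit st + w \<le> credit st') \<and>
    (budget st' = 0 \<or> real (card (cand st')) \<le> (1 - \<delta>) ^ Suc T * card (cand st))"
    if st': "st' \<in> set_pmf (batches_pmf f w \<delta> l (Suc T) st)" for st'
  proof -
    obtain s where s: "s \<in> set_pmf (batch_pmf f w \<delta> l st)" "st' \<in> set_pmf (batches_pmf f w \<delta> l T s)"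
      using st' by auto
    note b = bp[OF s(1)]
    have IH: "run_inv w M H st'" "credit s \<le> credit st'"
      "budget st' = 0 \<or> real (card (cand st')) \<le> (1 - \<delta>) ^ T * card (cand s)"
      using Suc.IH[OF b(1,2) Suc.prems(3)] s(2) by auto
    have "budget st' = 0 \<or> real (card (cand st')) \<le> (1 - \<delta>) ^ Suc T * card (cand st)"
    proof (cases "budget s = 0")
      case True
      then show ?thesis using batches_no_budget[OF True, of w T] s(2) by simp
    next
      case False
      then have "real (card (cand s)) \<le> (1 - \<delta>) * card (cand st)" using b(5) by simp
      then have "(1 - \<delta>) ^ T * card (cand s) \<le> (1 - \<delta>) ^ T * ((1 - \<delta>) * card (cand st))"
        using delta by (intro mult_left_mono) auto
      then show ?thesis using IH(3) by (auto simp: mult_ac)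
    qed
    then show ?thesis using IH b(3,4) by fastforce
  qed
  ultimately show ?case by blast
qed

text \<open>\<open>H\<close> is lowered by \<open>l\<close> at each level to pay for one short
  block. Once the budget is spent only the candidates are refilled, so the charging inequality stays
  at the threshold \<open>w'\<close> in force at that time while \<open>w\<close> keeps
  falling.\<close>

definition level_inv :: "real \<Rightarrow> nat \<Rightarrow> nat \<Rightarrow> 'a gstate \<Rightarrow> bool" where
  "level_inv w M H st \<longleftrightarrow> taken st \<subseteq> U \<and> kept st \<subseteq> taken st \<and> seen st \<subseteq> U \<and>
     f (taken st) \<le> f (kept st) \<and> card (kept st) + budget st \<le> M \<and> H \<le> card (seen st) + l * budget st \<and>
     (covered w st \<or> budget st = 0 \<and> (\<exists>w'>0. covered w' st))"

lemma refill_simps [simp]: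
  "taken (refill U f w st) = taken st" "kept (refill U f w st) = kept st" "seen (refill U f w st) = seen st"
  "budget (refill U f w st) = budget st" "credit (refill U f w st) = credit st"
  "covered w' (refill U f w st) = covered w' st"
  by (simp_all add: refill_def)

lemma run_inv_refill:
  assumes inv: "level_inv w M H st" and w: "0 < w" and budget: "budget st \<noteq> 0"
  shows "run_inv w M H (refill U f w st)" "alive f w (refill U f w st) = cand (refill U f w st)"
proof -
  have "cand (refill U f w st) \<inter> taken st = {}" using w by (auto simp: refill_def gain_mem)
  then have "wf (refill U f w st)" using inv by (auto simp: wf_def level_inv_def refill_def)
  then show "run_inv w M H (refill U f w st)"
    using inv budget unfolding run_inv_def level_inv_def by (auto simp: refill_def)
  show "alive f w (refill U f w st) = cand (refill U f w st)" by (auto simp: alive_def refill_def)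
qed

lemma level_inv_init:
  assumes G: "G \<subseteq> U" and W: "0 < W" "\<And>v. v \<in> U \<Longrightarrow> gain f G v \<le> W"
  shows "level_inv W (card G + m) (l * m) (init_state m G)"
proof -
  have "covered W (init_state m G)"
    unfolding covered_def
  proof (intro conjI ballI allI impI)
    fix v assume "v \<in> U - seen (init_state m G)"
    then have "gain_pos f G v \<le> W" using W by (auto simp: init_state_def)
    then have "(1 - \<delta>) * gain_pos f G v \<le> 1 * W" using delta by (intro mult_mono) auto
    then show "(1 - \<delta>) * gain_pos f (taken (init_state m G)) v \<le> W" by (simp add: init_state_def)
  qed (auto simp: init_state_def)
  then show ?thesis using G by (simp add: level_inv_def init_state_def)
qed

text \<open>After \<open>T\<close> batches fewer than one candidate is left unless the budget is
  gone. Without candidates every unseen element gains less than \<open>w\<close>, so the charging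
  inequality passes to the threshold (1 - \<delta>) w.\<close>

lemma level_props:
  assumes inv: "level_inv w M H st" and w: "0 < w" and T: "(1 - \<delta>) ^ T * card U < 1"
  shows "tame st (batches_pmf f w \<delta> l T (refill U f w st)) \<and> (\<forall>st'\<in>set_pmf (batches_pmf f w \<delta> l T (refill U f w st)).
    level_inv ((1 - \<delta>) * w) M (H - l) st' \<and> credit st \<le> credit st' \<and>
    (0 < T \<longrightarrow> 0 < budget st \<longrightarrow> (\<exists>v\<in>U - seen st. w \<le> gain f (taken st) v) \<longrightarrow> credit st + w \<le> credit st'))"
proof (cases "budget st = 0")
  case True
  have "\<exists>w'>0. covered w' st" using inv True w by (auto simp: level_inv_def)
  then have "level_inv ((1 - \<delta>) * w) M (H - l) (refill U f w st)"
    using inv True by (auto simp: level_inv_def)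
  moreover have "tame st (return_pmf (refill U f w st))"
    by (intro tame_return) (auto simp: surplus_def risk_def)
  ultimately show ?thesis using True by (simp add: batches_no_budget)
next
  case False
  let ?st = "refill U f w st"
  note run = run_inv_refill[OF inv w False]
  note bp = batches_props[OF run w, of T]
  have "surplus ?st = surplus st" "risk v ?st = risk v st" for v by (auto simp: surplus_def risk_def)
  then have "tame st (batches_pmf f w \<delta> l T ?st)" using bp unfolding tame_def by simp
  moreover have "level_inv ((1 - \<delta>) * w) M (H - l) st' \<and> credit st \<le> credit st' \<and>
    (0 < T \<longrightarrow> 0 < budget st \<longrightarrow> (\<exists>v\<in>U - seen st. w \<le> gain f (taken st) v) \<longrightarrow> credit st + w \<le> credit st')"
    if st': "st' \<in> set_pmf (batches_pmf f w \<delta> l T ?st)" for st'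
  proof -
    have p: "run_inv w M H st'" "credit st \<le> credit st'"
      "0 < T \<longrightarrow> 0 < budget st \<longrightarrow> cand ?st \<noteq> {} \<longrightarrow> credit st + w \<le> credit st'"
      "budget st' = 0 \<or> real (card (cand st')) \<le> (1 - \<delta>) ^ T * card (cand ?st)"
      using bp st' by auto
    have "card (cand ?st) \<le> card U" using finite_ground by (intro card_mono) (auto simp: refill_def)
    then have "(1 - \<delta>) ^ T * card (cand ?st) \<le> (1 - \<delta>) ^ T * card U" using delta by (intro mult_left_mono) auto
    then have "budget st' = 0 \<or> card (cand st') = 0" using p(4) T by auto
    moreover have "finite (cand st')" using p(1) by (auto simp: run_inv_def wf_def intro: finite_sub)
    ultimately have fin: "budget st' = 0 \<or> cand st' = {}" by auto
    have cov': "covered w st'" using p(1) by (simp add: run_inv_def)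
    have "covered ((1 - \<delta>) * w) st'" if e: "cand st' = {}"
    proof -
      have "(1 - \<delta>) * gain_pos f (taken st') v \<le> (1 - \<delta>) * w" if "v \<in> U - seen st'" for v
      proof -
        have "gain f (taken st') v < w" using p(1) e that by (auto simp: run_inv_def)
        then show ?thesis using delta w by (intro mult_left_mono) auto
      qed
      moreover have "(1 - \<delta>) * w * card (seen st' - Z) \<le> w * card (seen st' - Z)" for Z
        using delta w by (intro mult_right_mono) auto
      ultimately show ?thesis using cov' unfolding covered_def by (meson add_left_mono order_trans)
    qed
    then have "level_inv ((1 - \<delta>) * w) M (H - l) st'"
      using p(1) fin cov' w unfolding level_inv_def run_inv_def wf_def by (auto split: if_splits)
    moreover have "cand ?st \<noteq> {}" if "\<exists>v\<in>U - seen st. w \<le> gain f (taken st) v"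
      using that by (auto simp: refill_def)
    ultimately show ?thesis using p by blast
  qed
  ultimately show ?thesis by blast
qed

lemma levels_props:
  assumes "level_inv w M H st" "0 < w" "(1 - \<delta>) ^ T * card U < 1"
  shows "tame st (levels_pmf U f \<delta> l T L w st) \<and> (\<forall>st'\<in>set_pmf (levels_pmf U f \<delta> l T L w st).
    level_inv ((1 - \<delta>) ^ L * w) M (H - L * l) st' \<and> credit st \<le> credit st' \<and>
    (0 < L \<longrightarrow> 0 < T \<longrightarrow> 0 < budget st \<longrightarrow> (\<exists>v\<in>U - seen st. w \<le> gain f (taken st) v) \<longrightarrow> credit st + w \<le> credit st'))"
  using assms(1,2)
proof (induction L arbitrary: st w H)
  case 0
  then show ?case by (simp add: tame_def)
next
  case (Suc L)
  note lp = level_props[OF Suc.prems assms(3)]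
  have w': "0 < (1 - \<delta>) * w" using Suc.prems delta by simp
  have "tame st (levels_pmf U f \<delta> l T (Suc L) w st)"
    using lp Suc.IH[OF _ w'] by (auto intro!: tame_bind)
  moreover have "level_inv ((1 - \<delta>) ^ Suc L * w) M (H - Suc L * l) st' \<and> credit st \<le> credit st' \<and>
    (0 < T \<longrightarrow> 0 < budget st \<longrightarrow> (\<exists>v\<in>U - seen st. w \<le> gain f (taken st) v) \<longrightarrow> credit st + w \<le> credit st')"
    if st': "st' \<in> set_pmf (levels_pmf U f \<delta> l T (Suc L) w st)" for st'
  proof -
    obtain s where s: "s \<in> set_pmf (batches_pmf f w \<delta> l T (refill U f w st))"
      "st' \<in> set_pmf (levels_pmf U f \<delta> l T L ((1 - \<delta>) * w) s)" using st' by auto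
    have 1: "level_inv ((1 - \<delta>) * w) M (H - l) s" "credit st \<le> credit s"
      "0 < T \<longrightarrow> 0 < budget st \<longrightarrow> (\<exists>v\<in>U - seen st. w \<le> gain f (taken st) v) \<longrightarrow> credit st + w \<le> credit s"
      using lp s(1) by auto
    have 2: "level_inv ((1 - \<delta>) ^ L * ((1 - \<delta>) * w)) M (H - l - L * l) st'" "credit s \<le> credit st'"
      using Suc.IH[OF 1(1) w'] s(2) by auto
    have "(1 - \<delta>) ^ L * ((1 - \<delta>) * w) = (1 - \<delta>) ^ Suc L * w" "H - l - L * l = H - Suc L * l" by simp_all
    then have "level_inv ((1 - \<delta>) ^ Suc L * w) M (H - Suc L * l) st'" using 2(1) by (simp only:)
    then show ?thesis using 1(2,3) 2(2) by linarith
  qed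
  ultimately show ?case by blast
qed

text \<open>The unseen part of \<open>Z\<close> costs at most \<open>w\<close> per element, the part
  of \<open>seen\<close> outside \<open>Z\<close> pays \<open>w\<close> per element, and the sizes
  of these parts differ by exactly as much as those of \<open>Z\<close> and
  \<open>seen\<close>.\<close>

lemma covered_sum:
  assumes "covered w st" "0 < w" "seen st \<subseteq> U" "Z \<subseteq> U" "card Z \<le> k"
  shows "(1 - \<delta>) * (\<Sum>z\<in>Z. gain_pos f (taken st) z) \<le> credit st + w * (real k - card (seen st))"
    and "w * card (seen st) \<le> credit st"
proof -
  let ?g = "gain_pos f (taken st)"
  have fin: "finite Z" "finite (seen st)" using assms by (auto intro: finite_sub)
  have "(\<Sum>z\<in>Z. ?g z) = (\<Sum>z\<in>Z \<inter> seen st. ?g z) + (\<Sum>z\<in>Z - seen st. ?g z)"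
    using fin by (metis sum.Int_Diff)
  then have "(1 - \<delta>) * (\<Sum>z\<in>Z. ?g z) = (1 - \<delta>) * (\<Sum>z\<in>Z \<inter> seen st. ?g z) + (\<Sum>z\<in>Z - seen st. (1 - \<delta>) * ?g z)"
    by (simp add: distrib_left sum_distrib_left)
  moreover have "(\<Sum>z\<in>Z - seen st. (1 - \<delta>) * ?g z) \<le> (\<Sum>z\<in>Z - seen st. w)"
    using assms(1,4) unfolding covered_def by (intro sum_mono) blast
  moreover have "(1 - \<delta>) * (\<Sum>z\<in>Z \<inter> seen st. ?g z) + w * card (seen st - Z \<inter> seen st) \<le> credit st"
    using assms(1) unfolding covered_def by blast
  moreover have "seen st - Z \<inter> seen st = seen st - Z" by auto
  moreover have "real (card (Z - seen st)) - card (seen st - Z) \<le> real k - card (seen st)"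
  proof -
    have "card Z = card (Z \<inter> seen st) + card (Z - seen st)" using fin by (metis card_Int_Diff)
    moreover have "card (seen st) = card (Z \<inter> seen st) + card (seen st - Z)" using fin by (metis card_Int_Diff inf_commute)
    ultimately show ?thesis using assms(5) by linarith
  qed
  then have "w * (real (card (Z - seen st)) - card (seen st - Z)) \<le> w * (real k - card (seen st))"
    using assms(2) by (intro mult_left_mono) auto
  ultimately show "(1 - \<delta>) * (\<Sum>z\<in>Z. ?g z) \<le> credit st + w * (real k - card (seen st))"
    by (simp add: algebra_simps)
  show "w * card (seen st) \<le> credit st"
    using assms(1) unfolding covered_def by (auto dest!: spec[of _ "{}"])
qed

text \<open>A stage ends in one of two ways. Either the threshold is so low that \<open>k\<close>
  elements at that rate amount to a \<delta>-fraction of the credit. Or the budget is spent after at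
  least (1 - \<delta>) k elements have been seen; then w' (1 - \<delta>) k is at most the credit,
  which pays for the missing \<delta> k elements. Each case costs the second factor 1 -
  \<delta>.\<close>

lemma stage_end_gain:
  assumes inv: "level_inv w M H st" and w: "0 < w" and Z: "Z \<subseteq> U" "card Z \<le> k"
    and H: "(1 - \<delta>) * k \<le> H" and small: "k * w \<le> \<delta> * credit st"
  shows "(1 - \<delta>)\<^sup>2 * (f (Z \<union> taken st) - f (taken st)) \<le> credit st"
proof -
  let ?S = "\<Sum>z\<in>Z. gain_pos f (taken st) z"
  have sU: "seen st \<subseteq> U" "taken st \<subseteq> U" using inv by (auto simp: level_inv_def)
  have "(1 - \<delta>) * ((1 - \<delta>) * ?S) \<le> credit st"
  proof (cases "covered w st")
    case True
    note c = covered_sum[OF True w sU(1) Z]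
    have "0 \<le> w * card (seen st)" using w by simp
    then have "(1 - \<delta>) * ?S \<le> (1 + \<delta>) * credit st" using c(1) small by (simp add: algebra_simps)
    then have "(1 - \<delta>) * ((1 - \<delta>) * ?S) \<le> (1 - \<delta>) * ((1 + \<delta>) * credit st)" using delta by (intro mult_left_mono) auto
    also have "\<dots> = credit st - \<delta>\<^sup>2 * credit st" by (simp add: algebra_simps power2_eq_square)
    also have "\<dots> \<le> credit st" using c(2) \<open>0 \<le> w * card (seen st)\<close> by simp
    finally show ?thesis .
  next
    case False
    then obtain w' where w': "0 < w'" "covered w' st" and b: "budget st = 0" using inv by (auto simp: level_inv_def)
    note c = covered_sum[OF w'(2,1) sU(1) Z]
    have s: "(1 - \<delta>) * k \<le> card (seen st)" using inv b H by (simp add: level_inv_def)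
    then have "w' * ((1 - \<delta>) * k) \<le> w' * card (seen st)" using w' by (intro mult_left_mono) auto
    then have 1: "w' * ((1 - \<delta>) * k) \<le> credit st" using c(2) by linarith
    have "w' * (real k - card (seen st)) \<le> w' * (\<delta> * k)" using s w' by (intro mult_left_mono) (auto simp: algebra_simps)
    then have "(1 - \<delta>) * ?S \<le> credit st + w' * (\<delta> * k)" using c(1) by linarith
    then have "(1 - \<delta>) * ((1 - \<delta>) * ?S) \<le> (1 - \<delta>) * (credit st + w' * (\<delta> * k))" using delta by (intro mult_left_mono) auto
    also have "\<dots> = (1 - \<delta>) * credit st + \<delta> * (w' * ((1 - \<delta>) * k))" by (simp add: algebra_simps)
    also have "\<dots> \<le> (1 - \<delta>) * credit st + \<delta> * credit st" using 1 delta by (intro add_left_mono mult_left_mono) auto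
    finally show ?thesis by (simp add: algebra_simps)
  qed
  moreover have "(1 - \<delta>)\<^sup>2 * (f (Z \<union> taken st) - f (taken st)) \<le> (1 - \<delta>)\<^sup>2 * ?S"
    using union_le_sum_gain_pos[OF Z(1) sU(2)] by (intro mult_left_mono) auto
  ultimately show ?thesis by (simp add: power2_eq_square mult.assoc)
qed

text \<open>Origin of \<beta>: the charging loses \<open>(1 - \<delta>)\<^sup>2\<close>, the share
  of dead candidates another 1 - \<delta>, and the blocks absorbed too late the divisor 1 +
  \<delta>. The assumption on \<open>m\<close> leaves room for \<open>L\<close> short
  blocks.\<close>

lemma stage_props:
  assumes G: "G \<subseteq> U" and Z: "Z \<subseteq> U" "card Z \<le> k" and ne: "U \<noteq> {}"
    and T: "0 < T" "(1 - \<delta>) ^ T * card U < 1" and L: "0 < L" "k * (1 - \<delta>) ^ L \<le> \<delta>"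
    and m: "0 < m" "(1 - \<delta>) * k + L * l \<le> l * m"
  defines "D \<equiv> stage_pmf U f \<delta> l T L m G" and "\<beta> \<equiv> (1 - \<delta>) ^ 3 / (1 + \<delta>)"
  shows "finite (set_pmf D)" "\<And>G'. G' \<in> set_pmf D \<Longrightarrow> G' \<subseteq> U \<and> card G' \<le> card G + m"
    "(1 - 1 / l) * f (Z \<union> G) \<le> expect D (\<lambda>G'. f (Z \<union> G'))"
    "(1 - 1 / l) * f G + \<beta> / l * (1 - 1 / l)\<^sup>2 * f (Z \<union> G) \<le> expect D f"
proof -
  have "(1 - \<delta>) ^ 3 \<le> 1" using delta by (intro power_le_one) auto
  then have beta: "0 \<le> \<beta>" "\<beta> \<le> 1" unfolding \<beta>_def using delta by (auto simp: divide_le_eq)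
  define W where "W = top_gain U f G"
  have W: "gain f G v \<le> W" if "v \<in> U" for v
    unfolding W_def top_gain_def using finite_ground that by (intro Max_ge) auto
  have fZG: "0 \<le> f (Z \<union> G)" "0 \<le> f G" using G Z by (auto intro: nonneg)
  have t: "0 \<le> 1 - 1 / real l" "1 - 1 / real l \<le> 1" using l_pos by auto
  have "finite (set_pmf D) \<and> (\<forall>G'\<in>set_pmf D. G' \<subseteq> U \<and> card G' \<le> card G + m) \<and>
    (1 - 1 / l) * f (Z \<union> G) \<le> expect D (\<lambda>G'. f (Z \<union> G')) \<and>
    (1 - 1 / l) * f G + \<beta> / l * (1 - 1 / l)\<^sup>2 * f (Z \<union> G) \<le> expect D f"
  proof (cases "W \<le> 0")
    case True
    then have D: "D = return_pmf G" by (simp add: D_def stage_pmf_def W_def)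
    have "(\<Sum>z\<in>Z. gain_pos f G z) = 0" using W True Z by (intro sum.neutral) (fastforce simp: max_def)
    then have le: "f (Z \<union> G) \<le> f G" using union_le_sum_gain_pos[OF Z(1) G] by simp
    have tle: "(1 - 1 / l) * f (Z \<union> G) \<le> f (Z \<union> G)" using fZG t by (intro mult_left_le_one_le) auto
    then have "(1 - 1 / l) * f (Z \<union> G) - f G \<le> 0" using le by linarith
    then have "\<beta> / l * ((1 - 1 / l) * f (Z \<union> G) - f G) \<le> 0" using beta by (intro mult_nonneg_nonpos) auto
    then have "(1 - 1 / l) * f G + \<beta> / l * (1 - 1 / l)\<^sup>2 * f (Z \<union> G) \<le> f G"
      using beta fZG l_pos by (intro stage_recurrence) auto
    then show ?thesis using D tle G by simp
  next
    case False
    let ?D = "levels_pmf U f \<delta> l T L W (init_state m G)"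
    have D: "D = map_pmf kept ?D" using False by (simp add: D_def stage_pmf_def W_def)
    have inv: "level_inv W (card G + m) (l * m) (init_state m G)"
      using G False W by (intro level_inv_init) auto
    obtain v0 where v0: "v0 \<in> U" "W = gain f G v0"
    proof -
      have "W \<in> gain f G ` U" unfolding W_def top_gain_def using finite_ground ne by (intro Max_in) auto
      then show ?thesis using that by auto
    qed
    note lp = levels_props[OF inv _ T(2), of L]
    have fin: "finite (set_pmf ?D)" using lp False by (simp add: tame_def)
    have sup: "f G \<le> expect ?D surplus" using lp False by (simp add: tame_def surplus_def init_state_def)
    have rk: "expect ?D (risk v) \<le> risk v (init_state m G)" for v using lp False by (simp add: tame_def)
    have out: "level_inv ((1 - \<delta>) ^ L * W) (card G + m) (l * m - L * l) st" "W \<le> credit st" "G \<subseteq> kept st"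
      if st: "st \<in> set_pmf ?D" for st
    proof -
      show "level_inv ((1 - \<delta>) ^ L * W) (card G + m) (l * m - L * l) st" using lp False st by auto
      \<comment> \<open>The element of largest gain is unseen and meets the first threshold, so the
        first level collects credit at least \<open>W\<close>; this makes the final threshold
        comparable with the credit.\<close>
      have "credit (init_state m G) + W \<le> credit st"
        using lp False st L(1) T(1) m(1) v0 by (force simp: init_state_def)
      then show "W \<le> credit st" by (simp add: init_state_def)
      show "G \<subseteq> kept st" using kept_levels_mono[OF st] by (simp add: init_state_def)
    qed
    have sets: "taken st \<subseteq> U" "kept st \<subseteq> taken st" "f (taken st) \<le> f (kept st)" "card (kept st) \<le> card G + m"
      if "st \<in> set_pmf ?D" for st using out(1)[OF that] by (auto simp: level_inv_def)
    have prob: "expect ?D (\<lambda>st. of_bool (v \<in> A st - G)) \<le> 1 / l"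
      if A: "\<And>st. st \<in> set_pmf ?D \<Longrightarrow> A st \<subseteq> taken st" for A v
    proof (cases "v \<in> G")
      case False
      have "expect ?D (\<lambda>st. of_bool (v \<in> A st - G)) \<le> expect ?D (risk v)"
        using A by (intro expect_mono[OF fin]) (auto simp: risk_def)
      also have "\<dots> \<le> 1 / l" using rk[of v] False by (simp add: risk_def init_state_def)
      finally show ?thesis .
    qed simp
    \<comment> \<open>Used for \<open>kept\<close>, which is the output, and for
      \<open>taken\<close>, relative to which the remaining gain is bounded.\<close>
    have big: "(1 - 1 / l) * f (Z \<union> G) \<le> expect ?D (\<lambda>st. f (Z \<union> A st))"
      if A: "\<And>st. st \<in> set_pmf ?D \<Longrightarrow> G \<subseteq> A st \<and> A st \<subseteq> taken st" for A
    proof -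
      have "(1 - 1 / l) * f (Z \<union> G) \<le> expect ?D (\<lambda>st. f (Z \<union> G \<union> (A st - G)))"
        using prob[of A] A sets(1) G Z l_pos by (intro random_union_ge[OF fin]) (auto, blast)
      also have "\<dots> = expect ?D (\<lambda>st. f (Z \<union> A st))"
        using A by (intro expect_cong arg_cong[of _ _ f]) auto
      finally show ?thesis .
    qed
    have kept_big: "(1 - 1 / l) * f (Z \<union> G) \<le> expect ?D (\<lambda>st. f (Z \<union> kept st))"
      using out(3) sets(2) by (intro big) auto
    have taken_big: "(1 - 1 / l) * f (Z \<union> G) \<le> expect ?D (\<lambda>st. f (Z \<union> taken st))"
      using out(3) sets(2) by (intro big) fast
    have wL: "0 < (1 - \<delta>) ^ L * W" using False delta by simp
    have HL: "(1 - \<delta>) * k \<le> real (l * m - L * l)"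
    proof -
      have "0 \<le> (1 - \<delta>) * k" using delta by simp
      then have "real (L * l) \<le> real (l * m)" using m(2) by linarith
      then have "L * l \<le> l * m" by (simp only: of_nat_le_iff)
      then show ?thesis using m(2) by (simp add: of_nat_diff)
    qed
    have "\<beta> / l * (f (Z \<union> taken st) - f (kept st)) + surplus st \<le> f (kept st)"
      if st: "st \<in> set_pmf ?D" for st
    proof -
      have "k * ((1 - \<delta>) ^ L * W) = (k * (1 - \<delta>) ^ L) * W" by simp
      also have "\<dots> \<le> \<delta> * W" using L(2) False by (intro mult_right_mono) auto
      also have "\<dots> \<le> \<delta> * credit st" using out(2)[OF st] delta by (intro mult_left_mono) auto
      finally have "(1 - \<delta>)\<^sup>2 * (f (Z \<union> taken st) - f (taken st)) \<le> credit st"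
        using stage_end_gain[OF out(1)[OF st] wL Z HL] by simp
      moreover have "(1 - \<delta>)\<^sup>2 * (f (Z \<union> taken st) - f (kept st)) \<le> (1 - \<delta>)\<^sup>2 * (f (Z \<union> taken st) - f (taken st))"
        using sets(3)[OF st] by (intro mult_left_mono) auto
      ultimately have "(1 - \<delta>)\<^sup>2 * (f (Z \<union> taken st) - f (kept st)) \<le> credit st" by (rule order_trans[rotated])
      then have "yield_rate * ((1 - \<delta>)\<^sup>2 * (f (Z \<union> taken st) - f (kept st))) \<le> yield_rate * credit st"
        using delta by (intro mult_left_mono) (auto simp: yield_rate_def)
      moreover have "yield_rate * (1 - \<delta>)\<^sup>2 = \<beta> / l"
        by (simp add: yield_rate_def \<beta>_def power2_eq_square power3_eq_cube mult.commute)
      ultimately show ?thesis by (simp add: surplus_def mult.assoc[symmetric])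
    qed
    then have "expect ?D (\<lambda>st. \<beta> / l * (f (Z \<union> taken st) - f (kept st)) + surplus st) \<le> expect ?D (\<lambda>st. f (kept st))"
      by (rule expect_mono[OF fin])
    then have main: "\<beta> / l * (expect ?D (\<lambda>st. f (Z \<union> taken st)) - expect ?D (\<lambda>st. f (kept st))) + expect ?D surplus \<le> expect ?D (\<lambda>st. f (kept st))"
      using fin by (simp add: expect_affine)
    have "\<beta> / l * ((1 - 1 / l) * f (Z \<union> G)) \<le> \<beta> / l * expect ?D (\<lambda>st. f (Z \<union> taken st))"
      using taken_big beta by (intro mult_left_mono) auto
    then have "f G + \<beta> / l * ((1 - 1 / l) * f (Z \<union> G) - expect ?D (\<lambda>st. f (kept st))) \<le> expect ?D (\<lambda>st. f (kept st))"
      using main sup by (simp add: right_diff_distrib)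
    moreover have "0 \<le> expect ?D (\<lambda>st. f (kept st))"
      using sets by (intro integral_nonneg_AE) (auto simp: AE_measure_pmf_iff intro!: nonneg)
    ultimately have "(1 - 1 / l) * f G + \<beta> / l * (1 - 1 / l)\<^sup>2 * f (Z \<union> G) \<le> expect ?D (\<lambda>st. f (kept st))"
      using beta l_pos by (intro stage_recurrence) auto
    moreover have "kept st \<subseteq> U" if "st \<in> set_pmf ?D" for st using sets(1,2)[OF that] by simp
    ultimately show ?thesis using fin kept_big sets(4) unfolding D by simp
  qed
  then show "finite (set_pmf D)" "\<And>G'. G' \<in> set_pmf D \<Longrightarrow> G' \<subseteq> U \<and> card G' \<le> card G + m"
    "(1 - 1 / l) * f (Z \<union> G) \<le> expect D (\<lambda>G'. f (Z \<union> G'))"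
    "(1 - 1 / l) * f G + \<beta> / l * (1 - 1 / l)\<^sup>2 * f (Z \<union> G) \<le> expect D f" by auto
qed

end

section \<open>Oracle complexity of a stage\<close>

definition enum_list :: "'a set \<Rightarrow> 'a list" where
  "enum_list A = (SOME xs. set xs = A \<and> distinct xs)"

lemma enum_list: "finite A \<Longrightarrow> set (enum_list A) = A" "finite A \<Longrightarrow> length (enum_list A) = card A"
proof -
  assume "finite A"
  then have "set (enum_list A) = A \<and> distinct (enum_list A)"
    unfolding enum_list_def by (rule someI_ex[OF finite_distinct_list])
  then show "set (enum_list A) = A" "length (enum_list A) = card A"
    using distinct_card[of "enum_list A"] by simp_all
qed

definition neighbours :: "'a list \<Rightarrow> 'a set \<Rightarrow> 'a set list" where
  "neighbours vs X = X # map (\<lambda>v. insert v X) vs"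

text \<open>The batch must serve every place where the walk might stop. Between checkpoints the
  prefixes themselves suffice, since the gain of a picked element is a difference of consecutive
  prefixes.\<close>

fun walk_queries :: "real \<Rightarrow> 'a list \<Rightarrow> nat \<Rightarrow> 'a set \<Rightarrow> ('a set \<times> 'a option) list \<Rightarrow> 'a set list" where
  "walk_queries \<delta> vs i X [] = neighbours vs X"
| "walk_queries \<delta> vs i X ((B, x) # bs) =
     neighbours (if 0 < i \<and> grid \<delta> i then vs else []) X @ walk_queries \<delta> vs (Suc i) (X \<union> set_option x) bs"

lemma hd_walk_queries: "X \<in> set (walk_queries \<delta> vs i X bs)"
  by (cases bs) (auto simp: neighbours_def)

lemma alive_cong:
  assumes "\<And>S. S \<in> set (neighbours vs (taken st)) \<Longrightarrow> g S = f S" "cand st \<subseteq> set vs"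
  shows "alive g w st = alive f w st"
proof -
  have "gain g (taken st) v = gain f (taken st) v" if "v \<in> cand st" for v
    using assms that by (auto simp: gain_def neighbours_def)
  then show ?thesis by (auto simp: alive_def)
qed

lemma walk_cong:
  assumes "\<And>S. S \<in> set (walk_queries \<delta> vs i (taken st) bs) \<Longrightarrow> g S = f S" "cand st \<subseteq> set vs"
  shows "walk g w \<delta> N i st bs = walk f w \<delta> N i st bs"
  using assms
proof (induction bs arbitrary: i st)
  case Nil
  then show ?case using alive_cong[of vs st g f w] by simp
next
  case (Cons b bs)
  obtain B x where b: "b = (B, x)" by (cases b)
  have "g (taken st) = f (taken st)" using Cons.prems(1) b by (auto simp: neighbours_def)
  moreover have "g (taken st \<union> set_option x) = f (taken st \<union> set_option x)"
    using Cons.prems(1)[of "taken st \<union> set_option x"] hd_walk_queries[of "taken st \<union> set_option x"] b by auto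
  ultimately have "{a \<in> set_option x. 0 \<le> gain g (taken st) a} = {a \<in> set_option x. 0 \<le> gain f (taken st) a}"
    by (cases x) (auto simp: gain_def)
  then have ab: "absorb g w B x st = absorb f w B x st" by (simp add: absorb_def)
  have next_eq: "walk g w \<delta> N (Suc i) (absorb f w B x st) bs = walk f w \<delta> N (Suc i) (absorb f w B x st) bs"
    using Cons.prems b by (intro Cons.IH) auto
  show ?case
  proof (cases "0 < i \<and> grid \<delta> i")
    case True
    then have "alive g w st = alive f w st" using Cons.prems b by (intro alive_cong[of vs]) auto
    then show ?thesis using ab next_eq b by (simp add: plenty_def)
  next
    case False
    then show ?thesis using ab next_eq b by auto
  qed
qed

lemma length_walk_queries:
  "length (walk_queries \<delta> vs i X bs) =
    length bs + 1 + length vs * (1 + card {j \<in> {i..<i + length bs}. 0 < j \<and> grid \<delta> j})"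
proof (induction bs arbitrary: i X)
  case Nil
  then show ?case by (simp add: neighbours_def)
next
  case (Cons b bs)
  obtain B x where b: "b = (B, x)" by (cases b)
  have "{j \<in> {i..<i + length (b # bs)}. 0 < j \<and> grid \<delta> j} =
      (if 0 < i \<and> grid \<delta> i then {i} else {}) \<union> {j \<in> {Suc i..<Suc i + length bs}. 0 < j \<and> grid \<delta> j}"
    by (auto simp: le_eq_less_or_eq)
  then have "card {j \<in> {i..<i + length (b # bs)}. 0 < j \<and> grid \<delta> j} =
      (if 0 < i \<and> grid \<delta> i then 1 else 0) + card {j \<in> {Suc i..<Suc i + length bs}. 0 < j \<and> grid \<delta> j}"
    by simp
  then show ?case using Cons[of "Suc i" "X \<union> set_option x"] b by (simp add: neighbours_def)
qed

lemma length_valid_draws: "0 < l \<Longrightarrow> finite V \<Longrightarrow> valid_draws l n V bs \<Longrightarrow> length bs \<le> card V"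
proof (induction bs arbitrary: n V)
  case (Cons b bs)
  obtain B x where b: "b = (B, x)" by (cases b)
  have B: "B \<subseteq> V" "card B = min l (card V)" "V \<noteq> {}" using Cons.prems b by auto
  have "length bs \<le> card (V - B)" using Cons.prems b by (intro Cons.IH[of _ "n - 1"]) auto
  also have "\<dots> = card V - card B" using B Cons.prems(2) finite_subset by (intro card_Diff_subset) auto
  moreover have "0 < card V" using Cons.prems(2) B(3) by (simp add: card_gt_0_iff)
  ultimately show ?case using B(2) Cons.prems(1) by simp
qed simp

lemma walk_queries_subset:
  assumes "valid_draws l n V bs" "V \<subseteq> U" "set vs \<subseteq> U" "X \<subseteq> U" "S \<in> set (walk_queries \<delta> vs i X bs)"
  shows "S \<subseteq> U"
  using assms
proof (induction bs arbitrary: n V X i)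
  case Nil
  then show ?case by (auto simp: neighbours_def)
next
  case (Cons b bs)
  obtain B x where b: "b = (B, x)" by (cases b)
  show ?case
  proof (cases "S \<in> set (walk_queries \<delta> vs (Suc i) (X \<union> set_option x) bs)")
    case True
    show ?thesis by (rule Cons.IH[OF _ _ _ _ True, of "n - 1" "V - B"]) (use Cons.prems b in auto)
  next
    case False
    then show ?thesis using Cons.prems b by (auto simp: neighbours_def split: if_splits)
  qed
qed

definition batch_alg :: "'a set \<Rightarrow> real \<Rightarrow> real \<Rightarrow> nat \<Rightarrow> 'a gstate \<Rightarrow> ('a gstate \<Rightarrow> 'a oracle_alg) \<Rightarrow> 'a oracle_alg" where
  "batch_alg U w \<delta> l st = (if cand st = {} \<or> budget st = 0 then (\<lambda>c. c st) else
     (\<lambda>c. flip (draws l (budget st) (cand st)) (\<lambda>bs.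
        ask U (walk_queries \<delta> (enum_list (cand st)) 0 (taken st) bs) (\<lambda>g. walk g w \<delta> (card (cand st)) 0 st bs) c)))"

fun batches_alg :: "'a set \<Rightarrow> real \<Rightarrow> real \<Rightarrow> nat \<Rightarrow> nat \<Rightarrow> 'a gstate \<Rightarrow> ('a gstate \<Rightarrow> 'a oracle_alg) \<Rightarrow> 'a oracle_alg" where
  "batches_alg U w \<delta> l 0 st = (\<lambda>c. c st)"
| "batches_alg U w \<delta> l (Suc T) st = (\<lambda>c. batch_alg U w \<delta> l st (\<lambda>s. batches_alg U w \<delta> l T s c))"

fun levels_alg :: "'a set \<Rightarrow> real \<Rightarrow> nat \<Rightarrow> nat \<Rightarrow> nat \<Rightarrow> real \<Rightarrow> 'a gstate \<Rightarrow> ('a gstate \<Rightarrow> 'a oracle_alg) \<Rightarrow> 'a oracle_alg" where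
  "levels_alg U \<delta> l T 0 w st = (\<lambda>c. c st)"
| "levels_alg U \<delta> l T (Suc L) w st = (\<lambda>c. ask U (neighbours (enum_list U) (taken st)) (\<lambda>g. refill U g w st)
     (\<lambda>s. batches_alg U w \<delta> l T s (\<lambda>s'. levels_alg U \<delta> l T L ((1 - \<delta>) * w) s' c)))"

definition stage_alg :: "'a set \<Rightarrow> real \<Rightarrow> nat \<Rightarrow> nat \<Rightarrow> nat \<Rightarrow> nat \<Rightarrow> 'a set \<Rightarrow> ('a set \<Rightarrow> 'a oracle_alg) \<Rightarrow> 'a oracle_alg" where
  "stage_alg U \<delta> l T L m G = (\<lambda>c. ask U (neighbours (enum_list U) G) (\<lambda>g. top_gain U g G)
     (\<lambda>W. (if W \<le> 0 then (\<lambda>c. c G) else (\<lambda>c. levels_alg U \<delta> l T L W (init_state m G) (\<lambda>st. c (kept st)))) c))"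

lemma safe_batches: "safe U (batches_alg U w \<delta> l T st)"
proof (induction T arbitrary: st)
  case (Suc T)
  have batch: "safe U (batch_alg U w \<delta> l st)"
  proof (cases "cand st = {} \<or> budget st = 0")
    case True
    show ?thesis unfolding batch_alg_def if_P[OF True] by (rule safe_return)
  next
    case False
    show ?thesis unfolding batch_alg_def if_not_P[OF False] by (rule safe_bind[OF safe_flip safe_ask])
  qed
  show ?case unfolding batches_alg.simps by (rule safe_bind[OF batch Suc])
qed (simp add: safe_return)

lemma safe_levels: "safe U (levels_alg U \<delta> l T L w st)"
proof (induction L arbitrary: w st)
  case (Suc L)
  show ?case unfolding levels_alg.simps by (rule safe_bind[OF safe_ask safe_bind[OF safe_batches Suc]])
qed (simp add: safe_return)

lemma safe_stage: "safe U (stage_alg U \<delta> l T L m G)"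
proof -
  have "safe U (if W \<le> 0 then (\<lambda>c. c G) else (\<lambda>c. levels_alg U \<delta> l T L W (init_state m G) (\<lambda>st. c (kept st))))" for W
  proof (cases "W \<le> 0")
    case True
    show ?thesis unfolding if_P[OF True] by (rule safe_return)
  next
    case False
    show ?thesis unfolding if_not_P[OF False]
      by (rule safe_bind[OF safe_levels, where P' = "\<lambda>st c. c (kept st)"]) (rule safe_return)
  qed
  then show ?thesis unfolding stage_alg_def by (rule safe_bind[OF safe_ask])
qed

section \<open>Rounds and queries of batches, levels and stages\<close>

lemma realizes_map:
  assumes "realizes f P D R Q"
  shows "realizes f (\<lambda>c. P (\<lambda>b. c (h b))) (map_pmf h D) R Q"
proof -
  have "realizes f (\<lambda>c. P (\<lambda>b. c (h b))) (bind_pmf D (\<lambda>b. return_pmf (h b))) (R + 0) (Q + 0)"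
    by (rule realizes_bind[OF assms, where P' = "\<lambda>b c. c (h b)"]) (rule realizes_return)
  then show ?thesis by (simp add: map_pmf_def)
qed

lemma realizes_bind_return:
  assumes "realizes f P (return_pmf b) R Q" "realizes f (P' b) D R' Q'"
  shows "realizes f (\<lambda>c. P (\<lambda>b. P' b c)) D (R + R') (Q + Q')"
proof -
  have "realizes f (\<lambda>c. P (\<lambda>b. P' b c)) (bind_pmf (return_pmf b) (\<lambda>_. D)) (R + R') (Q + Q')"
    by (rule realizes_bind[OF assms(1)]) (simp add: assms(2))
  then show ?thesis by (simp add: bind_return_pmf)
qed

context submodular_fun
begin

lemma realizes_ask_neighbours:
  assumes "X \<subseteq> U" "\<And>g. (\<And>v. v \<in> U \<Longrightarrow> gain g X v = gain f X v) \<Longrightarrow> h g = h f"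
  shows "realizes f (ask U (neighbours (enum_list U) X) h) (return_pmf (h f)) 1 (card U + 1)"
proof -
  note e = enum_list[OF finite_ground]
  have "realizes f (ask U (neighbours (enum_list U) X) h) (return_pmf (h f)) 1 (length (neighbours (enum_list U) X))"
  proof (rule realizes_ask)
    show "S \<subseteq> U" if "S \<in> set (neighbours (enum_list U) X)" for S
      using that assms(1) e by (auto simp: neighbours_def)
    show "h g = h f" if "\<And>S. S \<in> set (neighbours (enum_list U) X) \<Longrightarrow> g S = f S" for g
      using that e by (intro assms(2)) (auto simp: neighbours_def gain_def)
  qed
  then show ?thesis using e by (simp add: neighbours_def add.commute)
qed

end

context threshold_sampling
begin

text \<open>Queries per candidate: 2 for the prefixes, the rest for the full probes at the
  checkpoints and at the end.\<close>

definition query_rate :: real where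
  "query_rate = 4 + 2 * ln (real (card U) + 1) / \<delta>"

lemma query_rate_nonneg: "0 \<le> query_rate"
  using delta by (simp add: query_rate_def)

lemma realizes_batch:
  assumes wf: "wf st"
  shows "realizes f (batch_alg U w \<delta> l st) (batch_pmf f w \<delta> l st) 1 (query_rate * card (cand st))"
proof (cases "cand st = {} \<or> budget st = 0")
  case True
  then have "realizes f (batch_alg U w \<delta> l st) (batch_pmf f w \<delta> l st) 0 0"
    using realizes_return[of f st] by (simp add: batch_alg_def batch_pmf_def)
  then show ?thesis by (rule realizes_mono) (use query_rate_nonneg in auto)
next
  case False
  have sub: "cand st \<subseteq> U" "taken st \<subseteq> U" using wf by (auto simp: wf_def)
  have V: "finite (cand st)" using sub by (intro finite_sub)
  note e = enum_list[OF V]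
  have c: "1 \<le> card (cand st)" "card (cand st) \<le> card U"
    using False V sub finite_ground by (auto simp: Suc_le_eq card_gt_0_iff intro: card_mono)
  let ?Q = "\<lambda>bs. walk_queries \<delta> (enum_list (cand st)) 0 (taken st) bs"
  let ?h = "\<lambda>bs g. walk g w \<delta> (card (cand st)) 0 st bs"
  have step: "realizes f (ask U (?Q bs) (?h bs)) (return_pmf (?h bs f)) 1 (query_rate * card (cand st))"
    if bs: "bs \<in> set_pmf (draws l (budget st) (cand st))" for bs
  proof -
    have val: "valid_draws l (budget st) (cand st) bs" using set_draws[OF l_pos V] bs by blast
    have A: "realizes f (ask U (?Q bs) (?h bs)) (return_pmf (?h bs f)) 1 (real (length (?Q bs)))"
    proof (rule realizes_ask)
      show "S \<subseteq> U" if "S \<in> set (?Q bs)" for S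
        using walk_queries_subset[OF val sub(1) _ sub(2) that] e sub by simp
      show "?h bs g = ?h bs f" if "\<And>S. S \<in> set (?Q bs) \<Longrightarrow> g S = f S" for g
        using walk_cong[of \<delta> "enum_list (cand st)" 0 st bs g f] that e by simp
    qed
    have B: "real (length (?Q bs)) \<le> query_rate * card (cand st)"
    proof -
      have len: "length bs \<le> card (cand st)" using length_valid_draws[OF l_pos V val] .
      have "card {j \<in> {0..<0 + length bs}. 0 < j \<and> grid \<delta> j} \<le> card {j. j \<le> card U \<and> 0 < j \<and> grid \<delta> j}"
        by (rule card_mono) (use len c in auto)
      then have "real (card {j \<in> {0..<0 + length bs}. 0 < j \<and> grid \<delta> j}) \<le> 2 * ln (real (card U) + 1) / \<delta> + 1"
        using card_grid_le[of \<delta> "card U"] delta c by linarith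
      then have "real (card (cand st)) * (1 + card {j \<in> {0..<0 + length bs}. 0 < j \<and> grid \<delta> j})
          \<le> card (cand st) * (2 + 2 * ln (real (card U) + 1) / \<delta>)"
        by (intro mult_left_mono) auto
      moreover have "real (length bs + 1) \<le> card (cand st) * 2" using len c by linarith
      moreover have "real (length (?Q bs)) = real (length bs + 1) +
          real (card (cand st)) * (1 + card {j \<in> {0..<0 + length bs}. 0 < j \<and> grid \<delta> j})"
        unfolding length_walk_queries e(2) by (simp add: distrib_left)
      moreover have "query_rate * card (cand st) = card (cand st) * 2 + card (cand st) * (2 + 2 * ln (real (card U) + 1) / \<delta>)"
        by (simp add: query_rate_def algebra_simps)
      ultimately show ?thesis by linarith
    qed
    show ?thesis by (rule realizes_mono[OF A order_refl B])
  qed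
  have "realizes f (\<lambda>c. flip (draws l (budget st) (cand st)) (\<lambda>bs. ask U (?Q bs) (?h bs) c))
     (bind_pmf (draws l (budget st) (cand st)) (\<lambda>bs. return_pmf (?h bs f))) (0 + 1) (0 + query_rate * card (cand st))"
    by (rule realizes_bind[OF realizes_flip step])
  then show ?thesis using False by (simp add: batch_alg_def batch_pmf_def map_pmf_def)
qed

lemma batches_alg_no_budget: "budget st = 0 \<Longrightarrow> batches_alg U w \<delta> l T st = (\<lambda>c. c st)"
  by (induction T) (auto simp: batch_alg_def)

text \<open>Candidates shrink by the factor 1 - \<delta> per batch, so a geometric series bounds the
  queries independently of \<open>T\<close>.\<close>

lemma realizes_batches:
  assumes "run_inv w M H st" "alive f w st = cand st" "0 < w"
  shows "realizes f (batches_alg U w \<delta> l T st) (batches_pmf f w \<delta> l T st) (real T) (query_rate / \<delta> * card (cand st))"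
  using assms
proof (induction T arbitrary: st)
  case 0
  have "realizes f (\<lambda>c. c st) (return_pmf st) 0 (query_rate / \<delta> * card (cand st))"
    using query_rate_nonneg delta by (intro realizes_mono[OF realizes_return]) auto
  then show ?case by simp
next
  case (Suc T)
  let ?V = "real (card (cand st))"
  have "realizes f (batches_alg U w \<delta> l T s) (batches_pmf f w \<delta> l T s) T (query_rate / \<delta> * ((1 - \<delta>) * ?V))"
    if s: "s \<in> set_pmf (batch_pmf f w \<delta> l st)" for s
  proof (cases "budget s = 0")
    case True
    then show ?thesis unfolding batches_alg_no_budget[OF True] batches_no_budget[OF True]
      using query_rate_nonneg delta by (intro realizes_mono[OF realizes_return]) auto
  next
    case False
    note bp = batch_props[OF Suc.prems s]
    have "query_rate / \<delta> * card (cand s) \<le> query_rate / \<delta> * ((1 - \<delta>) * ?V)"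
      using bp(5) False query_rate_nonneg delta by (intro mult_left_mono) auto
    then show ?thesis by (intro realizes_mono[OF Suc.IH[OF bp(1,2) Suc.prems(3)]]) auto
  qed
  then have "realizes f (\<lambda>c. batch_alg U w \<delta> l st (\<lambda>s. batches_alg U w \<delta> l T s c))
    (bind_pmf (batch_pmf f w \<delta> l st) (batches_pmf f w \<delta> l T)) (1 + real T) (query_rate * ?V + query_rate / \<delta> * ((1 - \<delta>) * ?V))"
    using Suc.prems by (intro realizes_bind[OF realizes_batch]) (auto simp: run_inv_def)
  moreover have "query_rate * ?V + query_rate / \<delta> * ((1 - \<delta>) * ?V) = query_rate / \<delta> * ?V"
    using delta by (simp add: field_simps)
  ultimately show ?case by simp
qed

definition level_queries :: real where
  "level_queries = card U + 1 + query_rate / \<delta> * card U"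

lemma realizes_levels:
  assumes "level_inv w M H st" "0 < w" "(1 - \<delta>) ^ T * card U < 1"
  shows "realizes f (levels_alg U \<delta> l T L w st) (levels_pmf U f \<delta> l T L w st) (real L * (1 + real T)) (real L * level_queries)"
  using assms(1,2)
proof (induction L arbitrary: w st H)
  case 0
  then show ?case using realizes_return[of f st] by simp
next
  case (Suc L)
  let ?st = "refill U f w st"
  have inv: "taken st \<subseteq> U" using Suc.prems by (simp add: level_inv_def)
  have first: "realizes f (ask U (neighbours (enum_list U) (taken st)) (\<lambda>g. refill U g w st)) (return_pmf ?st) 1 (card U + 1)"
    using inv by (intro realizes_ask_neighbours) (auto simp: refill_def intro!: arg_cong[of _ _ "\<lambda>V. st\<lparr>cand := V\<rparr>"])
  have second: "realizes f (batches_alg U w \<delta> l T ?st) (batches_pmf f w \<delta> l T ?st) T (query_rate / \<delta> * card U)"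
  proof (cases "budget st = 0")
    case True
    then have b: "budget ?st = 0" by simp
    show ?thesis unfolding batches_alg_no_budget[OF b] batches_no_budget[OF b]
      using query_rate_nonneg delta by (intro realizes_mono[OF realizes_return]) auto
  next
    case False
    note run = run_inv_refill[OF Suc.prems False]
    have "card (cand ?st) \<le> card U" using finite_ground by (intro card_mono) (auto simp: refill_def)
    then have "query_rate / \<delta> * card (cand ?st) \<le> query_rate / \<delta> * card U"
      using query_rate_nonneg delta by (intro mult_left_mono) auto
    then show ?thesis by (intro realizes_mono[OF realizes_batches[OF run Suc.prems(2)]]) auto
  qed
  have third: "realizes f (levels_alg U \<delta> l T L ((1 - \<delta>) * w) s) (levels_pmf U f \<delta> l T L ((1 - \<delta>) * w) s) (real L * (1 + real T)) (real L * level_queries)"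
    if "s \<in> set_pmf (batches_pmf f w \<delta> l T ?st)" for s
    using level_props[OF Suc.prems assms(3)] that Suc.prems(2) delta by (intro Suc.IH) auto
  have "realizes f (\<lambda>c. batches_alg U w \<delta> l T ?st (\<lambda>s'. levels_alg U \<delta> l T L ((1 - \<delta>) * w) s' c))
    (levels_pmf U f \<delta> l T (Suc L) w st) (real T + real L * (1 + real T)) (query_rate / \<delta> * card U + L * level_queries)"
    unfolding levels_pmf.simps by (rule realizes_bind[OF second third])
  from realizes_bind_return[OF first, of "\<lambda>s c. batches_alg U w \<delta> l T s (\<lambda>s'. levels_alg U \<delta> l T L ((1 - \<delta>) * w) s' c)", OF this]
  have "realizes f (levels_alg U \<delta> l T (Suc L) w st) (levels_pmf U f \<delta> l T (Suc L) w st)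
     (1 + (real T + real L * (1 + real T))) (real (card U + 1) + (query_rate / \<delta> * card U + L * level_queries))"
    by simp
  then show ?case by (rule realizes_mono) (auto simp: level_queries_def distrib_right)
qed

lemma realizes_stage:
  assumes G: "G \<subseteq> U" and T: "(1 - \<delta>) ^ T * card U < 1"
  shows "realizes f (stage_alg U \<delta> l T L m G) (stage_pmf U f \<delta> l T L m G)
    (1 + real L * (1 + real T)) (real (card U) + 1 + real L * level_queries)"
proof -
  define W where "W = top_gain U f G"
  have W: "gain f G v \<le> W" if "v \<in> U" for v
    unfolding W_def top_gain_def using finite_ground that by (intro Max_ge) auto
  have first: "realizes f (ask U (neighbours (enum_list U) G) (\<lambda>g. top_gain U g G)) (return_pmf W) 1 (card U + 1)"
    unfolding W_def using G by (intro realizes_ask_neighbours) (auto simp: top_gain_def intro!: arg_cong[of _ _ Max])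
  let ?P = "\<lambda>W. if W \<le> 0 then (\<lambda>c. c G) else (\<lambda>c. levels_alg U \<delta> l T L W (init_state m G) (\<lambda>st. c (kept st)))"
  have lq: "0 \<le> level_queries" using query_rate_nonneg delta by (simp add: level_queries_def)
  have "realizes f (?P W) (stage_pmf U f \<delta> l T L m G) (real L * (1 + real T)) (real L * level_queries)"
  proof (cases "W \<le> 0")
    case True
    have "realizes f (\<lambda>c. c G) (return_pmf G) (real L * (1 + real T)) (real L * level_queries)"
      using lq by (intro realizes_mono[OF realizes_return]) auto
    then show ?thesis using True by (simp add: stage_pmf_def W_def)
  next
    case False
    have inv: "level_inv W (card G + m) (l * m) (init_state m G)"
      using G False W by (intro level_inv_init) auto
    have "realizes f (\<lambda>c. levels_alg U \<delta> l T L W (init_state m G) (\<lambda>st. c (kept st)))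
       (map_pmf kept (levels_pmf U f \<delta> l T L W (init_state m G))) (real L * (1 + real T)) (real L * level_queries)"
      using False by (intro realizes_map realizes_levels[OF inv _ T]) auto
    then show ?thesis using False by (simp add: stage_pmf_def W_def)
  qed
  from realizes_bind_return[OF first, of ?P, OF this] show ?thesis
    unfolding stage_alg_def by (simp add: add_ac)
qed

end

section \<open>Random greedy and iteration\<close>

text \<open>Allowing fewer than \<open>k\<close> members takes the place of the dummy elements usual
  in random greedy.\<close>

definition top_set :: "'a set \<Rightarrow> nat \<Rightarrow> ('a \<Rightarrow> real) \<Rightarrow> 'a set" where
  "top_set U k h = arg_min_on (\<lambda>M. - (\<Sum>v\<in>M. h v)) {M. M \<subseteq> U \<and> card M \<le> k}"

lemma top_set:
  assumes "finite U"
  shows "top_set U k h \<subseteq> U" "card (top_set U k h) \<le> k"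
    and "\<And>M. M \<subseteq> U \<Longrightarrow> card M \<le> k \<Longrightarrow> (\<Sum>v\<in>M. h v) \<le> (\<Sum>v\<in>top_set U k h. h v)"
proof -
  let ?F = "{M. M \<subseteq> U \<and> card M \<le> k}"
  have fin: "finite ?F" using assms by (intro finite_subset[of ?F "Pow U"]) auto
  moreover have "{} \<in> ?F" by simp
  ultimately have ne: "?F \<noteq> {}" by blast
  show "top_set U k h \<subseteq> U" "card (top_set U k h) \<le> k"
    using arg_min_if_finite(1)[OF fin ne] by (auto simp: top_set_def)
  show "(\<Sum>v\<in>M. h v) \<le> (\<Sum>v\<in>top_set U k h. h v)" if "M \<subseteq> U" "card M \<le> k" for M
    using arg_min_least[OF fin ne, of M "\<lambda>M. - (\<Sum>v\<in>M. h v)"] that by (simp add: top_set_def)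
qed

text \<open>The value 0 off \<open>U\<close> makes the whole function determined by the queried
  values, so that it can be handed to the continuation.\<close>

definition ground_gain :: "'a set \<Rightarrow> ('a set \<Rightarrow> real) \<Rightarrow> 'a set \<Rightarrow> 'a \<Rightarrow> real" where
  "ground_gain U f G v = (if v \<in> U then gain f G v else 0)"

definition greedy_pmf :: "'a set \<Rightarrow> ('a set \<Rightarrow> real) \<Rightarrow> nat \<Rightarrow> 'a set \<Rightarrow> 'a set pmf" where
  "greedy_pmf U f k G = map_pmf (\<lambda>x. G \<union> set_option x) (pick k (top_set U k (ground_gain U f G)))"

definition greedy_alg :: "'a set \<Rightarrow> nat \<Rightarrow> 'a set \<Rightarrow> ('a set \<Rightarrow> 'a oracle_alg) \<Rightarrow> 'a oracle_alg" where
  "greedy_alg U k G = (\<lambda>c. ask U (neighbours (enum_list U) G) (\<lambda>g. ground_gain U g G)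
     (\<lambda>h. flip (map_pmf (\<lambda>x. G \<union> set_option x) (pick k (top_set U k h))) c))"

lemma safe_greedy: "safe U (greedy_alg U k G)"
  unfolding greedy_alg_def by (rule safe_bind[OF safe_ask safe_flip])

fun iter_pmf :: "('b \<Rightarrow> 'b pmf) \<Rightarrow> nat \<Rightarrow> 'b \<Rightarrow> 'b pmf" where
  "iter_pmf K 0 G = return_pmf G"
| "iter_pmf K (Suc n) G = bind_pmf (K G) (iter_pmf K n)"

fun iter_alg :: "('b \<Rightarrow> ('b \<Rightarrow> 'a oracle_alg) \<Rightarrow> 'a oracle_alg) \<Rightarrow> nat \<Rightarrow> 'b \<Rightarrow> ('b \<Rightarrow> 'a oracle_alg) \<Rightarrow> 'a oracle_alg" where
  "iter_alg P 0 G = (\<lambda>c. c G)"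
| "iter_alg P (Suc n) G = (\<lambda>c. P G (\<lambda>G'. iter_alg P n G' c))"

lemma safe_iter: "(\<And>G. safe U (P G)) \<Longrightarrow> safe U (iter_alg P n G)"
proof (induction n arbitrary: G)
  case 0
  show ?case unfolding iter_alg.simps by (rule safe_return)
next
  case (Suc n)
  show ?case unfolding iter_alg.simps by (rule safe_bind[OF Suc.prems Suc.IH[OF Suc.prems]])
qed

lemma realizes_iter:
  assumes "\<And>G. I G \<Longrightarrow> realizes f (P G) (K G) R Q" "\<And>G G'. I G \<Longrightarrow> G' \<in> set_pmf (K G) \<Longrightarrow> I G'" "I G"
  shows "realizes f (iter_alg P n G) (iter_pmf K n G) (n * R) (n * Q)"
  using assms(3)
proof (induction n arbitrary: G)
  case 0
  then show ?case using realizes_return[of f G] by simp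
next
  case (Suc n)
  have "realizes f (\<lambda>c. P G (\<lambda>G'. iter_alg P n G' c)) (bind_pmf (K G) (iter_pmf K n)) (R + n * R) (Q + n * Q)"
    by (rule realizes_bind[OF assms(1)[OF Suc.prems]]) (rule Suc.IH, rule assms(2)[OF Suc.prems])
  then show ?case by (simp add: distrib_right)
qed

section \<open>Guarantees for random greedy and for repeated stages\<close>

context submodular_fun
begin

lemma realizes_greedy:
  assumes "G \<subseteq> U"
  shows "realizes f (greedy_alg U k G) (greedy_pmf U f k G) 1 (card U + 1)"
proof -
  have first: "realizes f (ask U (neighbours (enum_list U) G) (\<lambda>g. ground_gain U g G)) (return_pmf (ground_gain U f G)) 1 (card U + 1)"
    using assms by (intro realizes_ask_neighbours) (auto simp: ground_gain_def)
  show ?thesis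
    using realizes_bind_return[OF first, of "\<lambda>h. flip (map_pmf (\<lambda>x. G \<union> set_option x) (pick k (top_set U k h)))", OF realizes_flip]
    unfolding greedy_alg_def greedy_pmf_def by simp
qed

text \<open>The gain of \<open>Z\<close> is measured at the new set \<open>G'\<close> and only then
  bounded by gains at \<open>G\<close>; this brings random greedy into the form of
  \<open>stage_recurrence\<close> with \<beta> = 1.\<close>

lemma greedy_props:
  assumes G: "G \<subseteq> U" and Z: "Z \<subseteq> U" "card Z \<le> k" and k: "0 < k"
  defines "D \<equiv> greedy_pmf U f k G"
  shows "finite (set_pmf D)" "\<And>G'. G' \<in> set_pmf D \<Longrightarrow> G' \<subseteq> U \<and> card G' \<le> card G + 1"
    "(1 - 1 / k) * f (Z \<union> G) \<le> expect D (\<lambda>G'. f (Z \<union> G'))"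
    "(1 - 1 / k) * f G + 1 / k * (1 - 1 / k)\<^sup>2 * f (Z \<union> G) \<le> expect D f"
proof -
  let ?h = "ground_gain U f G"
  define B where "B = top_set U k ?h"
  note ts = top_set[OF finite_ground, where k = k and h = ?h, folded B_def]
  have B: "finite B" using ts(1) finite_ground finite_subset by blast
  note pk = pick_props[OF B ts(2) k]
  have D: "D = map_pmf (\<lambda>x. G \<union> set_option x) (pick k B)" by (simp add: D_def greedy_pmf_def B_def)
  show fin: "finite (set_pmf D)" using pk(1) D by simp
  show out: "G' \<subseteq> U \<and> card G' \<le> card G + 1" if G': "G' \<in> set_pmf D" for G'
  proof -
    obtain x where x: "x \<in> set_pmf (pick k B)" "G' = G \<union> set_option x" using G' D by auto
    have "card (set_option x) \<le> 1" by (cases x) auto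
    then have "card G' \<le> card G + 1" using card_Un_le[of G "set_option x"] unfolding x(2) by linarith
    then show ?thesis using pk(2)[OF x(1)] ts(1) G x(2) by auto
  qed
  have prob: "expect (pick k B) (\<lambda>x. of_bool (v \<in> set_option x)) \<le> 1 / k" for v
  proof -
    have "(\<Sum>b\<in>B. of_bool (v \<in> set_option (Some b))) \<le> (1::real)"
      using B by (simp add: of_bool_def)
    then show ?thesis unfolding pk(3) using k by (simp add: divide_right_mono)
  qed
  have "(1 - 1 / k) * f (Z \<union> G) \<le> expect (pick k B) (\<lambda>x. f (Z \<union> G \<union> set_option x))"
  proof (rule random_union_ge[OF pk(1)])
    show "set_option x \<subseteq> U" if "x \<in> set_pmf (pick k B)" for x using pk(2)[OF that] ts(1) by simp
  qed (use G Z prob k in auto)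
  then show big: "(1 - 1 / k) * f (Z \<union> G) \<le> expect D (\<lambda>G'. f (Z \<union> G'))"
    unfolding D by (simp add: Un_assoc)
  have gB: "(\<Sum>b\<in>B. ?h b) = (\<Sum>b\<in>B. gain f G b)" using ts(1) by (intro sum.cong) (auto simp: ground_gain_def)
  have fB: "expect D f = f G + (\<Sum>b\<in>B. gain f G b) / k"
    unfolding D using k B by (simp add: pk(3) gain_def sum_subtractf field_simps)
  have ZB: "f (Z \<union> G') - f G' \<le> (\<Sum>b\<in>B. gain f G b)" if G': "G' \<in> set_pmf D" for G'
  proof -
    have fz: "finite Z" using Z(1) finite_ground finite_subset by blast
    have "f (Z \<union> G') - f G' \<le> (\<Sum>z\<in>Z. gain_pos f G' z)" using out[OF G'] Z by (intro union_le_sum_gain_pos) auto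
    also have "\<dots> \<le> (\<Sum>z\<in>Z. gain_pos f G z)"
      using out[OF G'] Z G' D by (intro sum_mono gain_pos_antimono) auto
    also have "\<dots> = (\<Sum>z\<in>{z \<in> Z. 0 < gain f G z}. ?h z)"
      using Z fz by (intro sum.mono_neutral_cong_right) (auto simp: ground_gain_def)
    also have "\<dots> \<le> (\<Sum>b\<in>B. ?h b)"
      using Z fz card_mono[of Z "{z \<in> Z. 0 < gain f G z}"] by (intro ts(3)) auto
    finally show ?thesis by (simp add: gB)
  qed
  have "expect D (\<lambda>G'. f (Z \<union> G') - f G') \<le> expect D (\<lambda>_. \<Sum>b\<in>B. gain f G b)"
    using ZB by (intro expect_mono[OF fin])
  then have "expect D (\<lambda>G'. f (Z \<union> G')) - expect D f \<le> (\<Sum>b\<in>B. gain f G b)"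
    using fin by (simp add: expect_affine)
  then have "1 / k * ((1 - 1 / k) * f (Z \<union> G) - expect D f) \<le> 1 / k * (\<Sum>b\<in>B. gain f G b)"
    using big by (intro mult_left_mono) auto
  then have "f G + 1 / k * ((1 - 1 / k) * f (Z \<union> G) - expect D f) \<le> expect D f" using fB by simp
  moreover have "0 \<le> expect D f"
    using out by (intro integral_nonneg_AE) (auto simp: AE_measure_pmf_iff intro!: nonneg)
  ultimately show "(1 - 1 / k) * f G + 1 / k * (1 - 1 / k)\<^sup>2 * f (Z \<union> G) \<le> expect D f"
    using k by (intro stage_recurrence) auto
qed

text \<open>Let t = 1 - 1 / l. Stage i + 1 contributes \<beta> / l times \<open>t\<^sup>2\<close> on
  a union that has shrunk by t ^ i, and the n - 1 - i later stages discount this by t ^ (n - 1 - i).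
  The exponents add up to n + 1 for every i, hence \<open>n\<close> equal terms.\<close>

lemma iter_props:
  fixes l :: nat
  assumes l: "0 < l" and b: "0 \<le> \<beta>" and Z: "Z \<subseteq> U"
    and fin: "\<And>G. G \<subseteq> U \<Longrightarrow> finite (set_pmf (K G))"
    and out: "\<And>G G'. G \<subseteq> U \<Longrightarrow> G' \<in> set_pmf (K G) \<Longrightarrow> G' \<subseteq> U \<and> card G' \<le> card G + m"
    and big: "\<And>G. G \<subseteq> U \<Longrightarrow> (1 - 1 / l) * f (Z \<union> G) \<le> expect (K G) (\<lambda>G'. f (Z \<union> G'))"
    and rec: "\<And>G. G \<subseteq> U \<Longrightarrow> (1 - 1 / l) * f G + \<beta> / l * (1 - 1 / l)\<^sup>2 * f (Z \<union> G) \<le> expect (K G) f"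
    and G: "G \<subseteq> U"
  shows "finite (set_pmf (iter_pmf K n G)) \<and> (\<forall>G'\<in>set_pmf (iter_pmf K n G). G' \<subseteq> U \<and> card G' \<le> card G + n * m) \<and>
    (1 - 1 / l) ^ n * f G + n * (\<beta> / l) * (1 - 1 / l) ^ (n + 1) * f (Z \<union> G) \<le> expect (iter_pmf K n G) f"
  using G
proof (induction n arbitrary: G)
  case 0
  then show ?case by simp
next
  case (Suc n)
  define t where "t = 1 - 1 / real l"
  define c where "c = \<beta> / l"
  have t: "0 \<le> t" using l by (simp add: t_def)
  have c: "0 \<le> c" using b by (simp add: c_def)
  note IH = Suc.IH[folded t_def c_def]
  have fK: "finite (set_pmf (K G))" using fin Suc.prems .
  have sub: "G' \<subseteq> U" if "G' \<in> set_pmf (K G)" for G' using out[OF Suc.prems that] by simp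
  have fin': "finite (set_pmf (iter_pmf K n G'))" if "G' \<in> set_pmf (K G)" for G' using IH[OF sub[OF that]] by simp
  have "G'' \<subseteq> U \<and> card G'' \<le> card G + Suc n * m" if "G'' \<in> set_pmf (iter_pmf K (Suc n) G)" for G''
  proof -
    obtain G' where G': "G' \<in> set_pmf (K G)" "G'' \<in> set_pmf (iter_pmf K n G')" using \<open>G'' \<in> _\<close> by auto
    then have "G'' \<subseteq> U" "card G'' \<le> card G' + n * m" "card G' \<le> card G + m"
      using IH[OF sub[OF G'(1)]] out[OF Suc.prems G'(1)] by auto
    then show ?thesis by simp
  qed
  moreover have "t ^ Suc n * f G + Suc n * c * t ^ (Suc n + 1) * f (Z \<union> G) \<le> expect (iter_pmf K (Suc n) G) f"
  proof -
    have "t ^ n * (t * f G + c * t\<^sup>2 * f (Z \<union> G)) \<le> t ^ n * expect (K G) f"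
      using rec[OF Suc.prems] t unfolding t_def[symmetric] c_def[symmetric] by (intro mult_left_mono) auto
    moreover have "n * c * t ^ (n + 1) * (t * f (Z \<union> G)) \<le> n * c * t ^ (n + 1) * expect (K G) (\<lambda>G'. f (Z \<union> G'))"
      using big[OF Suc.prems] t c unfolding t_def[symmetric] by (intro mult_left_mono) auto
    moreover have "expect (K G) (\<lambda>G'. t ^ n * f G' + n * c * t ^ (n + 1) * f (Z \<union> G')) \<le> expect (K G) (\<lambda>G'. expect (iter_pmf K n G') f)"
      using IH sub by (intro expect_mono[OF fK]) blast
    moreover have "expect (K G) (\<lambda>G'. expect (iter_pmf K n G') f) = expect (iter_pmf K (Suc n) G) f"
      using fK fin' by (simp add: expect_bind)
    moreover have "expect (K G) (\<lambda>G'. t ^ n * f G' + n * c * t ^ (n + 1) * f (Z \<union> G')) =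
        t ^ n * expect (K G) f + n * c * t ^ (n + 1) * expect (K G) (\<lambda>G'. f (Z \<union> G'))"
      using fK by (simp add: expect_affine)
    moreover have "t ^ n * (t * f G + c * t\<^sup>2 * f (Z \<union> G)) + n * c * t ^ (n + 1) * (t * f (Z \<union> G)) =
        t ^ Suc n * f G + Suc n * c * t ^ (Suc n + 1) * f (Z \<union> G)"
      by (simp add: algebra_simps power2_eq_square)
    ultimately show ?thesis by linarith
  qed
  ultimately show ?case using fK fin' unfolding t_def[symmetric] c_def[symmetric] by auto
qed

end

text \<open>With t = 1 - 1 / l the power splits into t ^ (l - 1) \<ge> 1 / e, which follows from 1 /
  t = 1 + 1 / (l - 1), and \<open>t\<^sup>2 \<ge> 1 - 2 / l\<close>.\<close>

lemma one_minus_inverse_power_ge: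
  assumes "2 \<le> l"
  shows "(1 - 2 / real l) / exp 1 \<le> (1 - 1 / real l) ^ (l + 1)"
proof -
  define t where "t = 1 - 1 / real l"
  have l: "real l > 1" using assms by simp
  have t: "0 < t" using l by (simp add: t_def)
  have "(1 / t) = 1 + 1 / (real l - 1)" using l by (simp add: t_def field_simps)
  then have "1 / t \<le> exp (1 / (real l - 1))" using exp_ge_add_one_self[of "1 / (real l - 1)"] by simp
  then have "(1 / t) ^ (l - 1) \<le> exp (1 / (real l - 1)) ^ (l - 1)" using t by (intro power_mono) auto
  also have "\<dots> = exp 1" using l assms by (simp add: exp_of_nat_mult[symmetric] of_nat_diff)
  finally have "1 / exp 1 \<le> t ^ (l - 1)" using t by (simp add: power_one_over field_simps)
  moreover have "1 - 2 / real l \<le> t\<^sup>2" by (simp add: t_def power2_eq_square algebra_simps)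
  moreover have "t ^ (l + 1) = t ^ (l - 1) * t\<^sup>2" using assms by (simp flip: power_add)
  moreover have "0 \<le> 1 - 2 / real l" using assms by simp
  ultimately have "1 / exp 1 * (1 - 2 / real l) \<le> t ^ (l + 1)" using t by (simp only:) (intro mult_mono, auto)
  then show ?thesis by (simp add: t_def)
qed

text \<open>Costs are bounded on every outcome, so the probability is 1 unless the claim is empty
  because 1 \<le> \<pi>.\<close>

lemma realizes_final:
  assumes real: "realizes f P D R Q" and safe: "safe U P"
    and out: "\<And>G. G \<in> set_pmf D \<Longrightarrow> G \<subseteq> U \<and> card G \<le> k"
    and val: "v \<le> expect D f"
    and cost: "1 \<le> \<pi> \<or> R \<le> r \<and> Q \<le> q" and pi: "0 \<le> \<pi>"
  shows "queries_within U (P Return) \<and>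
    (\<forall>(G, r, q) \<in> set_pmf (run f (P Return)). G \<subseteq> U \<and> card G \<le> k) \<and>
    v \<le> measure_pmf.expectation (run f (P Return)) (\<lambda>(G, r, q). f G) \<and>
    1 - \<pi> \<le> measure_pmf.prob (run f (P Return)) {(G, r', q'). real r' \<le> r \<and> real q' \<le> q}"
proof -
  have res: "map_pmf fst (run f (P Return)) = D"
    using realizes_result[OF real, of Return] by (simp add: result_def bind_return_pmf')
  have "queries_within U (P Return)"
    using safe unfolding safe_def by (auto intro: queries_within.intros)
  moreover have "\<forall>(G, r, q) \<in> set_pmf (run f (P Return)). G \<subseteq> U \<and> card G \<le> k"
    using out res by force
  moreover have "v \<le> measure_pmf.expectation (run f (P Return)) (\<lambda>(G, r, q). f G)"
  proof -
    have "(\<lambda>(G, r, q). f G) = (\<lambda>x :: 'a set \<times> nat \<times> nat. f (fst x))" by auto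
    then show ?thesis using val integral_map_pmf[of fst "run f (P Return)" f] unfolding res by simp
  qed
  moreover have "1 - \<pi> \<le> measure_pmf.prob (run f (P Return)) {(G, r', q'). real r' \<le> r \<and> real q' \<le> q}"
  proof (cases "1 \<le> \<pi>")
    case True
    then have "1 - \<pi> \<le> 0" by simp
    then show ?thesis using measure_nonneg order_trans by blast
  next
    case False
    have "cost_le f (P Return) (R + 0) (Q + 0)"
      by (rule realizes_cost[OF real]) (simp add: cost_le_def)
    then have "set_pmf (run f (P Return)) \<subseteq> {(G, r', q'). real r' \<le> r \<and> real q' \<le> q}"
      using cost False unfolding cost_le_def by fastforce
    then have "measure_pmf.prob (run f (P Return)) {(G, r', q'). real r' \<le> r \<and> real q' \<le> q} = 1"
      by (subst measure_pmf.prob_eq_1) (auto simp: AE_measure_pmf_iff)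
    then show ?thesis using pi by simp
  qed
  ultimately show ?thesis by blast
qed

section \<open>The combined algorithm\<close>

text \<open>For \<epsilon> \<ge> 1 / e the promised factor is not positive and the empty set will
  do. The choice of \<open>l\<close> makes 2 / l \<le> \<epsilon>, and \<delta> = \<epsilon> / 4
  makes \<beta> \<ge> 1 - \<epsilon>. Above the bound with 192 the budget lost to short blocks and
  to the rounding in \<open>k div l\<close> is at most \<delta> k, see
  \<open>budget_ok\<close>.\<close>

definition max_alg :: "'a set \<Rightarrow> nat \<Rightarrow> real \<Rightarrow> ('a set \<Rightarrow> 'a oracle_alg) \<Rightarrow> 'a oracle_alg" where
  "max_alg U k \<epsilon> =
    (if U = {} \<or> 1 / exp 1 \<le> \<epsilon> then (\<lambda>c. c {})
     else if real k \<le> 192 * ln k / \<epsilon> ^ 3 then iter_alg (greedy_alg U k) k {}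
     else let l = nat \<lceil>2 / \<epsilon>\<rceil>; \<delta> = \<epsilon> / 4 in
       iter_alg (stage_alg U \<delta> l (nat \<lceil>ln (card U) / \<delta>\<rceil> + 1) (nat \<lceil>ln (k / \<delta>) / \<delta>\<rceil> + 1) (k div l)) l {})"

lemma safe_max_alg: "safe U (max_alg U k \<epsilon>)"
proof -
  have "safe U (iter_alg (greedy_alg U k) k {})" by (rule safe_iter[OF safe_greedy])
  moreover have "safe U (iter_alg (stage_alg U \<delta> l T L m) l {})" for \<delta> l T L m
    by (rule safe_iter[OF safe_stage])
  ultimately show ?thesis unfolding max_alg_def Let_def by (simp add: safe_return)
qed

section \<open>Choice of parameters and numerical estimates\<close>

lemma one_minus_power_le:
  assumes "0 \<le> \<delta>" "\<delta> \<le> 1" "a \<le> \<delta> * real T"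
  shows "(1 - \<delta>) ^ T \<le> exp (- a)"
proof -
  have "1 - \<delta> \<le> exp (- \<delta>)" using exp_ge_add_one_self[of "- \<delta>"] by simp
  then have "(1 - \<delta>) ^ T \<le> exp (- \<delta>) ^ T" using assms by (intro power_mono) auto
  also have "\<dots> = exp (- (\<delta> * T))" by (simp add: exp_of_nat_mult[symmetric] mult.commute)
  also have "\<dots> \<le> exp (- a)" using assms by simp
  finally show ?thesis .
qed

lemma one_minus_cube_ge:
  fixes \<delta> :: real
  assumes "0 \<le> \<delta>" "\<delta> \<le> 1"
  shows "1 - 4 * \<delta> \<le> (1 - \<delta>) ^ 3 / (1 + \<delta>)"
proof -
  have "(1 - \<delta>) ^ 3 - (1 - 4 * \<delta>) * (1 + \<delta>) = \<delta>\<^sup>2 * (7 - \<delta>)"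
    by (simp add: power3_eq_cube power2_eq_square algebra_simps)
  moreover have "0 \<le> \<delta>\<^sup>2 * (7 - \<delta>)" using assms by simp
  ultimately have "(1 - 4 * \<delta>) * (1 + \<delta>) \<le> (1 - \<delta>) ^ 3" by linarith
  then show ?thesis using assms by (simp add: le_divide_eq)
qed

context submodular_fun
begin

lemma greedy_guarantee:
  assumes Z: "Z \<subseteq> U" "card Z \<le> k" and k: "2 \<le> k" "2 \<le> k * (exp 1 * \<epsilon>)"
  shows "realizes f (iter_alg (greedy_alg U k) k {}) (iter_pmf (greedy_pmf U f k) k {}) k (k * (card U + 1))"
    and "\<And>G. G \<in> set_pmf (iter_pmf (greedy_pmf U f k) k {}) \<Longrightarrow> G \<subseteq> U \<and> card G \<le> k"
    and "(1 / exp 1 - \<epsilon>) * f Z \<le> expect (iter_pmf (greedy_pmf U f k) k {}) f"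
proof -
  have k0: "0 < k" using k by simp
  note gp = greedy_props[OF _ Z k0]
  have "realizes f (iter_alg (greedy_alg U k) k {}) (iter_pmf (greedy_pmf U f k) k {}) (real k * 1) (real k * real (card U + 1))"
  proof (rule realizes_iter[where I = "\<lambda>G. G \<subseteq> U"])
    show "realizes f (greedy_alg U k G) (greedy_pmf U f k G) 1 (real (card U + 1))" if "G \<subseteq> U" for G
      using that by (rule realizes_greedy)
    show "G' \<subseteq> U" if "G \<subseteq> U" "G' \<in> set_pmf (greedy_pmf U f k G)" for G G'
      using gp(2)[OF that] by simp
  qed simp
  then show "realizes f (iter_alg (greedy_alg U k) k {}) (iter_pmf (greedy_pmf U f k) k {}) k (k * (card U + 1))"
    by (simp add: distrib_left)
  have props: "finite (set_pmf (iter_pmf (greedy_pmf U f k) k {})) \<and>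
    (\<forall>G'\<in>set_pmf (iter_pmf (greedy_pmf U f k) k {}). G' \<subseteq> U \<and> card G' \<le> card ({} :: 'a set) + k * 1) \<and>
    (1 - 1 / k) ^ k * f {} + k * (1 / k) * (1 - 1 / k) ^ (k + 1) * f (Z \<union> {}) \<le> expect (iter_pmf (greedy_pmf U f k) k {}) f"
    using gp by (intro iter_props[OF k0 _ Z(1)]) auto
  then show "\<And>G. G \<in> set_pmf (iter_pmf (greedy_pmf U f k) k {}) \<Longrightarrow> G \<subseteq> U \<and> card G \<le> k" by simp
  have "1 / exp 1 - \<epsilon> \<le> (1 - 2 / k) / exp 1" using k by (simp add: field_simps)
  also have "\<dots> \<le> (1 - 1 / k) ^ (k + 1)" using k by (intro one_minus_inverse_power_ge)
  finally have "(1 / exp 1 - \<epsilon>) * f Z \<le> (1 - 1 / k) ^ (k + 1) * f Z" using nonneg[OF Z(1)] by (rule mult_right_mono)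
  moreover have "0 \<le> (1 - 1 / k) ^ k * f {}" using k nonneg[of "{}"] by simp
  ultimately show "(1 / exp 1 - \<epsilon>) * f Z \<le> expect (iter_pmf (greedy_pmf U f k) k {}) f" using props k0 by simp
qed

end

lemma nat_ceiling_bounds: "0 \<le> (x::real) \<Longrightarrow> x \<le> real (nat \<lceil>x\<rceil>)" "0 \<le> x \<Longrightarrow> real (nat \<lceil>x\<rceil>) \<le> x + 1"
  by linarith+

locale parallel_regime = submodular_fun U f for U :: "'a set" and f +
  fixes k :: nat and \<epsilon> :: real
  assumes nonempty: "U \<noteq> {}" and eps: "0 < \<epsilon>" "\<epsilon> < 1 / 2" and k3: "3 \<le> k"
    and large: "192 * ln k / \<epsilon> ^ 3 < k"
begin

definition "\<delta> = \<epsilon> / 4"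
definition "parts = nat \<lceil>2 / \<epsilon>\<rceil>"
definition "T = nat \<lceil>ln (card U) / \<delta>\<rceil> + 1"
definition "L = nat \<lceil>ln (k / \<delta>) / \<delta>\<rceil> + 1"
definition "m = k div parts"

lemma ln_k: "1 \<le> ln (real k)"
proof -
  have "exp 1 \<le> real k" using exp_le k3 by linarith
  then show ?thesis using k3 by (simp add: ln_ge_iff)
qed

lemma inv_eps: "2 < 1 / \<epsilon>"
  using eps by (simp add: field_simps)

lemma large': "192 * ln k * (1 / \<epsilon>) ^ 3 < k"
  using large by (simp add: power_one_over)

lemma l_bounds: "2 / \<epsilon> \<le> parts" "real parts \<le> 3 * (1 / \<epsilon>)" "2 \<le> parts"
proof -
  show *: "2 / \<epsilon> \<le> parts" unfolding parts_def using eps by (intro nat_ceiling_bounds) auto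
  have "real parts \<le> 2 / \<epsilon> + 1" unfolding parts_def using eps by (intro nat_ceiling_bounds) auto
  then show "real parts \<le> 3 * (1 / \<epsilon>)" using inv_eps by simp
  show "2 \<le> parts" using * inv_eps by linarith
qed

lemma card_ground: "1 \<le> card U"
  using nonempty finite_ground by (simp add: Suc_le_eq card_gt_0_iff)

text \<open>In this regime 4 / \<epsilon> \<le> k, so ln (k / \<delta>) \<le> 2 ln k and no separate
  logarithm of 1 / \<epsilon> appears.\<close>

lemma L_bound: "real L \<le> 10 * ln k * (1 / \<epsilon>)"
proof -
  have d: "0 < \<delta>" using eps by (simp add: \<delta>_def)
  have "4 / \<epsilon> \<le> real k"
  proof -
    have "(1 / \<epsilon>) ^ 1 \<le> (1 / \<epsilon>) ^ 3" using inv_eps by (intro power_increasing) auto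
    then have "4 * (1 / \<epsilon>) \<le> 192 * ln k * (1 / \<epsilon>) ^ 3" using ln_k eps by (intro mult_mono) auto
    then show ?thesis using large' by simp
  qed
  then have "ln (4 / \<epsilon>) \<le> ln k" using eps k3 by (subst ln_le_cancel_iff) auto
  moreover have "ln (k / \<delta>) = ln k + ln (4 / \<epsilon>)"
    using eps k3 ln_mult[of "real k" "4 / \<epsilon>"] by (simp add: \<delta>_def mult.commute)
  ultimately have up: "ln (k / \<delta>) \<le> 2 * ln k" by simp
  have "0 \<le> ln (k / \<delta>)"
  proof -
    have "1 \<le> 4 / \<epsilon>" using inv_eps by simp
    then have "0 \<le> ln (4 / \<epsilon>)" by simp
    then show ?thesis using \<open>ln (k / \<delta>) = ln k + ln (4 / \<epsilon>)\<close> ln_k by simp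
  qed
  then have "0 \<le> ln (k / \<delta>) / \<delta>" using d by simp
  moreover have "real L = real (nat \<lceil>ln (k / \<delta>) / \<delta>\<rceil>) + 1" by (simp add: L_def)
  ultimately have "real L \<le> ln (k / \<delta>) / \<delta> + 2" using nat_ceiling_bounds(2)[of "ln (k / \<delta>) / \<delta>"] by linarith
  also have "\<dots> \<le> 2 * ln k / \<delta> + 2" using up d by (simp add: divide_right_mono)
  also have "\<dots> \<le> 8 * ln k * (1 / \<epsilon>) + 2 * (ln k * (1 / \<epsilon>))"
  proof -
    have "1 * 1 \<le> ln k * (1 / \<epsilon>)" using ln_k inv_eps by (intro mult_mono) auto
    then show ?thesis by (simp add: \<delta>_def)
  qed
  finally show ?thesis by simp
qed

lemma L_power: "k * (1 - \<delta>) ^ L \<le> \<delta>"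
proof -
  have d: "0 < \<delta>" "\<delta> < 1" using eps by (auto simp: \<delta>_def)
  have "ln (k / \<delta>) / \<delta> \<le> real L" unfolding L_def by linarith
  then have "ln (k / \<delta>) \<le> \<delta> * L" using d by (simp add: divide_le_eq mult.commute)
  then have "(1 - \<delta>) ^ L \<le> exp (- ln (k / \<delta>))" using d by (intro one_minus_power_le) auto
  also have "\<dots> = \<delta> / k" using d k3 by (simp add: exp_minus)
  finally show ?thesis using k3 by (simp add: field_simps)
qed

lemma T_power: "(1 - \<delta>) ^ T * card U < 1"
proof -
  have d: "0 < \<delta>" "\<delta> < 1" using eps by (auto simp: \<delta>_def)
  \<comment> \<open>The extra batch in \<open>T\<close> makes the final inequality strict.\<close>
  have "ln (card U) / \<delta> + 1 \<le> real T" unfolding T_def by linarith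
  then have "(ln (card U) / \<delta> + 1) * \<delta> \<le> T * \<delta>" using d by (intro mult_right_mono) auto
  moreover have "(ln (card U) / \<delta> + 1) * \<delta> = ln (card U) + \<delta>" using d by (simp add: field_simps)
  ultimately have "ln (card U) + \<delta> \<le> \<delta> * T" by (simp add: mult.commute)
  then have "(1 - \<delta>) ^ T \<le> exp (- (ln (card U) + \<delta>))" using d by (intro one_minus_power_le) auto
  also have "\<dots> = exp (- \<delta>) / card U" using card_ground by (simp add: exp_diff exp_minus divide_inverse)
  finally have "(1 - \<delta>) ^ T * card U \<le> exp (- \<delta>)" using card_ground by (simp add: field_simps)
  also have "\<dots> < 1" using d by simp
  finally show ?thesis .
qed

text \<open>\<open>L\<close> short blocks and the remainder of \<open>k div parts\<close> lose at
  most L + 1 times \<open>parts\<close> elements. With L + 1 \<le> 11 ln k / \<epsilon>,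
  \<open>parts\<close> \<le> 3 / \<epsilon> and \<delta> = \<epsilon> / 4, this is at most \<delta>
  times 132 ln k / \<open>\<epsilon> ^ 3\<close>, hence at most \<delta> k.\<close>

lemma budget_ok: "0 < m" "(1 - \<delta>) * k + L * parts \<le> parts * m" "parts * m \<le> k"
proof -
  have lp: "0 < parts" using l_bounds by simp
  have "real (L + 1) * parts \<le> (11 * ln k * (1 / \<epsilon>)) * (3 * (1 / \<epsilon>))"
  proof (rule mult_mono)
    have "1 * 1 \<le> ln k * (1 / \<epsilon>)" using ln_k inv_eps by (intro mult_mono) auto
    then show "real (L + 1) \<le> 11 * ln k * (1 / \<epsilon>)" using L_bound by simp
  qed (use l_bounds ln_k eps in auto)
  also have "\<dots> = \<delta> * (132 * ln k * (1 / \<epsilon>) ^ 3)" using eps by (simp add: \<delta>_def power3_eq_cube)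
  also have "\<dots> \<le> \<delta> * k"
  proof -
    have "132 * ln k * (1 / \<epsilon>) ^ 3 \<le> 192 * ln k * (1 / \<epsilon>) ^ 3" using ln_k eps by (intro mult_right_mono) auto
    then show ?thesis using large' eps by (intro mult_left_mono) (auto simp: \<delta>_def)
  qed
  finally have small: "real (L + 1) * parts \<le> \<delta> * k" .
  have dk: "\<delta> * k \<le> k" using mult_right_mono[of \<delta> 1 "real k"] eps by (simp add: \<delta>_def)
  have "real parts \<le> real (L + 1) * parts" by (simp add: distrib_right)
  then have "real parts \<le> real k" using small dk by linarith
  then show "0 < m" unfolding m_def using lp by (simp add: div_greater_zero_iff)
  have "k < parts * m + parts" unfolding m_def using mult_div_mod_eq[of parts k] mod_less_divisor[OF lp, of k] by linarith
  then have "real k \<le> real (parts * m) + parts" by linarith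
  then show "(1 - \<delta>) * k + L * parts \<le> parts * m" using small by (simp add: algebra_simps)
  show "parts * m \<le> k" unfolding m_def by simp
qed

sublocale threshold_sampling U f \<delta> parts
  using eps l_bounds by unfold_locales (auto simp: \<delta>_def)

abbreviation "stages \<equiv> iter_pmf (stage_pmf U f \<delta> parts T L m) parts {}"

lemma parallel_out:
  assumes Z: "Z \<subseteq> U" "card Z \<le> k"
  shows "\<And>G. G \<in> set_pmf stages \<Longrightarrow> G \<subseteq> U \<and> card G \<le> k"
    and "(1 / exp 1 - \<epsilon>) * f Z \<le> expect stages f"
proof -
  let ?\<beta> = "(1 - \<delta>) ^ 3 / (1 + \<delta>)"
  have b: "0 \<le> ?\<beta>" using delta by simp
  have T0: "0 < T" and L0: "0 < L" by (auto simp: T_def L_def)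
  note sp = stage_props[OF _ Z nonempty T0 T_power L0 L_power budget_ok(1,2)]
  have props: "finite (set_pmf stages) \<and> (\<forall>G'\<in>set_pmf stages. G' \<subseteq> U \<and> card G' \<le> card ({} :: 'a set) + parts * m) \<and>
    (1 - 1 / parts) ^ parts * f {} + parts * (?\<beta> / parts) * (1 - 1 / parts) ^ (parts + 1) * f (Z \<union> {}) \<le> expect stages f"
    using sp by (intro iter_props[OF l_pos b Z(1)]) auto
  show "\<And>G. G \<in> set_pmf stages \<Longrightarrow> G \<subseteq> U \<and> card G \<le> k"
    using props budget_ok(3) by (auto intro: order_trans)
  have "1 - \<epsilon> \<le> ?\<beta>" using one_minus_cube_ge[of \<delta>] delta by (simp add: \<delta>_def)
  moreover have "(1 - \<epsilon>) / exp 1 \<le> (1 - 1 / parts) ^ (parts + 1)"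
  proof -
    have "2 / real parts \<le> \<epsilon>" using l_bounds eps l_pos by (simp add: field_simps)
    then have "(1 - \<epsilon>) / exp 1 \<le> (1 - 2 / parts) / exp 1" by (intro divide_right_mono) auto
    also have "\<dots> \<le> (1 - 1 / parts) ^ (parts + 1)" using l_bounds by (intro one_minus_inverse_power_ge)
    finally show ?thesis .
  qed
  ultimately have "(1 - \<epsilon>) * ((1 - \<epsilon>) / exp 1) \<le> ?\<beta> * (1 - 1 / parts) ^ (parts + 1)"
    using eps b by (intro mult_mono) auto
  \<comment> \<open>One factor 1 - \<epsilon> comes from \<beta>, one from the finite number of
    stages. Since e \<ge> 2, the joint loss 2 \<epsilon> / e is at most \<epsilon>.\<close>
  moreover have "1 / exp 1 - \<epsilon> \<le> (1 - \<epsilon>) * ((1 - \<epsilon>) / exp 1)"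
  proof -
    have "2 \<le> exp (1::real)" using exp_ge_add_one_self[of 1] by simp
    then have "1 - exp 1 * \<epsilon> \<le> 1 - 2 * \<epsilon>" using eps by simp
    also have "\<dots> \<le> (1 - \<epsilon>) * (1 - \<epsilon>)" by (simp add: algebra_simps)
    finally have "(1 - exp 1 * \<epsilon>) / exp 1 \<le> (1 - \<epsilon>) * (1 - \<epsilon>) / exp 1" by (intro divide_right_mono) auto
    moreover have "(1 - exp 1 * \<epsilon>) / exp 1 = 1 / exp 1 - \<epsilon>" by (simp add: diff_divide_distrib)
    ultimately show ?thesis by simp
  qed
  ultimately have "(1 / exp 1 - \<epsilon>) * f Z \<le> ?\<beta> * (1 - 1 / parts) ^ (parts + 1) * f Z"
    using nonneg[OF Z(1)] by (intro mult_right_mono) auto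
  moreover have "0 \<le> (1 - 1 / parts) ^ parts * f {}" using l_pos nonneg[of "{}"] by simp
  ultimately show "(1 / exp 1 - \<epsilon>) * f Z \<le> expect stages f" using props l_pos by simp
qed

lemma parallel_realizes:
  "realizes f (iter_alg (stage_alg U \<delta> parts T L m) parts {}) stages
     (parts * (1 + real L * (1 + real T))) (parts * (real (card U) + 1 + real L * level_queries))"
proof (rule realizes_iter[where I = "\<lambda>G. G \<subseteq> U"])
  show "realizes f (stage_alg U \<delta> parts T L m G) (stage_pmf U f \<delta> parts T L m G) (1 + real L * (1 + real T))
    (real (card U) + 1 + real L * level_queries)" if "G \<subseteq> U" for G
    using that T_power by (rule realizes_stage)
  have T0: "0 < T" and L0: "0 < L" by (auto simp: T_def L_def)
  show "G' \<subseteq> U" if "G \<subseteq> U" "G' \<in> set_pmf (stage_pmf U f \<delta> parts T L m G)" for G G'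
    using stage_props(2)[OF that(1) empty_subsetI _ nonempty T0 T_power L0 L_power budget_ok(1,2) that(2)] by simp
qed simp

text \<open>The estimates give the powers 3 and 4 of 1 / \<epsilon>, which are then raised to 5 and
  6. With at least 3 elements the logarithm is at least 1, so that lower-order summands can be
  absorbed.\<close>

lemma parallel_cost:
  assumes n: "3 \<le> card U"
  shows "parts * (1 + real L * (1 + real T)) \<le> 1000 * (1 / \<epsilon>) ^ 5 * ln (card U) * ln k"
    and "parts * (real (card U) + 1 + real L * level_queries) \<le> 3000 * (1 / \<epsilon>) ^ 6 * card U * ln (card U) * ln k"
proof -
  define x where "x = ln (real k)"
  define y where "y = ln (real (card U))"
  define z where "z = 1 / \<epsilon>"
  define n where "n = real (card U)"
  have "exp 1 \<le> real (card U)" using exp_le assms by linarith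
  then have y: "1 \<le> y" using assms unfolding y_def by (simp add: ln_ge_iff)
  have x: "1 \<le> x" using ln_k by (simp add: x_def)
  have z: "1 \<le> z" using inv_eps by (simp add: z_def)
  have n1: "1 \<le> n" using assms by (simp add: n_def)
  have yz: "1 \<le> y * z" and xyz: "1 \<le> x * y * z * z" and yz2: "1 \<le> y * z * z" and xyz3: "1 \<le> x * y * (z * z * z)"
    using mult_mono[OF y z] mult_mono[OF x mult_mono[OF y mult_mono[OF z z]]]
      mult_mono[OF y mult_mono[OF z z]] mult_mono[OF x mult_mono[OF y mult_mono[OF z mult_mono[OF z z]]]] x y z
    by (simp_all add: mult.assoc)
  have lb: "real parts \<le> 3 * z" using l_bounds by (simp add: z_def)
  have Lb: "real L \<le> 10 * x * z" using L_bound by (simp add: x_def z_def)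
  have Tb: "1 + real T \<le> 7 * (y * z)"
  proof -
    have "0 \<le> y / \<delta>" using y delta by simp
    moreover have "real T = real (nat \<lceil>y / \<delta>\<rceil>) + 1" by (simp add: T_def y_def)
    ultimately have "real T \<le> y / \<delta> + 2" using nat_ceiling_bounds(2)[of "y / \<delta>"] by linarith
    also have "\<dots> = 4 * (y * z) + 2" by (simp add: \<delta>_def z_def)
    finally show ?thesis using yz by simp
  qed
  have "real L * (1 + real T) \<le> (10 * x * z) * (7 * (y * z))"
    using Lb Tb x y z by (intro mult_mono) auto
  then have "1 + real L * (1 + real T) \<le> 71 * (x * y * z * z)" using xyz by (simp add: algebra_simps)
  then have "parts * (1 + real L * (1 + real T)) \<le> (3 * z) * (71 * (x * y * z * z))"
    using lb x y z by (intro mult_mono) auto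
  also have "\<dots> = 213 * z ^ 3 * (x * y)" by (simp add: power3_eq_cube)
  also have "\<dots> \<le> 1000 * z ^ 5 * (x * y)"
    using x y z power_increasing[of 3 5 z] by (intro mult_right_mono mult_mono) auto
  finally show "parts * (1 + real L * (1 + real T)) \<le> 1000 * (1 / \<epsilon>) ^ 5 * ln (card U) * ln k"
    by (simp add: x_def y_def z_def mult_ac)
  have qr: "query_rate \<le> 20 * (y * z)"
  proof -
    have "real (card U) + 1 \<le> real (card U) ^ 2"
    proof -
      have "real (card U) * 2 \<le> real (card U) * real (card U)" using assms by (intro mult_left_mono) auto
      moreover have "real (card U) + 1 \<le> real (card U) * 2" using assms by simp
      ultimately show ?thesis unfolding power2_eq_square by linarith
    qed
    then have "ln (real (card U) + 1) \<le> ln (real (card U) ^ 2)" using assms by (subst ln_le_cancel_iff) auto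
    also have "\<dots> = 2 * y" using assms by (simp add: ln_realpow y_def)
    finally have "2 * ln (real (card U) + 1) / \<delta> \<le> 2 * (2 * y) / \<delta>" using delta by (intro divide_right_mono) auto
    also have "\<dots> = 16 * (y * z)" by (simp add: \<delta>_def z_def)
    finally show ?thesis using yz by (simp add: query_rate_def)
  qed
  have lq: "level_queries \<le> 82 * (n * (y * z * z))"
  proof -
    have "query_rate / \<delta> \<le> 20 * (y * z) / \<delta>" using qr delta by (intro divide_right_mono) auto
    also have "\<dots> = 80 * (y * z * z)" by (simp add: \<delta>_def z_def)
    finally have "query_rate / \<delta> * n \<le> 80 * (y * z * z) * n" using n1 by (intro mult_right_mono) auto
    moreover have "n * 1 \<le> n * (y * z * z)" using n1 yz2 by (intro mult_left_mono) auto
    moreover have "level_queries = n + 1 + query_rate / \<delta> * n" by (simp add: level_queries_def n_def)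
    moreover have "80 * (y * z * z) * n = 80 * (n * (y * z * z))" by simp
    ultimately show ?thesis using n1 by linarith
  qed
  have "real L * level_queries \<le> (10 * x * z) * (82 * (n * (y * z * z)))"
    using Lb lq x y z n1 query_rate_nonneg delta by (intro mult_mono) (auto simp: level_queries_def)
  moreover have "n * 1 \<le> n * (x * y * (z * z * z))" using n1 xyz3 by (intro mult_left_mono) auto
  moreover have "(10 * x * z) * (82 * (n * (y * z * z))) = 820 * (n * (x * y * (z * z * z)))" by simp
  ultimately have "n + 1 + real L * level_queries \<le> 822 * (n * (x * y * (z * z * z)))"
    using n1 by linarith
  then have "parts * (n + 1 + real L * level_queries) \<le> (3 * z) * (822 * (n * (x * y * (z * z * z))))"
    using lb x y z n1 query_rate_nonneg delta by (intro mult_mono) (auto simp: level_queries_def)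
  also have "\<dots> = 2466 * z ^ 4 * (n * x * y)" by (simp add: power4_eq_xxxx)
  also have "\<dots> \<le> 3000 * z ^ 6 * (n * x * y)"
    using x y z n1 power_increasing[of 4 6 z] by (intro mult_right_mono mult_mono) auto
  finally show "parts * (real (card U) + 1 + real L * level_queries) \<le> 3000 * (1 / \<epsilon>) ^ 6 * card U * ln (card U) * ln k"
    by (simp add: x_def y_def z_def n_def mult_ac)
qed

end

text \<open>Since \<epsilon> < 1 / 2, the square is at least 9 / 4. Enlarging e \<epsilon> l - 4 to
  e \<epsilon> l and cancelling \<open>l\<close> gives k e \<epsilon> \<ge> 9 / 4. Thus the loss 2 /
  (e k) of random greedy is below \<epsilon>, and e \<epsilon> < 1 gives k > 2.\<close>

lemma budget_lower_bound:
  fixes k l :: nat and \<epsilon> :: real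
  assumes eps: "0 < \<epsilon>" "\<epsilon> < 1 / exp 1" and l: "0 < l" "4 / (exp 1 * \<epsilon>) \<le> l" "exp 1 * \<epsilon> * l - 4 \<noteq> 0"
    and k: "(2 - \<epsilon>)\<^sup>2 * l / (exp 1 * \<epsilon> * l - 4) \<le> k"
  shows "2 \<le> k * (exp 1 * \<epsilon>)" "3 \<le> k" "\<epsilon> < 1 / 2"
proof -
  have e2: "2 \<le> exp (1::real)" using exp_ge_add_one_self[of 1] by simp
  then have "1 / exp 1 \<le> (1::real) / 2" by (intro divide_left_mono) auto
  then show half: "\<epsilon> < 1 / 2" using eps by linarith
  have pos: "0 < exp 1 * \<epsilon> * l - 4" using l eps by (simp add: field_simps)
  have "(3 / 2)\<^sup>2 \<le> (2 - \<epsilon>)\<^sup>2" using half by (intro power_mono) auto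
  then have "9 / 4 * real l \<le> (2 - \<epsilon>)\<^sup>2 * l" by (intro mult_right_mono) (auto simp: power2_eq_square)
  also have "\<dots> \<le> k * (exp 1 * \<epsilon> * l - 4)" using k pos by (simp add: divide_le_eq)
  also have "\<dots> \<le> k * (exp 1 * \<epsilon> * l)" by (intro mult_left_mono) auto
  finally have "9 / 4 * real l \<le> k * (exp 1 * \<epsilon>) * l" by (simp add: mult.assoc)
  then have main: "9 / 4 \<le> k * (exp 1 * \<epsilon>)" using l by simp
  then show "2 \<le> k * (exp 1 * \<epsilon>)" by linarith
  have "exp 1 * \<epsilon> < 1" using eps by (simp add: field_simps)
  then have "k * (exp 1 * \<epsilon>) \<le> real k * 1" by (intro mult_left_mono) auto
  then have "2 < real k" using main by linarith
  then show "3 \<le> k" by linarith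
qed

theorem theorem5p2:
  "\<exists>alg :: 'a set \<Rightarrow> nat \<Rightarrow> real \<Rightarrow> nat \<Rightarrow> 'a oracle_alg.
     \<forall>C_l :: real. \<exists>C_p C_r C_q :: real.
       \<forall>(U :: 'a set) (f :: 'a set \<Rightarrow> real) (n :: nat) (k :: nat) (\<epsilon> :: real) (l :: nat) (Opt :: 'a set).
         finite U \<longrightarrow> card U = n \<longrightarrow>
         (\<forall>S. S \<subseteq> U \<longrightarrow> 0 \<le> f S) \<longrightarrow> submodular_on U f \<longrightarrow>
         0 < \<epsilon> \<longrightarrow> \<epsilon> < 1 \<longrightarrow> 0 < k \<longrightarrow>
         is_arg_max f (\<lambda>S. S \<subseteq> U \<and> card S \<le> k) Opt \<longrightarrow>
         0 < l \<longrightarrow> real l \<le> C_l / \<epsilon> \<longrightarrow> real l \<ge> 4 / (exp 1 * \<epsilon>) \<longrightarrow>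
         exp 1 * \<epsilon> * real l - 4 \<noteq> 0 \<longrightarrow>
         real k \<ge> (2 - \<epsilon>)\<^sup>2 * real l / (exp 1 * \<epsilon> * real l - 4) \<longrightarrow>
         queries_within U (alg U k \<epsilon> l) \<and>
         (\<forall>(G, r, q) \<in> set_pmf (run f (alg U k \<epsilon> l)). G \<subseteq> U \<and> card G \<le> k) \<and>
         measure_pmf.expectation (run f (alg U k \<epsilon> l)) (\<lambda>(G, r, q). f G)
           \<ge> (1 / exp 1 - \<epsilon>) * f Opt \<and>
         measure_pmf.prob (run f (alg U k \<epsilon> l))
           {(G, r, q). real r \<le> C_r * (1 / \<epsilon> ^ 5) * ln (real n) * ln (real k) \<and>
                       real q \<le> C_q * (1 / \<epsilon> ^ 6) * real n * ln (real n) * ln (real k)}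
           \<ge> 1 - C_p * (1 / (\<epsilon> * real n))"
proof (rule exI[of _ "\<lambda>U k \<epsilon> l. max_alg U k \<epsilon> Return"], rule allI,
    rule exI[of _ 3], rule exI[of _ 1000], rule exI[of _ 3000], intro allI impI)
  fix C_l \<epsilon> :: real and U Opt :: "'a set" and f :: "'a set \<Rightarrow> real" and n k l :: nat
  assume U: "finite U" "card U = n" and f: "\<forall>S. S \<subseteq> U \<longrightarrow> 0 \<le> f S" "submodular_on U f"
    and eps: "0 < \<epsilon>" "\<epsilon> < 1" and k: "0 < k" and Opt: "is_arg_max f (\<lambda>S. S \<subseteq> U \<and> card S \<le> k) Opt"
    and l: "0 < l" "real l \<le> C_l / \<epsilon>" "real l \<ge> 4 / (exp 1 * \<epsilon>)" "exp 1 * \<epsilon> * real l - 4 \<noteq> 0"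
    and kl: "real k \<ge> (2 - \<epsilon>)\<^sup>2 * real l / (exp 1 * \<epsilon> * real l - 4)"
  interpret submodular_fun U f using U f by unfold_locales auto
  have Z: "Opt \<subseteq> U" "card Opt \<le> k" using Opt by (auto simp: is_arg_max_def)
  let ?r = "1000 * (1 / \<epsilon> ^ 5) * ln (real n) * ln (real k)"
  let ?q = "3000 * (1 / \<epsilon> ^ 6) * real n * ln (real n) * ln (real k)"
  have pi: "0 \<le> 3 * (1 / (\<epsilon> * real n))" using eps by simp
  \<comment> \<open>Origin of the constant 3: for \<open>n < 3\<close> the logarithm of
    \<open>n\<close> falls below 1 and is even 0 at \<open>n = 1\<close>, so there the probability
    bound is made empty.\<close>
  have small: "1 \<le> 3 * (1 / (\<epsilon> * real n))" if "0 < n" "n < 3"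
  proof -
    have "\<epsilon> * real n \<le> 1 * 3" using eps that by (intro mult_mono) auto
    then show ?thesis using eps that by (simp add: field_simps)
  qed
  have "\<exists>D R Q. realizes f (max_alg U k \<epsilon>) D R Q \<and> (\<forall>G\<in>set_pmf D. G \<subseteq> U \<and> card G \<le> k) \<and>
      (1 / exp 1 - \<epsilon>) * f Opt \<le> expect D f \<and> (1 \<le> 3 * (1 / (\<epsilon> * real n)) \<or> R \<le> ?r \<and> Q \<le> ?q)"
  proof (cases "U = {} \<or> 1 / exp 1 \<le> \<epsilon>")
    case True
    then have alg: "max_alg U k \<epsilon> = (\<lambda>c. c {})" by (simp add: max_alg_def)
    have "(1 / exp 1 - \<epsilon>) * f Opt \<le> f {}"
    proof (cases "U = {}")
      case True
      then have "Opt = {}" using Z by simp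
      have "1 / exp 1 \<le> (1::real)" by (simp add: divide_le_eq)
      then have "1 / exp 1 - \<epsilon> \<le> 1" using eps by linarith
      then have "(1 / exp 1 - \<epsilon>) * f {} \<le> 1 * f {}" using nonneg[of "{}"] by (intro mult_right_mono) auto
      then show ?thesis using \<open>Opt = {}\<close> by simp
    next
      case False
      then have "(1 / exp 1 - \<epsilon>) * f Opt \<le> 0" using \<open>U = {} \<or> 1 / exp 1 \<le> \<epsilon>\<close> nonneg[OF Z(1)]
        by (intro mult_nonpos_nonneg) auto
      then show ?thesis using nonneg[of "{}"] by simp
    qed
    \<comment> \<open>This covers \<open>n = 0\<close>, where the failure term
      \<open>3 * (1 / 0)\<close> is 0 and the cost bound is due with certainty.\<close>
    moreover have "0 \<le> ?r" "0 \<le> ?q" using k eps by (cases "n = 0", auto)+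
    ultimately show ?thesis unfolding alg using realizes_return[of f "{}"]
      by (intro exI[of _ "return_pmf {}"] exI[of _ 0]) auto
  next
    case False
    then have ne: "U \<noteq> {}" and e1: "\<epsilon> < 1 / exp 1" by auto
    note kb = budget_lower_bound[OF eps(1) e1 l(1,3,4) kl]
    have n0: "0 < n" using ne U by (auto simp: card_gt_0_iff)
    have "exp 1 \<le> real k" using exp_le kb(2) by linarith
    then have x: "1 \<le> ln (real k)" using kb(2) by (simp add: ln_ge_iff)
    have y: "1 \<le> ln (real n)" if "3 \<le> n"
    proof -
      have "exp 1 \<le> real n" using exp_le that by linarith
      then show ?thesis using that by (simp add: ln_ge_iff)
    qed
    show ?thesis
    proof (cases "real k \<le> 192 * ln k / \<epsilon> ^ 3")
      case True
      have alg: "max_alg U k \<epsilon> = iter_alg (greedy_alg U k) k {}" using True False by (simp add: max_alg_def)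
      have "2 \<le> k" using kb(2) by simp
      note gg = greedy_guarantee[OF Z this kb(1)]
      have cost: "real k \<le> ?r \<and> real (k * (card U + 1)) \<le> ?q" if n3: "3 \<le> n"
      proof -
        let ?z = "1 / \<epsilon>"
        have z: "1 \<le> ?z" using eps by simp
        have k1: "real k \<le> 192 * ?z ^ 3 * ln k" using True by (simp add: power_one_over)
        have k2: "192 * ?z ^ 3 * ln k \<le> 192 * ?z ^ i * ln k * ln n" if "3 \<le> i" for i
        proof -
          have "192 * ?z ^ 3 * ln k * 1 \<le> 192 * ?z ^ i * ln k * ln n"
            using x y[OF n3] z eps that power_increasing[of 3 i ?z] by (intro mult_mono) auto
          then show ?thesis by simp
        qed
        have nn: "0 \<le> ?z ^ i * ln k * ln n" for i using x y[OF n3] eps by simp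
        have "real k \<le> 192 * (?z ^ 5 * ln k * ln n)" using k1 k2[of 5] by simp
        also have "\<dots> \<le> 1000 * (?z ^ 5 * ln k * ln n)" using nn by (intro mult_right_mono) auto
        finally have r: "real k \<le> ?r" by (simp add: power_one_over mult_ac)
        have k6: "real k \<le> 192 * (?z ^ 6 * ln k * ln n)" using k1 k2[of 6] by simp
        have "real k * real (card U + 1) \<le> real k * (2 * n)" using n3 U by (intro mult_left_mono) auto
        then have "real (k * (card U + 1)) \<le> real k * (2 * n)" by (simp only: of_nat_mult)
        also have "\<dots> \<le> 192 * (?z ^ 6 * ln k * ln n) * (2 * n)" using k6 by (intro mult_right_mono) auto
        also have "\<dots> = 384 * (?z ^ 6 * ln k * ln n * n)" by simp
        also have "\<dots> \<le> 3000 * (?z ^ 6 * ln k * ln n * n)" using nn by (intro mult_right_mono) auto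
        finally have "real (k * (card U + 1)) \<le> ?q" by (simp add: power_one_over mult_ac)
        then show ?thesis using r by simp
      qed
      have "1 \<le> 3 * (1 / (\<epsilon> * real n)) \<or> real k \<le> ?r \<and> real (k * (card U + 1)) \<le> ?q"
        using cost small[OF n0] by (cases "n < 3") auto
      then show ?thesis unfolding alg using gg by blast
    next
      case large: False
      interpret P: parallel_regime U f k \<epsilon>
        using ne eps kb large by unfold_locales auto
      have alg: "max_alg U k \<epsilon> = iter_alg (stage_alg U P.\<delta> P.parts P.T P.L P.m) P.parts {}"
        using large False by (simp add: max_alg_def Let_def P.\<delta>_def P.parts_def P.T_def P.L_def P.m_def)
      have cost: "1 \<le> 3 * (1 / (\<epsilon> * real n)) \<or> P.parts * (1 + real P.L * (1 + real P.T)) \<le> ?r \<and>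
          P.parts * (real (card U) + 1 + real P.L * P.level_queries) \<le> ?q"
        using P.parallel_cost small[OF n0] U(2) by (cases "n < 3") (simp_all add: power_one_over)
      show ?thesis unfolding alg using P.parallel_realizes P.parallel_out[OF Z] cost by blast
    qed
  qed
  then obtain D R Q where "realizes f (max_alg U k \<epsilon>) D R Q" "\<And>G. G \<in> set_pmf D \<Longrightarrow> G \<subseteq> U \<and> card G \<le> k"
    "(1 / exp 1 - \<epsilon>) * f Opt \<le> expect D f" "1 \<le> 3 * (1 / (\<epsilon> * real n)) \<or> R \<le> ?r \<and> Q \<le> ?q" by blast
  from realizes_final[OF this(1) safe_max_alg this(2-4) pi]
  show "queries_within U (max_alg U k \<epsilon> Return) \<and>
         (\<forall>(G, r, q) \<in> set_pmf (run f (max_alg U k \<epsilon> Return)). G \<subseteq> U \<and> card G \<le> k) \<and>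
         measure_pmf.expectation (run f (max_alg U k \<epsilon> Return)) (\<lambda>(G, r, q). f G)
           \<ge> (1 / exp 1 - \<epsilon>) * f Opt \<and>
         measure_pmf.prob (run f (max_alg U k \<epsilon> Return))
           {(G, r, q). real r \<le> ?r \<and> real q \<le> ?q}
           \<ge> 1 - 3 * (1 / (\<epsilon> * real n))" .
qed

end
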